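(* Let $k\ge0$, let $T$ be a semi-classical arithmetic, and let $X$ be a set of sentences of the language of $\mathsf{HA}$ all belonging to $\mathcal{Q}_{k+1}$. The following are pairwise equivalent: (1) $\mathsf{PA}+X$ is $\mathcal{V}_{k+1}$-conservative over $T+X$; (2) $\mathsf{PA}+X$ is $\Pi_{k+2}$-conservative over $T+X$; (3) $\mathsf{PA}+X$ is $\Sigma_{k+1}$-conservative over $T+X$; (4) $T+X$ is closed under $\mathrm{DNE\text{-}R}(\Sigma_{k+1})$; (5) $T+X$ is closed under $\mathrm{DMLD\text{-}R}(\Pi_{k+1})$; (6) $\mathsf{PA}+X$ is $\mathrm{E}_{k+1}$-conservative over $T+X$; (7) $\mathsf{PA}+X$ is $\mathrm{F}_k$-conservative over $T+X$; (8) $\mathsf{PA}+X$ is $(\Sigma_k\lor\Pi_k)$-conservative over $T+X$; (9) $T+X\vdash\mathrm{LEM}(\Sigma_k)$; (10) $T+X\vdash\mathrm{CD}(\Sigma_k)$; (11) $T+X$ is closed under $\mathrm{CD\text{-}R}(\Sigma_k)$.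
   Context: $\mathsf{HA}$ is intuitionistic first-order arithmetic with function symbols for all primitive recursive functions and logical constants $\forall,\exists,\to,\land,\lor,\perp$ ($\neg\varphi:\equiv\varphi\to\perp$); $\mathsf{PA}$ is $\mathsf{HA}$ plus excluded middle for all formulas. A semi-classical arithmetic is a theory $T$ in the language of $\mathsf{HA}$ with $\mathsf{HA}\subseteq T\subseteq\mathsf{PA}$. $T+X$ adds the sentences of $X$ as axioms. $T'$ is $\Gamma$-conservative over $T$ if every formula of $\Gamma$ provable in $T'$ is provable in $T$. $\Sigma_0=\Pi_0$ = quantifier-free formulas; $\Sigma_{k+1}$ = formulas $\exists x_1\cdots\exists x_n\varphi$, $\varphi\in\Pi_k$; $\Pi_{k+1}$ = formulas $\forall x_1\cdots\forall x_n\varphi$, $\varphi\in\Sigma_k$. $\Sigma_k\lor\Pi_k$ = formulas $\varphi\lor\psi$ with $\varphi\in\Sigma_k$, $\psi\in\Pi_k$. $\mathrm{LEM}(\Sigma_k)$: $\varphi\lor\neg\varphi$ for $\varphi\in\Sigma_k$. $\mathrm{CD}(\Sigma_k)$: the scheme $\forall x(\varphi\lor\psi)\to\varphi\lor\forall x\psi$ for $\varphi,\psi\in\Sigma_k$ with $x$ not free in $\varphi$. Dual of a prenex formula: $\varphi^\perp:\equiv\neg\varphi$ if $\varphi$ is quantifier-free; $(\forall x\varphi)^\perp:\equiv\exists x\varphi^\perp$; $(\exists x\varphi)^\perp:\equiv\forall x\varphi^\perp$. Rules (formulas may contain free variables): $T$ is closed under $\mathrm{DNE\text{-}R}(\Gamma)$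 if $T\vdash\neg\neg\varphi$ implies $T\vdash\varphi$ for all $\varphi\in\Gamma$; under $\mathrm{CD\text{-}R}(\Gamma)$ if $T\vdash\forall x(\varphi\lor\psi)$ implies $T\vdash\varphi\lor\forall x\psi$ for all $\varphi,\psi\in\Gamma$ with $x$ not free in $\varphi$; under $\mathrm{DMLD\text{-}R}(\Gamma)$ if $T\vdash\neg(\varphi\land\psi)$ implies $T\vdash\varphi^\perp\lor\psi^\perp$ for all $\varphi,\psi\in\Gamma$. Degree: an alternation path is a finite sequence of symbols $+,-$ in which they alternate; $i(s)$ is the first symbol of $s$ if nonempty and $\times$ if empty, $s^\perp$ swaps $+$ and $-$, $l(s)$ is the length. $\mathrm{Alt}(\varphi)=\{\langle\rangle\}$ for quantifier-free $\varphi$; otherwise $\mathrm{Alt}(\varphi_1\land\varphi_2)=\mathrm{Alt}(\varphi_1\lor\varphi_2)=\mathrm{Alt}(\varphi_1)\cup\mathrm{Alt}(\varphi_2)$, $\mathrm{Alt}(\varphi_1\to\varphi_2)=\{s^\perp:s\in\mathrm{Alt}(\varphi_1)\}\cup\mathrm{Alt}(\varphi_2)$, $\mathrm{Alt}(\forall x\varphi_1)=\{s\in\mathrm{Alt}(\varphi_1):i(s)=-\}\cup\{-s:s\in\mathrm{Alt}(\varphi_1),i(s)\ne-\}$, $\mathrm{Alt}(\exists x\varphi_1)=\{s\in\mathrm{Alt}(\varphi_1):i(s)=+\}\cup\{+s:s\in\mathrm{Alt}(\varphi_1),i(s)\ne+\}$. $\deg(\varphi)=\max\{l(s):s\in\mathrm{Alt}(\varphi)\}$.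 $\mathrm{F}_k$ = formulas of degree exactly $k$; $\mathrm{F}_k^+$ = degree $\le k$; $\mathrm{E}_{k+1}$ = formulas $\varphi\in\mathrm{F}_{k+1}$ with $i(s)=+$ for all $s\in\mathrm{Alt}(\varphi)$ with $l(s)=k+1$. $\mathcal{R}_0=\mathcal{J}_0=\Sigma_0$; $\mathcal{R}_{k+1},\mathcal{J}_{k+1}$ are simultaneously generated by: every formula of $\mathrm{F}_k^+$ is in both; for $R,R'\in\mathcal{R}_{k+1}$, $J,J'\in\mathcal{J}_{k+1}$: $R\land R',R\lor R',\forall xR,J\to R\in\mathcal{R}_{k+1}$ and $J\land J',J\lor J',\exists xJ,R\to J\in\mathcal{J}_{k+1}$. $\mathcal{Q}_0=\Sigma_0$; $\mathcal{Q}_{k+1}$ is generated by prime formulas and closure under $\land,\lor,\forall x,\exists x$, and $J\to Q$ for $J\in\mathcal{J}_{k+1}$, $Q\in\mathcal{Q}_{k+1}$. $\mathcal{V}_{k+1}$ is generated by $\mathcal{J}_{k+1}$ and closure under $\land$ and $\forall x$. *)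

theory Defs
  imports Main
begin

text \<open>
  Function symbols are the derivations of primitive recursive functions.  \<open>PProj n i\<close> is the
  \<open>i\<close>-th (counting from 0) of the \<open>n\<close>-ary projections; \<open>PComp n g fs\<close> is the \<open>n\<close>-ary composition
  of \<open>g\<close> with \<open>fs\<close> (the arity is recorded because \<open>fs\<close> may be empty); \<open>f = PRec g h\<close> is given by
  \<open>f(0,x) = g(x)\<close> and \<open>f(S y,x) = h(y,f(y,x),x)\<close>.
\<close>

datatype prfun = PZero | PSucc | PProj nat nat | PComp nat prfun "prfun list" | PRec prfun prfun

fun arity :: "prfun \<Rightarrow> nat" where
  "arity PZero = 0"
| "arity PSucc = 1"
| "arity (PProj n i) = n"
| "arity (PComp n g fs) = n"
| "arity (PRec g h) = Suc (arity g)"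

fun wf_prfun :: "prfun \<Rightarrow> bool" where
  "wf_prfun PZero \<longleftrightarrow> True"
| "wf_prfun PSucc \<longleftrightarrow> True"
| "wf_prfun (PProj n i) \<longleftrightarrow> i < n"
| "wf_prfun (PComp n g fs) \<longleftrightarrow>
     wf_prfun g \<and> arity g = length fs \<and> (\<forall>f \<in> set fs. wf_prfun f \<and> arity f = n)"
| "wf_prfun (PRec g h) \<longleftrightarrow> wf_prfun g \<and> wf_prfun h \<and> arity h = arity g + 2"

datatype rtm = RVar nat | RFn prfun "rtm list"

fun wf_rtm :: "rtm \<Rightarrow> bool" where
  "wf_rtm (RVar n) \<longleftrightarrow> True"
| "wf_rtm (RFn f ts) \<longleftrightarrow> wf_prfun f \<and> length ts = arity f \<and> (\<forall>t \<in> set ts. wf_rtm t)"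

fun rsubst :: "(nat \<Rightarrow> rtm) \<Rightarrow> rtm \<Rightarrow> rtm" where
  "rsubst \<sigma> (RVar n) = \<sigma> n"
| "rsubst \<sigma> (RFn f ts) = RFn f (map (rsubst \<sigma>) ts)"

fun rfv :: "rtm \<Rightarrow> nat set" where
  "rfv (RVar n) = {n}"
| "rfv (RFn f ts) = (\<Union>t \<in> set ts. rfv t)"

lemma wf_rsubst: "(\<And>n. wf_rtm (\<sigma> n)) \<Longrightarrow> wf_rtm t \<Longrightarrow> wf_rtm (rsubst \<sigma> t)"
  by (induction t) auto

typedef tm = "{t. wf_rtm t}"
  by (rule exI[of _ "RVar 0"]) simp

setup_lifting type_definition_tm

lift_definition Var :: "nat \<Rightarrow> tm" is RVar by simp
lift_definition zero :: tm is "RFn PZero []" by simp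
lift_definition succ :: "tm \<Rightarrow> tm" is "\<lambda>t. RFn PSucc [t]" by simp
lift_definition tsubst :: "(nat \<Rightarrow> tm) \<Rightarrow> tm \<Rightarrow> tm" is rsubst by (rule wf_rsubst)
lift_definition tfv :: "tm \<Rightarrow> nat set" is rfv .

text \<open>Formulas use de Bruijn indices: \<open>All\<close> and \<open>Ex\<close> bind index 0 of their bodies.\<close>

datatype fm = Eq tm tm | Bot | And fm fm | Or fm fm | Imp fm fm | All fm | Ex fm

abbreviation Neg :: "fm \<Rightarrow> fm" where
  "Neg \<phi> \<equiv> Imp \<phi> Bot"

primrec fv :: "fm \<Rightarrow> nat set" where
  "fv (Eq s t) = tfv s \<union> tfv t"
| "fv Bot = {}"
| "fv (And \<phi> \<psi>) = fv \<phi> \<union> fv \<psi>"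
| "fv (Or \<phi> \<psi>) = fv \<phi> \<union> fv \<psi>"
| "fv (Imp \<phi> \<psi>) = fv \<phi> \<union> fv \<psi>"
| "fv (All \<phi>) = {n. Suc n \<in> fv \<phi>}"
| "fv (Ex \<phi>) = {n. Suc n \<in> fv \<phi>}"

definition sentence :: "fm \<Rightarrow> bool" where
  "sentence \<phi> \<longleftrightarrow> fv \<phi> = {}"

definition up :: "(nat \<Rightarrow> tm) \<Rightarrow> nat \<Rightarrow> tm" where
  "up \<sigma> = case_nat (Var 0) (\<lambda>n. tsubst (\<lambda>m. Var (Suc m)) (\<sigma> n))"

primrec subst :: "(nat \<Rightarrow> tm) \<Rightarrow> fm \<Rightarrow> fm" where
  "subst \<sigma> (Eq s t) = Eq (tsubst \<sigma> s) (tsubst \<sigma> t)"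
| "subst \<sigma> Bot = Bot"
| "subst \<sigma> (And \<phi> \<psi>) = And (subst \<sigma> \<phi>) (subst \<sigma> \<psi>)"
| "subst \<sigma> (Or \<phi> \<psi>) = Or (subst \<sigma> \<phi>) (subst \<sigma> \<psi>)"
| "subst \<sigma> (Imp \<phi> \<psi>) = Imp (subst \<sigma> \<phi>) (subst \<sigma> \<psi>)"
| "subst \<sigma> (All \<phi>) = All (subst (up \<sigma>) \<phi>)"
| "subst \<sigma> (Ex \<phi>) = Ex (subst (up \<sigma>) \<phi>)"

text \<open>
  \<open>shift \<phi>\<close> is \<open>\<phi>\<close> read in a context with one more variable, numbered 0; the formulas
  of the form \<open>shift \<phi>\<close> are those in which the variable 0 is not free.
  \<open>inst \<phi> t\<close> substitutes \<open>t\<close> for the variable 0, for use under a removed quantifier.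
\<close>

definition shift :: "fm \<Rightarrow> fm" where
  "shift = subst (\<lambda>n. Var (Suc n))"

definition inst :: "fm \<Rightarrow> tm \<Rightarrow> fm" where
  "inst \<phi> t = subst (case_nat t Var) \<phi>"

text \<open>
  Natural deduction from axioms \<open>T\<close> and open assumptions \<open>\<Gamma>\<close>.  The eigenvariable conditions
  concern only \<open>\<Gamma>\<close>, so an axiom with free variables has the force of its universal closure.
\<close>

inductive deriv :: "fm set \<Rightarrow> fm set \<Rightarrow> fm \<Rightarrow> bool" for T :: "fm set" where
  Axiom: "\<phi> \<in> T \<Longrightarrow> deriv T \<Gamma> \<phi>"
| Assume: "\<phi> \<in> \<Gamma> \<Longrightarrow> deriv T \<Gamma> \<phi>"
| BotE: "deriv T \<Gamma> Bot \<Longrightarrow> deriv T \<Gamma> \<phi>"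
| AndI: "deriv T \<Gamma> \<phi> \<Longrightarrow> deriv T \<Gamma> \<psi> \<Longrightarrow> deriv T \<Gamma> (And \<phi> \<psi>)"
| AndE1: "deriv T \<Gamma> (And \<phi> \<psi>) \<Longrightarrow> deriv T \<Gamma> \<phi>"
| AndE2: "deriv T \<Gamma> (And \<phi> \<psi>) \<Longrightarrow> deriv T \<Gamma> \<psi>"
| OrI1: "deriv T \<Gamma> \<phi> \<Longrightarrow> deriv T \<Gamma> (Or \<phi> \<psi>)"
| OrI2: "deriv T \<Gamma> \<psi> \<Longrightarrow> deriv T \<Gamma> (Or \<phi> \<psi>)"
| OrE: "deriv T \<Gamma> (Or \<phi> \<psi>) \<Longrightarrow> deriv T (insert \<phi> \<Gamma>) \<chi> \<Longrightarrow> deriv T (insert \<psi> \<Gamma>) \<chi>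
    \<Longrightarrow> deriv T \<Gamma> \<chi>"
| ImpI: "deriv T (insert \<phi> \<Gamma>) \<psi> \<Longrightarrow> deriv T \<Gamma> (Imp \<phi> \<psi>)"
| ImpE: "deriv T \<Gamma> (Imp \<phi> \<psi>) \<Longrightarrow> deriv T \<Gamma> \<phi> \<Longrightarrow> deriv T \<Gamma> \<psi>"
| AllI: "deriv T (shift ` \<Gamma>) \<phi> \<Longrightarrow> deriv T \<Gamma> (All \<phi>)"
| AllE: "deriv T \<Gamma> (All \<phi>) \<Longrightarrow> deriv T \<Gamma> (inst \<phi> t)"
| ExI: "deriv T \<Gamma> (inst \<phi> t) \<Longrightarrow> deriv T \<Gamma> (Ex \<phi>)"
| ExE: "deriv T \<Gamma> (Ex \<phi>) \<Longrightarrow> deriv T (insert \<phi> (shift ` \<Gamma>)) (shift \<chi>) \<Longrightarrow> deriv T \<Gamma> \<chi>"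

definition provable :: "fm set \<Rightarrow> fm \<Rightarrow> bool" (infix "\<turnstile>" 50) where
  "T \<turnstile> \<phi> \<longleftrightarrow> deriv T {} \<phi>"

inductive defining_eq :: "rtm \<Rightarrow> rtm \<Rightarrow> bool" where
  "i < n \<Longrightarrow> length ts = n \<Longrightarrow> defining_eq (RFn (PProj n i) ts) (ts ! i)"
| "defining_eq (RFn (PComp n g fs) ts) (RFn g (map (\<lambda>f. RFn f ts) fs))"
| "defining_eq (RFn (PRec g h) (RFn PZero [] # ts)) (RFn g ts)"
| "defining_eq (RFn (PRec g h) (RFn PSucc [t] # ts))
     (RFn h (t # RFn (PRec g h) (t # ts) # ts))"

inductive_set HA :: "fm set" where
  eq_refl: "Eq t t \<in> HA"
| eq_subst: "Imp (Eq s t) (Imp (inst \<phi> s) (inst \<phi> t)) \<in> HA"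
| succ_not_zero: "Neg (Eq (succ t) zero) \<in> HA"
| succ_inj: "Imp (Eq (succ s) (succ t)) (Eq s t) \<in> HA"
| prim_rec: "defining_eq (Rep_tm s) (Rep_tm t) \<Longrightarrow> Eq s t \<in> HA"
| induction: "Imp (inst \<phi> zero)
    (Imp (All (Imp \<phi> (subst (case_nat (succ (Var 0)) (\<lambda>n. Var (Suc n))) \<phi>))) (All \<phi>)) \<in> HA"

definition LEM :: "fm set \<Rightarrow> fm set" where
  "LEM \<Gamma> = {Or \<phi> (Neg \<phi>) | \<phi>. \<phi> \<in> \<Gamma>}"

definition PA :: "fm set" where
  "PA = HA \<union> LEM UNIV"

text \<open>
  A theory is represented by a set of axioms, and inclusion of theories is inclusion of their
  sets of theorems; \<open>T + X\<close> is \<open>T \<union> X\<close>.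
\<close>

definition subtheory :: "fm set \<Rightarrow> fm set \<Rightarrow> bool" where
  "subtheory S T \<longleftrightarrow> (\<forall>\<phi>. S \<turnstile> \<phi> \<longrightarrow> T \<turnstile> \<phi>)"

definition semi_classical :: "fm set \<Rightarrow> bool" where
  "semi_classical T \<longleftrightarrow> subtheory HA T \<and> subtheory T PA"

definition conservative :: "fm set \<Rightarrow> fm set \<Rightarrow> fm set \<Rightarrow> bool" where
  "conservative \<Gamma> T' T \<longleftrightarrow> (\<forall>\<phi> \<in> \<Gamma>. T' \<turnstile> \<phi> \<longrightarrow> T \<turnstile> \<phi>)"

definition proves_all :: "fm set \<Rightarrow> fm set \<Rightarrow> bool" where
  "proves_all T \<Gamma> \<longleftrightarrow> (\<forall>\<phi> \<in> \<Gamma>. T \<turnstile> \<phi>)"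

primrec qf :: "fm \<Rightarrow> bool" where
  "qf (Eq s t) \<longleftrightarrow> True"
| "qf Bot \<longleftrightarrow> True"
| "qf (And \<phi> \<psi>) \<longleftrightarrow> qf \<phi> \<and> qf \<psi>"
| "qf (Or \<phi> \<psi>) \<longleftrightarrow> qf \<phi> \<and> qf \<psi>"
| "qf (Imp \<phi> \<psi>) \<longleftrightarrow> qf \<phi> \<and> qf \<psi>"
| "qf (All \<phi>) \<longleftrightarrow> False"
| "qf (Ex \<phi>) \<longleftrightarrow> False"

text \<open>
  Quantifier blocks are nonempty, so that the formulas of \<open>Sigma_fm k\<close> and \<open>Pi_fm k\<close> have
  degree exactly \<open>k\<close>.
\<close>

fun Sigma_fm :: "nat \<Rightarrow> fm set" and Pi_fm :: "nat \<Rightarrow> fm set" where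
  "Sigma_fm 0 = {\<phi>. qf \<phi>}"
| "Sigma_fm (Suc k) = {(Ex ^^ n) \<phi> | n \<phi>. n \<ge> 1 \<and> \<phi> \<in> Pi_fm k}"
| "Pi_fm 0 = {\<phi>. qf \<phi>}"
| "Pi_fm (Suc k) = {(All ^^ n) \<phi> | n \<phi>. n \<ge> 1 \<and> \<phi> \<in> Sigma_fm k}"

definition Sigma_or_Pi :: "nat \<Rightarrow> fm set" where
  "Sigma_or_Pi k = {Or \<phi> \<psi> | \<phi> \<psi>. \<phi> \<in> Sigma_fm k \<and> \<psi> \<in> Pi_fm k}"

text \<open>Only meaningful for prenex formulas.\<close>

fun dual :: "fm \<Rightarrow> fm" where
  "dual (All \<phi>) = Ex (dual \<phi>)"
| "dual (Ex \<phi>) = All (dual \<phi>)"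
| "dual \<phi> = Neg \<phi>"

definition CD :: "fm set \<Rightarrow> fm set" where
  "CD \<Gamma> = {Imp (All (Or (shift \<phi>) \<psi>)) (Or \<phi> (All \<psi>)) | \<phi> \<psi>. \<phi> \<in> \<Gamma> \<and> \<psi> \<in> \<Gamma>}"

definition DNE_R :: "fm set \<Rightarrow> fm set \<Rightarrow> bool" where
  "DNE_R \<Gamma> T \<longleftrightarrow> (\<forall>\<phi> \<in> \<Gamma>. T \<turnstile> Neg (Neg \<phi>) \<longrightarrow> T \<turnstile> \<phi>)"

definition CD_R :: "fm set \<Rightarrow> fm set \<Rightarrow> bool" where
  "CD_R \<Gamma> T \<longleftrightarrow>
     (\<forall>\<phi> \<in> \<Gamma>. \<forall>\<psi> \<in> \<Gamma>. T \<turnstile> All (Or (shift \<phi>) \<psi>) \<longrightarrow> T \<turnstile> Or \<phi> (All \<psi>))"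

definition DMLD_R :: "fm set \<Rightarrow> fm set \<Rightarrow> bool" where
  "DMLD_R \<Gamma> T \<longleftrightarrow>
     (\<forall>\<phi> \<in> \<Gamma>. \<forall>\<psi> \<in> \<Gamma>. T \<turnstile> Neg (And \<phi> \<psi>) \<longrightarrow> T \<turnstile> Or (dual \<phi>) (dual \<psi>))"

datatype sign = Plus | Minus

primrec flip :: "sign \<Rightarrow> sign" where
  "flip Plus = Minus"
| "flip Minus = Plus"

text \<open>\<open>None\<close> plays the role of the symbol \<open>\<times>\<close>.\<close>

fun first :: "sign list \<Rightarrow> sign option" where
  "first [] = None"
| "first (a # s) = Some a"

primrec alt :: "fm \<Rightarrow> sign list set" where
  "alt (Eq s t) = {[]}"
| "alt Bot = {[]}"
| "alt (And \<phi> \<psi>) = alt \<phi> \<union> alt \<psi>"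
| "alt (Or \<phi> \<psi>) = alt \<phi> \<union> alt \<psi>"
| "alt (Imp \<phi> \<psi>) = map flip ` alt \<phi> \<union> alt \<psi>"
| "alt (All \<phi>) = {s \<in> alt \<phi>. first s = Some Minus}
     \<union> {Minus # s | s. s \<in> alt \<phi> \<and> first s \<noteq> Some Minus}"
| "alt (Ex \<phi>) = {s \<in> alt \<phi>. first s = Some Plus}
     \<union> {Plus # s | s. s \<in> alt \<phi> \<and> first s \<noteq> Some Plus}"

lemma alt_qf: "qf \<phi> \<Longrightarrow> alt \<phi> = {[]}"
  by (induction \<phi>) auto

lemma finite_alt: "finite (alt \<phi>)"
  by (induction \<phi>) auto

lemma alt_nonempty: "alt \<phi> \<noteq> {}"
  by (induction \<phi>) auto

definition deg :: "fm \<Rightarrow> nat" where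
  "deg \<phi> = Max (length ` alt \<phi>)"

definition F_fm :: "nat \<Rightarrow> fm set" where
  "F_fm k = {\<phi>. deg \<phi> = k}"

definition Fplus_fm :: "nat \<Rightarrow> fm set" where
  "Fplus_fm k = {\<phi>. deg \<phi> \<le> k}"

definition E_fm :: "nat \<Rightarrow> fm set" where
  "E_fm k = {\<phi> \<in> F_fm k. \<forall>s \<in> alt \<phi>. length s = k \<longrightarrow> first s = Some Plus}"

inductive is_R :: "nat \<Rightarrow> fm \<Rightarrow> bool" and is_J :: "nat \<Rightarrow> fm \<Rightarrow> bool" where
  "qf \<phi> \<Longrightarrow> is_R 0 \<phi>"
| "\<phi> \<in> Fplus_fm k \<Longrightarrow> is_R (Suc k) \<phi>"
| "is_R (Suc k) \<phi> \<Longrightarrow> is_R (Suc k) \<psi> \<Longrightarrow> is_R (Suc k) (And \<phi> \<psi>)"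
| "is_R (Suc k) \<phi> \<Longrightarrow> is_R (Suc k) \<psi> \<Longrightarrow> is_R (Suc k) (Or \<phi> \<psi>)"
| "is_R (Suc k) \<phi> \<Longrightarrow> is_R (Suc k) (All \<phi>)"
| "is_J (Suc k) \<phi> \<Longrightarrow> is_R (Suc k) \<psi> \<Longrightarrow> is_R (Suc k) (Imp \<phi> \<psi>)"
| "qf \<phi> \<Longrightarrow> is_J 0 \<phi>"
| "\<phi> \<in> Fplus_fm k \<Longrightarrow> is_J (Suc k) \<phi>"
| "is_J (Suc k) \<phi> \<Longrightarrow> is_J (Suc k) \<psi> \<Longrightarrow> is_J (Suc k) (And \<phi> \<psi>)"
| "is_J (Suc k) \<phi> \<Longrightarrow> is_J (Suc k) \<psi> \<Longrightarrow> is_J (Suc k) (Or \<phi> \<psi>)"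
| "is_J (Suc k) \<phi> \<Longrightarrow> is_J (Suc k) (Ex \<phi>)"
| "is_R (Suc k) \<phi> \<Longrightarrow> is_J (Suc k) \<psi> \<Longrightarrow> is_J (Suc k) (Imp \<phi> \<psi>)"

text \<open>Equations and \<open>Bot\<close> are the prime formulas.\<close>

inductive is_Q :: "nat \<Rightarrow> fm \<Rightarrow> bool" where
  "qf \<phi> \<Longrightarrow> is_Q 0 \<phi>"
| "is_Q (Suc k) (Eq s t)"
| "is_Q (Suc k) Bot"
| "is_Q (Suc k) \<phi> \<Longrightarrow> is_Q (Suc k) \<psi> \<Longrightarrow> is_Q (Suc k) (And \<phi> \<psi>)"
| "is_Q (Suc k) \<phi> \<Longrightarrow> is_Q (Suc k) \<psi> \<Longrightarrow> is_Q (Suc k) (Or \<phi> \<psi>)"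
| "is_Q (Suc k) \<phi> \<Longrightarrow> is_Q (Suc k) (All \<phi>)"
| "is_Q (Suc k) \<phi> \<Longrightarrow> is_Q (Suc k) (Ex \<phi>)"
| "is_J (Suc k) \<phi> \<Longrightarrow> is_Q (Suc k) \<psi> \<Longrightarrow> is_Q (Suc k) (Imp \<phi> \<psi>)"

inductive is_V :: "nat \<Rightarrow> fm \<Rightarrow> bool" where
  "is_J (Suc k) \<phi> \<Longrightarrow> is_V (Suc k) \<phi>"
| "is_V (Suc k) \<phi> \<Longrightarrow> is_V (Suc k) \<psi> \<Longrightarrow> is_V (Suc k) (And \<phi> \<psi>)"
| "is_V (Suc k) \<phi> \<Longrightarrow> is_V (Suc k) (All \<phi>)"

definition Q_fm :: "nat \<Rightarrow> fm set" where
  "Q_fm k = {\<phi>. is_Q k \<phi>}"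

definition V_fm :: "nat \<Rightarrow> fm set" where
  "V_fm k = {\<phi>. is_V k \<phi>}"

definition pairwise_equivalent :: "bool list \<Rightarrow> bool" where
  "pairwise_equivalent Ps \<longleftrightarrow> (\<forall>P \<in> set Ps. \<forall>Q \<in> set Ps. P \<longleftrightarrow> Q)"

end

theory Submission
  imports Defs
begin

text \<open>
  All statements follow from \<open>LEM(\<Sigma>\<^sub>k)\<close>, and each implies it.  From \<open>LEM(\<Sigma>\<^sub>k)\<close>, the theory \<open>T + X\<close> decides
  every formula of degree at most \<open>k\<close>.  In the negative translation with falsity replaced by a formula
  \<open>C\<close>, such a formula \<open>\<phi>\<close> becomes \<open>\<phi> \<or> C\<close>; hence a formula of \<open>\<J>\<^sub>k\<^sub>+\<^sub>1\<close> is translated into one implying its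
  double negation relative to \<open>C\<close>, and a formula of \<open>\<Q>\<^sub>k\<^sub>+\<^sub>1\<close> implies its translation.  So \<open>PA + X \<turnstile> \<phi>\<close> with
  \<open>\<phi> \<in> \<J>\<^sub>k\<^sub>+\<^sub>1\<close> gives \<open>T + X \<turnstile> \<phi>\<close> by the choice \<open>C = \<phi>\<close>.  Conversely, \<open>LEM(\<Sigma>\<^sub>k)\<close> is recovered from the rules
  by induction on the level: over \<open>LEM(\<Sigma>\<^sub>n)\<close>, an instance of excluded middle one level higher is
  equivalent to a prenex formula to which the rule applies.

  Derivability is treated through prime theories, the points of a canonical Kripke model for the
  propositional connectives; quantifiers are handled by their adjunctions with \<open>shift\<close>.
\<close>

section \<open>Substitution, derivations and prime theories\<close>


text \<open>Taking C = \<phi> is Friedman's device: the usual negative translation only yields the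
  double negation of \<phi>, whereas \<open>dn \<phi> \<phi>\<close> implies \<phi>. Since C changes
  with the theorem to be transferred, each axiom of X must imply its translation for all C at once.
  This explains the restriction on premises of implications in Q: the translation of a formula of J
  gives the formula back under \<open>dn C\<close>. The obstacle is the universal quantifier. From
  \<open>All (Or \<phi> (shift C))\<close> one cannot infer \<open>Or (All \<phi>) C\<close>
  intuitionistically, and C is arbitrary. Excluded middle up to degree k decides
  \<open>All \<phi>\<close> instead: if it is refuted there is a counterexample, and there C must
  hold. The rules speak of theorems, not of hypotheses. For DNE and CD the level is therefore raised
  step by step: excluded middle at level n produces a theorem of the prenex form to which the rule
  applies, and this gives level n + 1. DMLD reaches level k in one step.\<close>

lemma rsubst_rsubst: "rsubst \<sigma> (rsubst \<tau> t) = rsubst (\<lambda>n. rsubst \<sigma> (\<tau> n)) t"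
  by (induction t) auto

lemma rsubst_cong: "(\<And>n. n \<in> rfv t \<Longrightarrow> \<sigma> n = \<tau> n) \<Longrightarrow> rsubst \<sigma> t = rsubst \<tau> t"
  by (induction t) auto

lemma rsubst_RVar: "rsubst RVar t = t"
  by (induction t) (auto simp: map_idI)

lemma finite_rfv: "finite (rfv t)"
  by (induction t) auto

lemma tsubst_Var [simp]: "tsubst \<sigma> (Var n) = \<sigma> n"
  by transfer simp

lemma tsubst_zero [simp]: "tsubst \<sigma> zero = zero"
  by transfer simp

lemma tsubst_succ [simp]: "tsubst \<sigma> (succ t) = succ (tsubst \<sigma> t)"
  by transfer simp

lemma tsubst_tsubst [simp]: "tsubst \<sigma> (tsubst \<tau> t) = tsubst (\<lambda>n. tsubst \<sigma> (\<tau> n)) t"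
  by transfer (rule rsubst_rsubst)

lemma tsubst_id [simp]: "tsubst Var t = t"
  by transfer (rule rsubst_RVar)

lemma tsubst_cong: "(\<And>n. n \<in> tfv t \<Longrightarrow> \<sigma> n = \<tau> n) \<Longrightarrow> tsubst \<sigma> t = tsubst \<tau> t"
  by transfer (rule rsubst_cong)

lemma finite_tfv: "finite (tfv t)"
  by transfer (rule finite_rfv)

lemma up_0 [simp]: "up \<sigma> 0 = Var 0"
  by (simp add: up_def)

lemma up_Suc [simp]: "up \<sigma> (Suc n) = tsubst (\<lambda>m. Var (Suc m)) (\<sigma> n)"
  by (simp add: up_def)

lemma up_Var [simp]: "up Var = Var"
  by (rule ext) (simp add: up_def split: nat.split)

lemma up_comp: "(\<lambda>n. tsubst (up \<sigma>) (up \<tau> n)) = up (\<lambda>n. tsubst \<sigma> (\<tau> n))"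
proof
  fix n show "tsubst (up \<sigma>) (up \<tau> n) = up (\<lambda>n. tsubst \<sigma> (\<tau> n)) n"
    by (cases n) simp_all
qed

lemma subst_subst: "subst \<sigma> (subst \<tau> \<phi>) = subst (\<lambda>n. tsubst \<sigma> (\<tau> n)) \<phi>"
  by (induction \<phi> arbitrary: \<sigma> \<tau>) (simp_all add: up_comp)

lemma subst_id [simp]: "subst Var \<phi> = \<phi>"
  by (induction \<phi>) simp_all

lemma subst_cong: "(\<And>n. n \<in> fv \<phi> \<Longrightarrow> \<sigma> n = \<tau> n) \<Longrightarrow> subst \<sigma> \<phi> = subst \<tau> \<phi>"
proof (induction \<phi> arbitrary: \<sigma> \<tau>)
  case (Eq s t)
  then show ?case using tsubst_cong[of s \<sigma> \<tau>] tsubst_cong[of t \<sigma> \<tau>] by simp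
next
  case (All \<phi>)
  have "up \<sigma> n = up \<tau> n" if "n \<in> fv \<phi>" for n using that All.prems by (cases n) auto
  then have "subst (up \<sigma>) \<phi> = subst (up \<tau>) \<phi>" by (rule All.IH)
  then show ?case by simp
next
  case (Ex \<phi>)
  have "up \<sigma> n = up \<tau> n" if "n \<in> fv \<phi>" for n using that Ex.prems by (cases n) auto
  then have "subst (up \<sigma>) \<phi> = subst (up \<tau>) \<phi>" by (rule Ex.IH)
  then show ?case by simp
next
  case (And \<phi> \<psi>)
  have "subst \<sigma> \<phi> = subst \<tau> \<phi>" "subst \<sigma> \<psi> = subst \<tau> \<psi>"
    by (rule And.IH, use And.prems in simp)+
  then show ?case by simp
next
  case (Or \<phi> \<psi>)
  have "subst \<sigma> \<phi> = subst \<tau> \<phi>" "subst \<sigma> \<psi> = subst \<tau> \<psi>"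
    by (rule Or.IH, use Or.prems in simp)+
  then show ?case by simp
next
  case (Imp \<phi> \<psi>)
  have "subst \<sigma> \<phi> = subst \<tau> \<phi>" "subst \<sigma> \<psi> = subst \<tau> \<psi>"
    by (rule Imp.IH, use Imp.prems in simp)+
  then show ?case by simp
qed simp

lemma finite_fv: "finite (fv \<phi>)"
proof (induction \<phi>)
  case (All \<phi>)
  have "fv (All \<phi>) = Suc -` fv \<phi>" by auto
  then show ?case using All finite_vimageI[of "fv \<phi>" Suc] by simp
next
  case (Ex \<phi>)
  have "fv (Ex \<phi>) = Suc -` fv \<phi>" by auto
  then show ?case using Ex finite_vimageI[of "fv \<phi>" Suc] by simp
qed (simp_all add: finite_tfv)

lemma subst_up_inst: "inst (subst (up \<sigma>) \<phi>) t = subst (case_nat t \<sigma>) \<phi>"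
proof -
  have "(\<lambda>n. tsubst (case_nat t Var) (up \<sigma> n)) = case_nat t \<sigma>"
    by (rule ext) (simp split: nat.split)
  then show ?thesis by (simp add: inst_def subst_subst)
qed

lemma inst_shift [simp]: "inst (shift \<phi>) t = \<phi>"
  by (simp add: inst_def shift_def subst_subst)

lemma shift_subst: "subst (up \<sigma>) (shift \<phi>) = shift (subst \<sigma> \<phi>)"
  by (simp add: shift_def subst_subst)

lemma case_nat_Var_0 [simp]: "case_nat (Var 0) (\<lambda>n. Var (Suc n)) = Var"
  by (rule ext) (simp split: nat.split)

lemma inst_up_Var_0 [simp]: "inst (subst (up (\<lambda>n. Var (Suc n))) \<phi>) (Var 0) = \<phi>"
  by (simp add: subst_up_inst)

lemma shift_simps [simp]:
  "shift Bot = Bot"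
  "shift (And \<phi> \<psi>) = And (shift \<phi>) (shift \<psi>)"
  "shift (Or \<phi> \<psi>) = Or (shift \<phi>) (shift \<psi>)"
  "shift (Imp \<phi> \<psi>) = Imp (shift \<phi>) (shift \<psi>)"
  by (simp_all add: shift_def)

section \<open>Weakening and finite support of derivations\<close>

text \<open>No renaming occurs even if \<Delta> mentions every variable: the eigenvariable rules
  shift the whole context away from index 0, and taking images under \<open>shift\<close> is
  monotone.\<close>

lemma deriv_weaken: "deriv T \<Gamma> \<phi> \<Longrightarrow> \<Gamma> \<subseteq> \<Delta> \<Longrightarrow> deriv T \<Delta> \<phi>"
proof (induction arbitrary: \<Delta> rule: deriv.induct)
  case (OrE \<Gamma> \<phi> \<psi> \<chi>) then show ?case by (meson deriv.OrE insert_mono)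
next
  case (ImpI \<phi> \<Gamma> \<psi>) then show ?case by (meson deriv.ImpI insert_mono)
next
  case (AllI \<Gamma> \<phi>) then show ?case by (meson deriv.AllI image_mono)
next
  case (ExE \<Gamma> \<phi> \<chi>) then show ?case by (meson deriv.ExE image_mono insert_mono)
next
  case Axiom then show ?case by (blast intro: deriv.Axiom)
next
  case Assume then show ?case by (blast intro: deriv.Assume)
next
  case BotE then show ?case by (blast intro: deriv.BotE)
next
  case AndE1 then show ?case by (blast intro: deriv.AndE1)
next
  case AndE2 then show ?case by (blast intro: deriv.AndE2)
next
  case OrI1 then show ?case by (blast intro: deriv.OrI1)
next
  case OrI2 then show ?case by (blast intro: deriv.OrI2)
next
  case AllE then show ?case by (blast intro: deriv.AllE)
next
  case ExI then show ?case by (blast intro: deriv.ExI)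
next
  case AndI then show ?case by (blast intro: deriv.AndI)
next
  case ImpE then show ?case by (blast intro: deriv.ImpE)
qed

text \<open>Supplies the chain condition for Zorn's lemma. At the eigenvariable rules, a finite part
  of the shifted context is the image of a finite part of \<Gamma>.\<close>

lemma deriv_finite: "deriv T \<Gamma> \<phi> \<Longrightarrow> \<exists>\<Delta>. finite \<Delta> \<and> \<Delta> \<subseteq> \<Gamma> \<and> deriv T \<Delta> \<phi>"
proof (induction rule: deriv.induct)
  case (Axiom \<phi> \<Gamma>) then show ?case by (meson deriv.Axiom empty_subsetI finite.emptyI)
next
  case (Assume \<phi> \<Gamma>) then show ?case
    by (intro exI[of _ "{\<phi>}"]) (auto intro: deriv.Assume)
next
  case (AndI \<Gamma> \<phi> \<psi>)
  then obtain \<Delta> \<Delta>' where "finite \<Delta>" "\<Delta> \<subseteq> \<Gamma>" "deriv T \<Delta> \<phi>" "finite \<Delta>'" "\<Delta>' \<subseteq> \<Gamma>" "deriv T \<Delta>' \<psi>"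
    by blast
  then show ?case by (intro exI[of _ "\<Delta> \<union> \<Delta>'"]) (auto intro: deriv.AndI deriv_weaken)
next
  case (ImpE \<Gamma> \<phi> \<psi>)
  then obtain \<Delta> \<Delta>' where "finite \<Delta>" "\<Delta> \<subseteq> \<Gamma>" "deriv T \<Delta> (Imp \<phi> \<psi>)"
    "finite \<Delta>'" "\<Delta>' \<subseteq> \<Gamma>" "deriv T \<Delta>' \<phi>"
    by blast
  then have "deriv T (\<Delta> \<union> \<Delta>') (Imp \<phi> \<psi>)" "deriv T (\<Delta> \<union> \<Delta>') \<phi>"
    by (auto intro: deriv_weaken)
  with \<open>finite \<Delta>\<close> \<open>finite \<Delta>'\<close> \<open>\<Delta> \<subseteq> \<Gamma>\<close> \<open>\<Delta>' \<subseteq> \<Gamma>\<close> show ?case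
    by (intro exI[of _ "\<Delta> \<union> \<Delta>'"]) (auto intro: deriv.ImpE)
next
  case (OrE \<Gamma> \<phi> \<psi> \<chi>)
  then obtain \<Delta> \<Delta>1 \<Delta>2 where *: "finite \<Delta>" "\<Delta> \<subseteq> \<Gamma>" "deriv T \<Delta> (Or \<phi> \<psi>)"
    "finite \<Delta>1" "\<Delta>1 \<subseteq> insert \<phi> \<Gamma>" "deriv T \<Delta>1 \<chi>"
    "finite \<Delta>2" "\<Delta>2 \<subseteq> insert \<psi> \<Gamma>" "deriv T \<Delta>2 \<chi>"
    by blast
  \<comment> \<open>Discharged formulas are removed, since they need not belong to \<Gamma>.\<close>
  let ?D = "\<Delta> \<union> (\<Delta>1 - {\<phi>}) \<union> (\<Delta>2 - {\<psi>})"
  have "deriv T ?D (Or \<phi> \<psi>)" "deriv T (insert \<phi> ?D) \<chi>" "deriv T (insert \<psi> ?D) \<chi>"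
    using *(3,6,9) by (auto intro: deriv_weaken)
  then have "deriv T ?D \<chi>" by (rule deriv.OrE)
  then show ?case using * by (intro exI[of _ ?D]) auto
next
  case (ImpI \<phi> \<Gamma> \<psi>)
  then obtain \<Delta> where *: "finite \<Delta>" "\<Delta> \<subseteq> insert \<phi> \<Gamma>" "deriv T \<Delta> \<psi>" by blast
  then have "deriv T (insert \<phi> (\<Delta> - {\<phi>})) \<psi>" by (auto intro: deriv_weaken)
  then show ?case using * by (intro exI[of _ "\<Delta> - {\<phi>}"]) (auto intro: deriv.ImpI)
next
  case (AllI \<Gamma> \<phi>)
  then obtain \<Delta> where "finite \<Delta>" "\<Delta> \<subseteq> shift ` \<Gamma>" "deriv T \<Delta> \<phi>" by blast
  then show ?case by (metis deriv.AllI finite_subset_image)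
next
  case (ExE \<Gamma> \<phi> \<chi>)
  then obtain \<Delta> \<Delta>' where *: "finite \<Delta>" "\<Delta> \<subseteq> \<Gamma>" "deriv T \<Delta> (Ex \<phi>)"
    "finite \<Delta>'" "\<Delta>' \<subseteq> insert \<phi> (shift ` \<Gamma>)" "deriv T \<Delta>' (shift \<chi>)" by blast
  obtain \<Delta>2 where d2: "finite \<Delta>2" "\<Delta>2 \<subseteq> \<Gamma>" "\<Delta>' - {\<phi>} = shift ` \<Delta>2"
    using *(4,5) finite_subset_image[of "\<Delta>' - {\<phi>}" shift \<Gamma>] by blast
  have "deriv T (insert \<phi> (shift ` (\<Delta> \<union> \<Delta>2))) (shift \<chi>)"
    using *(6) by (rule deriv_weaken) (use d2 in auto)
  moreover have "deriv T (\<Delta> \<union> \<Delta>2) (Ex \<phi>)" using *(3) by (rule deriv_weaken) auto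
  ultimately have "deriv T (\<Delta> \<union> \<Delta>2) \<chi>" using deriv.ExE by blast
  then show ?case using * d2 by (intro exI[of _ "\<Delta> \<union> \<Delta>2"]) auto
next
  case BotE then show ?case by (meson deriv.BotE)
next
  case AndE1 then show ?case by (meson deriv.AndE1)
next
  case AndE2 then show ?case by (meson deriv.AndE2)
next
  case OrI1 then show ?case by (meson deriv.OrI1)
next
  case OrI2 then show ?case by (meson deriv.OrI2)
next
  case AllE then show ?case by (meson deriv.AllE)
next
  case ExI then show ?case by (meson deriv.ExI)
qed

section \<open>Prime theories as worlds of the canonical model\<close>

text \<open>No witness property is imposed for \<open>Ex\<close>, so only the connectives get Kripke
  clauses. This avoids fresh constants; the quantifiers are handled through
  \<open>shift\<close>.\<close>

definition prime_theories :: "fm set \<Rightarrow> fm set set" where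
  "prime_theories S = {M. (\<forall>\<phi>. deriv S M \<phi> \<longrightarrow> \<phi> \<in> M) \<and> Bot \<notin> M \<and>
     (\<forall>\<phi> \<psi>. Or \<phi> \<psi> \<in> M \<longrightarrow> \<phi> \<in> M \<or> \<psi> \<in> M)}"

lemma deriv_cut: "deriv S \<Gamma> \<phi> \<Longrightarrow> deriv S (insert \<phi> \<Gamma>) \<psi> \<Longrightarrow> deriv S \<Gamma> \<psi>"
  by (rule deriv.ImpE[OF deriv.ImpI])

text \<open>A set maximal among those that do not derive \<chi> is prime: any formula outside it
  derives \<chi> once added, so both disjuncts of a member cannot lie outside.\<close>

lemma prime_extension:
  assumes "\<not> deriv S \<Gamma> \<chi>"
  shows "\<exists>M \<in> prime_theories S. \<Gamma> \<subseteq> M \<and> \<chi> \<notin> M"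
proof -
  let ?A = "{M. \<Gamma> \<subseteq> M \<and> \<not> deriv S M \<chi>}"
  have "\<exists>M\<in>?A. \<forall>N\<in>?A. M \<subseteq> N \<longrightarrow> N = M"
  proof (rule subset_Zorn_nonempty)
    show "?A \<noteq> {}" using assms by auto
    fix C assume C: "C \<noteq> {}" "subset.chain ?A C"
    have "\<not> deriv S (\<Union>C) \<chi>"
    proof
      assume "deriv S (\<Union>C) \<chi>"
      from deriv_finite[OF this]
      obtain \<Delta> where \<Delta>: "finite \<Delta>" "\<Delta> \<subseteq> \<Union>C" "deriv S \<Delta> \<chi>" by blast
      obtain M where "M \<in> C" "\<Delta> \<subseteq> M"
        using finite_subset_Union_chain[OF \<Delta>(1,2) C] by blast
      then have "deriv S M \<chi>" "M \<in> ?A"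
        using deriv_weaken[OF \<Delta>(3)] C(2) by (auto simp: subset.chain_def)
      then show False by simp
    qed
    moreover have "\<Gamma> \<subseteq> \<Union>C" using C unfolding subset.chain_def by blast
    ultimately show "\<Union>C \<in> ?A" by simp
  qed
  then obtain M where M: "\<Gamma> \<subseteq> M" "\<not> deriv S M \<chi>"
    and max: "\<And>N. \<Gamma> \<subseteq> N \<Longrightarrow> \<not> deriv S N \<chi> \<Longrightarrow> M \<subseteq> N \<Longrightarrow> N = M" by auto
  have ext: "deriv S (insert \<phi> M) \<chi>" if "\<phi> \<notin> M" for \<phi>
    using max[of "insert \<phi> M"] M(1) that by blast
  have closed: "\<phi> \<in> M" if "deriv S M \<phi>" for \<phi>
    using ext deriv_cut that M(2) by blast
  have "\<phi> \<in> M \<or> \<psi> \<in> M" if "Or \<phi> \<psi> \<in> M" for \<phi> \<psi>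
    using that ext[of \<phi>] ext[of \<psi>] M(2) by (meson deriv.Assume deriv.OrE)
  moreover have "Bot \<notin> M" using M(2) by (meson deriv.Assume deriv.BotE)
  ultimately have "M \<in> prime_theories S" using closed by (simp add: prime_theories_def)
  moreover have "\<chi> \<notin> M" using M(2) deriv.Assume by blast
  ultimately show ?thesis using M(1) by blast
qed

lemma prime_closed: "M \<in> prime_theories S \<Longrightarrow> deriv S M \<phi> \<Longrightarrow> \<phi> \<in> M"
  by (simp add: prime_theories_def)

text \<open>Completeness with respect to these worlds: propositional intuitionistic steps become
  membership facts that automation can settle.\<close>

lemma deriv_iff: "deriv S \<Gamma> \<phi> \<longleftrightarrow> (\<forall>M \<in> prime_theories S. \<Gamma> \<subseteq> M \<longrightarrow> \<phi> \<in> M)"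
proof
  assume "deriv S \<Gamma> \<phi>"
  then show "\<forall>M \<in> prime_theories S. \<Gamma> \<subseteq> M \<longrightarrow> \<phi> \<in> M"
    using deriv_weaken prime_closed by blast
next
  assume "\<forall>M \<in> prime_theories S. \<Gamma> \<subseteq> M \<longrightarrow> \<phi> \<in> M"
  then show "deriv S \<Gamma> \<phi>" using prime_extension[of S \<Gamma> \<phi>] by blast
qed

lemma provable_iff: "S \<turnstile> \<phi> \<longleftrightarrow> (\<forall>M \<in> prime_theories S. \<phi> \<in> M)"
  by (simp add: provable_def deriv_iff)

lemma prime_Bot: "M \<in> prime_theories S \<Longrightarrow> Bot \<notin> M"
  by (simp add: prime_theories_def)

lemma prime_member: "M \<in> prime_theories S \<Longrightarrow> \<phi> \<in> M \<longleftrightarrow> deriv S M \<phi>"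
  using prime_closed deriv.Assume by blast

lemma prime_And: "M \<in> prime_theories S \<Longrightarrow> And \<phi> \<psi> \<in> M \<longleftrightarrow> \<phi> \<in> M \<and> \<psi> \<in> M"
  using prime_member[of M S] deriv.AndE1[of S M \<phi> \<psi>] deriv.AndE2[of S M \<phi> \<psi>]
    deriv.AndI[of S M \<phi> \<psi>] by auto

lemma prime_Or: "M \<in> prime_theories S \<Longrightarrow> Or \<phi> \<psi> \<in> M \<longleftrightarrow> \<phi> \<in> M \<or> \<psi> \<in> M"
proof
  assume M: "M \<in> prime_theories S"
  { assume "Or \<phi> \<psi> \<in> M" then show "\<phi> \<in> M \<or> \<psi> \<in> M" using M unfolding prime_theories_def by blast }
  { assume "\<phi> \<in> M \<or> \<psi> \<in> M"
    then have "deriv S M (Or \<phi> \<psi>)" by (metis deriv.Assume deriv.OrI1 deriv.OrI2)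
    then show "Or \<phi> \<psi> \<in> M" by (rule prime_closed[OF M]) }
qed

lemma prime_Imp: "M \<in> prime_theories S \<Longrightarrow>
    Imp \<phi> \<psi> \<in> M \<longleftrightarrow> (\<forall>N \<in> prime_theories S. M \<subseteq> N \<longrightarrow> \<phi> \<in> N \<longrightarrow> \<psi> \<in> N)"
proof
  assume M: "M \<in> prime_theories S"
  { assume "Imp \<phi> \<psi> \<in> M"
    then show "\<forall>N \<in> prime_theories S. M \<subseteq> N \<longrightarrow> \<phi> \<in> N \<longrightarrow> \<psi> \<in> N"
      by (meson deriv.Assume deriv.ImpE prime_closed subsetD) }
  { assume "\<forall>N \<in> prime_theories S. M \<subseteq> N \<longrightarrow> \<phi> \<in> N \<longrightarrow> \<psi> \<in> N"
    then have "deriv S (insert \<phi> M) \<psi>" by (simp add: deriv_iff)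
    then show "Imp \<phi> \<psi> \<in> M" using M deriv.ImpI prime_closed by blast }
qed

lemmas prime_simps = prime_Bot prime_And prime_Or prime_Imp

lemma prime_inst_All: "M \<in> prime_theories S \<Longrightarrow> All \<phi> \<in> M \<Longrightarrow> inst \<phi> t \<in> M"
  using prime_member[of M S] deriv.AllE[of S M \<phi> t] by auto

lemma prime_inst_Ex: "M \<in> prime_theories S \<Longrightarrow> inst \<phi> t \<in> M \<Longrightarrow> Ex \<phi> \<in> M"
  using prime_member[of M S] deriv.ExI[of S M \<phi> t] by auto

text \<open>Instantiating at \<open>Var 0\<close> undoes the shift of the body and returns \<phi>
  with its own free variable 0. Together with \<open>prime_shift_Ex\<close> this replaces the Kripke
  clauses that quantifiers lack.\<close>

lemma prime_shift_All: "M \<in> prime_theories S \<Longrightarrow> shift (All \<phi>) \<in> M \<Longrightarrow> \<phi> \<in> M"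
  using prime_inst_All[of M S "subst (up (\<lambda>n. Var (Suc n))) \<phi>" "Var 0"] by (simp add: shift_def)

lemma prime_shift_Ex: "M \<in> prime_theories S \<Longrightarrow> \<phi> \<in> M \<Longrightarrow> shift (Ex \<phi>) \<in> M"
  using prime_inst_Ex[of M S "subst (up (\<lambda>n. Var (Suc n))) \<phi>" "Var 0"] by (simp add: shift_def)

lemma provable_Imp_iff: "S \<turnstile> Imp \<phi> \<psi> \<longleftrightarrow> (\<forall>M \<in> prime_theories S. \<phi> \<in> M \<longrightarrow> \<psi> \<in> M)"
  by (auto simp: provable_iff prime_Imp)

lemma Imp_All_I: "S \<turnstile> Imp (shift \<chi>) \<phi> \<Longrightarrow> S \<turnstile> Imp \<chi> (All \<phi>)"
proof -
  assume "S \<turnstile> Imp (shift \<chi>) \<phi>"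
  then have "deriv S (shift ` {\<chi>}) \<phi>" by (simp add: provable_Imp_iff deriv_iff)
  then show ?thesis unfolding provable_def by (intro deriv.ImpI deriv.AllI)
qed

lemma Imp_Ex_I: "S \<turnstile> Imp \<phi> (shift \<chi>) \<Longrightarrow> S \<turnstile> Imp (Ex \<phi>) \<chi>"
proof -
  assume "S \<turnstile> Imp \<phi> (shift \<chi>)"
  then have "deriv S (insert \<phi> (shift ` {Ex \<phi>})) (shift \<chi>)" by (simp add: provable_Imp_iff deriv_iff)
  then show ?thesis unfolding provable_def by (meson deriv.ImpI deriv.ExE deriv.Assume insertI1)
qed

section \<open>Closure of theorems under substitution and change of axioms\<close>

text \<open>The n outer quantifiers go first, by the induction hypothesis for the tail of \<sigma>;
  the remaining innermost one binds index 0 and receives \<open>\<sigma> 0\<close>.\<close>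

lemma deriv_inst_many:
  "deriv S \<Gamma> ((All ^^ n) \<phi>) \<Longrightarrow> deriv S \<Gamma> (subst (\<lambda>i. if i < n then \<sigma> i else Var (i - n)) \<phi>)"
proof (induction n arbitrary: \<phi> \<sigma>)
  case 0 then show ?case by simp
next
  case (Suc n)
  let ?\<tau> = "\<lambda>i. if i < n then \<sigma> (Suc i) else Var (i - n)"
  have "deriv S \<Gamma> ((All ^^ n) (All \<phi>))" using Suc.prems by (simp add: funpow_swap1)
  from Suc.IH[OF this, of "\<lambda>i. \<sigma> (Suc i)"] have "deriv S \<Gamma> (All (subst (up ?\<tau>) \<phi>))" by simp
  then have "deriv S \<Gamma> (subst (case_nat (\<sigma> 0) ?\<tau>) \<phi>)" by (metis deriv.AllE subst_up_inst)
  moreover have "case_nat (\<sigma> 0) ?\<tau> = (\<lambda>i. if i < Suc n then \<sigma> i else Var (i - Suc n))"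
    by (rule ext) (simp split: nat.split)
  ultimately show ?case by simp
qed

text \<open>The axioms are not assumed closed under substitution, so a derivation cannot simply be
  substituted into. Without open assumptions all free variables can be generalised and then
  instantiated simultaneously.\<close>

lemma provable_subst: "S \<turnstile> \<phi> \<Longrightarrow> S \<turnstile> subst \<sigma> \<phi>"
proof -
  assume *: "S \<turnstile> \<phi>"
  obtain n where n: "\<forall>i \<in> fv \<phi>. i < n" using finite_fv finite_nat_set_iff_bounded by blast
  have "S \<turnstile> (All ^^ m) \<phi>" for m
    by (induction m) (use * in \<open>simp_all add: provable_def deriv.AllI\<close>)
  then have "S \<turnstile> subst (\<lambda>i. if i < n then \<sigma> i else Var (i - n)) \<phi>"
    unfolding provable_def by (rule deriv_inst_many)
  moreover have "subst (\<lambda>i. if i < n then \<sigma> i else Var (i - n)) \<phi> = subst \<sigma> \<phi>"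
    using n by (intro subst_cong) auto
  ultimately show ?thesis by simp
qed

lemma provable_shift: "S \<turnstile> \<phi> \<Longrightarrow> S \<turnstile> shift \<phi>"
  unfolding shift_def by (rule provable_subst)

lemma provable_All: "S \<turnstile> All \<phi> \<longleftrightarrow> S \<turnstile> \<phi>"
proof
  assume "S \<turnstile> \<phi>" then show "S \<turnstile> All \<phi>" by (simp add: provable_def deriv.AllI)
next
  assume "S \<turnstile> All \<phi>"
  then have "S \<turnstile> shift (All \<phi>)" by (rule provable_shift)
  then show "S \<turnstile> \<phi>" using prime_shift_All[of _ S \<phi>] by (simp add: provable_iff)
qed

lemma deriv_trans:
  assumes "deriv T \<Gamma> \<phi>" and T: "\<And>\<psi>. \<psi> \<in> T \<Longrightarrow> S \<turnstile> \<psi>"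
  shows "deriv S \<Gamma> \<phi>"
  using assms(1)
proof (induction rule: deriv.induct)
  case (Axiom \<phi> \<Gamma>)
  then show ?case using T[of \<phi>] deriv_weaken[of S "{}" \<phi> \<Gamma>] by (simp add: provable_def)
next
  case Assume then show ?case by (rule deriv.Assume)
next
  case BotE from BotE.IH show ?case by (rule deriv.BotE)
next
  case AndE1 from AndE1.IH show ?case by (rule deriv.AndE1)
next
  case AndE2 from AndE2.IH show ?case by (rule deriv.AndE2)
next
  case OrI1 from OrI1.IH show ?case by (rule deriv.OrI1)
next
  case OrI2 from OrI2.IH show ?case by (rule deriv.OrI2)
next
  case AllE from AllE.IH show ?case by (rule deriv.AllE)
next
  case ExI from ExI.IH show ?case by (rule deriv.ExI)
next
  case AndI from AndI.IH show ?case by (rule deriv.AndI)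
next
  case ImpE from ImpE.IH show ?case by (rule deriv.ImpE)
next
  case OrE from OrE.IH show ?case by (rule deriv.OrE)
next
  case ImpI from ImpI.IH show ?case by (rule deriv.ImpI)
next
  case AllI from AllI.IH show ?case by (rule deriv.AllI)
next
  case ExE from ExE.IH show ?case by (rule deriv.ExE)
qed

lemma provable_trans: "T \<turnstile> \<phi> \<Longrightarrow> (\<And>\<psi>. \<psi> \<in> T \<Longrightarrow> S \<turnstile> \<psi>) \<Longrightarrow> S \<turnstile> \<phi>"
  unfolding provable_def[of T] provable_def[of S \<phi>] by (rule deriv_trans)

lemma provable_axiom: "\<phi> \<in> S \<Longrightarrow> S \<turnstile> \<phi>"
  by (simp add: provable_def deriv.Axiom)

lemma provable_MP: "S \<turnstile> Imp \<phi> \<psi> \<Longrightarrow> S \<turnstile> \<phi> \<Longrightarrow> S \<turnstile> \<psi>"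
  unfolding provable_def by (rule deriv.ImpE)

section \<open>Provable equivalence and decidability\<close>


lemma shift_AllD: "shift (All \<phi>) \<in> M \<Longrightarrow> M \<in> prime_theories S \<Longrightarrow> \<phi> \<in> M"
  by (rule prime_shift_All)

text \<open>The quantifiers are the two adjoints of \<open>shift\<close>; with
  \<open>Imp_Ex_iff\<close> this carries the quantifier reasoning below.\<close>

lemma Imp_All_iff: "S \<turnstile> Imp \<chi> (All \<phi>) \<longleftrightarrow> S \<turnstile> Imp (shift \<chi>) \<phi>"
  using provable_shift[of S "Imp \<chi> (All \<phi>)"] Imp_All_I[of S \<chi> \<phi>] prime_shift_All[of _ S \<phi>]
  by (auto simp: provable_Imp_iff)

lemma Imp_Ex_iff: "S \<turnstile> Imp (Ex \<phi>) \<chi> \<longleftrightarrow> S \<turnstile> Imp \<phi> (shift \<chi>)"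
  using provable_shift[of S "Imp (Ex \<phi>) \<chi>"] Imp_Ex_I[of S \<phi> \<chi>] prime_shift_Ex[of _ S \<phi>]
  by (auto simp: provable_Imp_iff)

lemma Imp_trans: "S \<turnstile> Imp \<phi> \<psi> \<Longrightarrow> S \<turnstile> Imp \<psi> \<chi> \<Longrightarrow> S \<turnstile> Imp \<phi> \<chi>"
  by (simp add: provable_Imp_iff)

lemma Imp_curry: "S \<turnstile> Imp (And \<phi> \<psi>) \<chi> \<longleftrightarrow> S \<turnstile> Imp \<phi> (Imp \<psi> \<chi>)"
proof
  assume "S \<turnstile> Imp (And \<phi> \<psi>) \<chi>" then show "S \<turnstile> Imp \<phi> (Imp \<psi> \<chi>)"
    by (auto simp: provable_Imp_iff prime_simps)
next
  assume "S \<turnstile> Imp \<phi> (Imp \<psi> \<chi>)" then show "S \<turnstile> Imp (And \<phi> \<psi>) \<chi>"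
    by (auto simp: provable_Imp_iff prime_simps)
qed

definition eqv :: "fm set \<Rightarrow> fm \<Rightarrow> fm \<Rightarrow> bool" where
  "eqv S \<phi> \<psi> \<longleftrightarrow> S \<turnstile> Imp \<phi> \<psi> \<and> S \<turnstile> Imp \<psi> \<phi>"

definition decidable :: "fm set \<Rightarrow> fm \<Rightarrow> bool" where
  "decidable S \<phi> \<longleftrightarrow> S \<turnstile> Or \<phi> (Neg \<phi>)"

lemma eqvI: "S \<turnstile> Imp \<phi> \<psi> \<Longrightarrow> S \<turnstile> Imp \<psi> \<phi> \<Longrightarrow> eqv S \<phi> \<psi>"
  by (simp add: eqv_def)

lemma eqv_iff: "eqv S \<phi> \<psi> \<longleftrightarrow> (\<forall>M \<in> prime_theories S. \<phi> \<in> M \<longleftrightarrow> \<psi> \<in> M)"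
  by (auto simp: eqv_def provable_Imp_iff)

lemma decidable_iff: "decidable S \<phi> \<longleftrightarrow>
    (\<forall>M \<in> prime_theories S. \<phi> \<in> M \<or> (\<forall>N \<in> prime_theories S. M \<subseteq> N \<longrightarrow> \<phi> \<notin> N))"
  by (auto simp: decidable_def provable_iff prime_simps)

lemma eqv_refl: "eqv S \<phi> \<phi>"
  by (simp add: eqv_iff)

lemma eqv_sym: "eqv S \<phi> \<psi> \<Longrightarrow> eqv S \<psi> \<phi>"
  by (simp add: eqv_iff)

lemma eqv_trans: "eqv S \<phi> \<psi> \<Longrightarrow> eqv S \<psi> \<chi> \<Longrightarrow> eqv S \<phi> \<chi>"
  by (simp add: eqv_iff)

lemma eqv_provable: "eqv S \<phi> \<psi> \<Longrightarrow> S \<turnstile> \<phi> \<longleftrightarrow> S \<turnstile> \<psi>"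
  by (auto simp: eqv_iff provable_iff)

lemma eqv_subst: "eqv S \<phi> \<psi> \<Longrightarrow> eqv S (subst \<sigma> \<phi>) (subst \<sigma> \<psi>)"
  unfolding eqv_def using provable_subst[of S _ \<sigma>] by (metis subst.simps(5))

lemma eqv_shift: "eqv S \<phi> \<psi> \<Longrightarrow> eqv S (shift \<phi>) (shift \<psi>)"
  unfolding shift_def by (rule eqv_subst)

lemma eqv_And: "eqv S \<phi> \<phi>' \<Longrightarrow> eqv S \<psi> \<psi>' \<Longrightarrow> eqv S (And \<phi> \<psi>) (And \<phi>' \<psi>')"
  by (simp add: eqv_iff prime_simps)

lemma eqv_Or: "eqv S \<phi> \<phi>' \<Longrightarrow> eqv S \<psi> \<psi>' \<Longrightarrow> eqv S (Or \<phi> \<psi>) (Or \<phi>' \<psi>')"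
  by (simp add: eqv_iff prime_simps)

lemma eqv_Imp: "eqv S \<phi> \<phi>' \<Longrightarrow> eqv S \<psi> \<psi>' \<Longrightarrow> eqv S (Imp \<phi> \<psi>) (Imp \<phi>' \<psi>')"
  by (simp add: eqv_iff prime_simps)

lemma Imp_All_mono: "S \<turnstile> Imp \<phi> \<psi> \<Longrightarrow> S \<turnstile> Imp (All \<phi>) (All \<psi>)"
  unfolding Imp_All_iff by (auto simp: provable_Imp_iff dest: shift_AllD)

lemma Imp_Ex_mono: "S \<turnstile> Imp \<phi> \<psi> \<Longrightarrow> S \<turnstile> Imp (Ex \<phi>) (Ex \<psi>)"
  unfolding Imp_Ex_iff by (auto simp: provable_Imp_iff intro: prime_shift_Ex)

lemma eqv_All: "eqv S \<phi> \<psi> \<Longrightarrow> eqv S (All \<phi>) (All \<psi>)"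
  by (simp add: eqv_def Imp_All_mono)

lemma eqv_Ex: "eqv S \<phi> \<psi> \<Longrightarrow> eqv S (Ex \<phi>) (Ex \<psi>)"
  by (simp add: eqv_def Imp_Ex_mono)

text \<open>Instantiation at \<open>zero\<close> expresses that the domain is inhabited. Dummy
  quantifiers are therefore harmless and can pad formulas to higher classes.\<close>

lemma eqv_All_shift: "eqv S (All (shift \<phi>)) \<phi>"
proof (rule eqvI)
  show "S \<turnstile> Imp (All (shift \<phi>)) \<phi>"
    using prime_inst_All[of _ S "shift \<phi>" zero] by (simp add: provable_Imp_iff)
  show "S \<turnstile> Imp \<phi> (All (shift \<phi>))" unfolding Imp_All_iff by (simp add: provable_Imp_iff)
qed

lemma eqv_Ex_shift: "eqv S (Ex (shift \<phi>)) \<phi>"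
proof (rule eqvI)
  show "S \<turnstile> Imp \<phi> (Ex (shift \<phi>))"
    using prime_inst_Ex[of _ S "shift \<phi>" zero] by (simp add: provable_Imp_iff)
  show "S \<turnstile> Imp (Ex (shift \<phi>)) \<phi>" unfolding Imp_Ex_iff by (simp add: provable_Imp_iff)
qed

lemma eqv_And_Ex: "eqv S (And (Ex \<phi>) \<psi>) (Ex (And \<phi> (shift \<psi>)))"
proof (rule eqvI)
  show "S \<turnstile> Imp (And (Ex \<phi>) \<psi>) (Ex (And \<phi> (shift \<psi>)))"
    \<comment> \<open>Currying isolates \<open>Ex \<phi>\<close> as the premise, so that the
      adjunction applies; uncurrying then restores the conjunction.\<close>
    unfolding Imp_curry unfolding Imp_Ex_iff shift_simps unfolding Imp_curry[symmetric]
    by (auto simp: provable_Imp_iff intro: prime_shift_Ex)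
  show "S \<turnstile> Imp (Ex (And \<phi> (shift \<psi>))) (And (Ex \<phi>) \<psi>)"
    unfolding Imp_Ex_iff by (auto simp: provable_Imp_iff prime_simps intro: prime_shift_Ex)
qed

lemma eqv_And_All: "eqv S (And (All \<phi>) \<psi>) (All (And \<phi> (shift \<psi>)))"
proof (rule eqvI)
  show "S \<turnstile> Imp (And (All \<phi>) \<psi>) (All (And \<phi> (shift \<psi>)))"
    unfolding Imp_All_iff by (auto simp: provable_Imp_iff prime_simps dest: shift_AllD)
  have "S \<turnstile> Imp (All (And \<phi> (shift \<psi>))) (All \<phi>)"
    by (rule Imp_All_mono) (simp add: provable_Imp_iff prime_simps)
  moreover have "S \<turnstile> Imp (All (And \<phi> (shift \<psi>))) (All (shift \<psi>))"
    by (rule Imp_All_mono) (simp add: provable_Imp_iff prime_simps)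
  ultimately show "S \<turnstile> Imp (All (And \<phi> (shift \<psi>))) (And (All \<phi>) \<psi>)"
    using eqv_All_shift[of S \<psi>] by (auto simp: eqv_iff provable_Imp_iff prime_simps)
qed

lemma eqv_Or_Ex: "eqv S (Or (Ex \<phi>) \<psi>) (Ex (Or \<phi> (shift \<psi>)))"
proof (rule eqvI)
  have "S \<turnstile> Imp (Ex \<phi>) (Ex (Or \<phi> (shift \<psi>)))"
    by (rule Imp_Ex_mono) (simp add: provable_Imp_iff prime_simps)
  moreover have "S \<turnstile> Imp (Ex (shift \<psi>)) (Ex (Or \<phi> (shift \<psi>)))"
    by (rule Imp_Ex_mono) (simp add: provable_Imp_iff prime_simps)
  ultimately show "S \<turnstile> Imp (Or (Ex \<phi>) \<psi>) (Ex (Or \<phi> (shift \<psi>)))"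
    using eqv_Ex_shift[of S \<psi>] by (auto simp: eqv_iff provable_Imp_iff prime_simps)
  show "S \<turnstile> Imp (Ex (Or \<phi> (shift \<psi>))) (Or (Ex \<phi>) \<psi>)"
    unfolding Imp_Ex_iff by (auto simp: provable_Imp_iff prime_simps intro: prime_shift_Ex)
qed

text \<open>The right-to-left half is the constant domain principle, invalid intuitionistically in
  general. With \<psi> decided, either \<psi> holds or its negation leaves \<phi> at every
  value.\<close>

lemma eqv_Or_All:
  assumes "decidable S \<psi>"
  shows "eqv S (Or (All \<phi>) \<psi>) (All (Or \<phi> (shift \<psi>)))"
proof (rule eqvI)
  show "S \<turnstile> Imp (Or (All \<phi>) \<psi>) (All (Or \<phi> (shift \<psi>)))"
    unfolding Imp_All_iff by (auto simp: provable_Imp_iff prime_simps dest: shift_AllD)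
  have "S \<turnstile> Imp (And (All (Or \<phi> (shift \<psi>))) (Neg \<psi>)) (All \<phi>)"
    unfolding Imp_All_iff by (auto simp: provable_Imp_iff prime_simps dest!: shift_AllD)
  then show "S \<turnstile> Imp (All (Or \<phi> (shift \<psi>))) (Or (All \<phi>) \<psi>)"
    using assms by (auto simp: provable_Imp_iff decidable_iff prime_simps)
qed

lemma eqv_Neg_Ex: "eqv S (Neg (Ex \<phi>)) (All (Neg \<phi>))"
proof (rule eqvI)
  show "S \<turnstile> Imp (Neg (Ex \<phi>)) (All (Neg \<phi>))"
    unfolding Imp_All_iff by (auto simp: provable_Imp_iff prime_simps dest: prime_shift_Ex)
  have "S \<turnstile> Imp (Ex \<phi>) (Imp (All (Neg \<phi>)) Bot)"
    unfolding Imp_Ex_iff by (auto simp: provable_Imp_iff prime_simps dest!: shift_AllD)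
  then show "S \<turnstile> Imp (All (Neg \<phi>)) (Neg (Ex \<phi>))"
    by (auto simp: provable_Imp_iff prime_simps)
qed

lemma Imp_Ex_Neg: "S \<turnstile> Imp (Ex (Neg \<phi>)) (Neg (All \<phi>))"
  unfolding Imp_Ex_iff by (auto simp: provable_Imp_iff prime_simps dest: shift_AllD)

lemma decidable_eqv: "eqv S \<phi> \<psi> \<Longrightarrow> decidable S \<phi> \<Longrightarrow> decidable S \<psi>"
  by (auto simp: eqv_iff decidable_iff)

lemma decidable_subst: "decidable S \<phi> \<Longrightarrow> decidable S (subst \<sigma> \<phi>)"
  unfolding decidable_def using provable_subst[of S "Or \<phi> (Neg \<phi>)" \<sigma>] by simp

lemma decidable_shift: "decidable S \<phi> \<Longrightarrow> decidable S (shift \<phi>)"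
  unfolding shift_def by (rule decidable_subst)

lemma decidable_Bot: "decidable S Bot"
  by (auto simp: decidable_iff prime_simps)

lemma decidable_And: "decidable S \<phi> \<Longrightarrow> decidable S \<psi> \<Longrightarrow> decidable S (And \<phi> \<psi>)"
  by (auto simp: decidable_iff prime_simps)

lemma decidable_Or: "decidable S \<phi> \<Longrightarrow> decidable S \<psi> \<Longrightarrow> decidable S (Or \<phi> \<psi>)"
  by (auto simp: decidable_iff prime_simps)

lemma decidable_Imp: "decidable S \<phi> \<Longrightarrow> decidable S \<psi> \<Longrightarrow> decidable S (Imp \<phi> \<psi>)"
  unfolding decidable_iff by (smt (verit) prime_Imp subset_trans subset_iff)

lemma eqv_Imp_Or: "decidable S \<phi> \<Longrightarrow> eqv S (Imp \<phi> \<psi>) (Or (Neg \<phi>) \<psi>)"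
  unfolding decidable_iff eqv_iff by (auto simp: prime_simps)

text \<open>Deciding \<phi> removes the double negation under the quantifier, so absence of a
  counterexample gives \<open>All \<phi>\<close>; deciding \<open>Ex (Neg \<phi>)\<close> separates
  the two cases.\<close>

lemma decidable_All:
  assumes "decidable S \<phi>" "decidable S (Ex (Neg \<phi>))"
  shows "decidable S (All \<phi>)" "eqv S (Neg (All \<phi>)) (Ex (Neg \<phi>))"
proof -
  have "S \<turnstile> Imp (Neg (Ex (Neg \<phi>))) (All \<phi>)"
    unfolding Imp_All_iff shift_simps
  proof (unfold provable_Imp_iff, intro ballI impI)
    fix M assume M: "M \<in> prime_theories S" "Imp (shift (Ex (Neg \<phi>))) Bot \<in> M"
    then have "Neg \<phi> \<notin> M" using prime_shift_Ex[OF M(1), of "Neg \<phi>"] by (auto simp: prime_simps)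
    then show "\<phi> \<in> M" using assms(1) M(1) by (auto simp: decidable_iff prime_simps)
  qed
  then have 1: "All \<phi> \<in> M" if "M \<in> prime_theories S" "Neg (Ex (Neg \<phi>)) \<in> M" for M
    using that by (simp add: provable_Imp_iff)
  have 2: "Neg (All \<phi>) \<in> M" if "M \<in> prime_theories S" "Ex (Neg \<phi>) \<in> M" for M
    using that Imp_Ex_Neg[of S \<phi>] by (simp add: provable_Imp_iff)
  have 3: "Ex (Neg \<phi>) \<in> M \<or> Neg (Ex (Neg \<phi>)) \<in> M" if "M \<in> prime_theories S" for M
    using that assms(2) by (simp add: decidable_def provable_iff prime_Or)
  have 4: "All \<phi> \<notin> M \<or> Neg (All \<phi>) \<notin> M" if "M \<in> prime_theories S" for M
    using that by (auto simp: prime_simps)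
  show "decidable S (All \<phi>)"
    using 1 2 3 by (auto simp: decidable_def provable_iff prime_Or)
  show "eqv S (Neg (All \<phi>)) (Ex (Neg \<phi>))"
    unfolding eqv_iff using 1 2 3 4 by blast
qed

section \<open>The prenex hierarchy\<close>


lemma qf_subst [simp]: "qf (subst \<sigma> \<phi>) \<longleftrightarrow> qf \<phi>"
  by (induction \<phi> arbitrary: \<sigma>) simp_all

lemma subst_All_pow: "subst \<sigma> ((All ^^ n) \<phi>) = (All ^^ n) (subst ((up ^^ n) \<sigma>) \<phi>)"
  by (induction n arbitrary: \<sigma>) (simp_all add: funpow_swap1[of up])

lemma subst_Ex_pow: "subst \<sigma> ((Ex ^^ n) \<phi>) = (Ex ^^ n) (subst ((up ^^ n) \<sigma>) \<phi>)"
  by (induction n arbitrary: \<sigma>) (simp_all add: funpow_swap1[of up])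

lemma prenex_subst:
  "\<phi> \<in> Sigma_fm n \<Longrightarrow> subst \<sigma> \<phi> \<in> Sigma_fm n"
  "\<phi> \<in> Pi_fm n \<Longrightarrow> subst \<sigma> \<phi> \<in> Pi_fm n"
proof (induction n arbitrary: \<phi> \<sigma>)
  case (Suc n)
  { case 1 then show ?case using Suc.IH(2) by (fastforce simp: subst_Ex_pow) }
  { case 2 then show ?case using Suc.IH(1) by (fastforce simp: subst_All_pow) }
qed auto

text \<open>A Boolean polarity lets one induction serve both halves of the hierarchy.\<close>

definition prenex_fm :: "bool \<Rightarrow> nat \<Rightarrow> fm set" where
  "prenex_fm b n = (if b then Sigma_fm n else Pi_fm n)"

definition qu :: "bool \<Rightarrow> fm \<Rightarrow> fm" where
  "qu b \<phi> = (if b then Ex \<phi> else All \<phi>)"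

lemma qu_simps [simp]: "qu True \<phi> = Ex \<phi>" "qu False \<phi> = All \<phi>"
  by (simp_all add: qu_def)

lemma eqv_qu: "eqv S \<phi> \<psi> \<Longrightarrow> eqv S (qu b \<phi>) (qu b \<psi>)"
  by (simp add: qu_def eqv_All eqv_Ex)

lemma eqv_qu_shift: "eqv S (qu b (shift \<phi>)) \<phi>"
  by (simp add: qu_def eqv_All_shift eqv_Ex_shift)

lemma prenex_fm_0 [simp]: "prenex_fm b 0 = {\<phi>. qf \<phi>}"
  by (simp add: prenex_fm_def)

lemma prenex_fm_Suc: "prenex_fm b (Suc n) = {(qu b ^^ m) \<phi> | m \<phi>. m \<ge> 1 \<and> \<phi> \<in> prenex_fm (\<not> b) n}"
proof -
  have "qu True = Ex" "qu False = All" by (simp_all add: fun_eq_iff)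
  then show ?thesis by (cases b) (simp_all add: prenex_fm_def)
qed

lemma prenex_fm_subst: "\<phi> \<in> prenex_fm b n \<Longrightarrow> subst \<sigma> \<phi> \<in> prenex_fm b n"
  by (simp add: prenex_fm_def prenex_subst split: if_splits)

lemma prenex_fm_switch: "\<phi> \<in> prenex_fm (\<not> b) n \<Longrightarrow> qu b \<phi> \<in> prenex_fm b (Suc n)"
  unfolding prenex_fm_Suc by (auto intro!: exI[of _ "Suc 0"])

lemma prenex_fm_qu: "\<phi> \<in> prenex_fm b (Suc n) \<Longrightarrow> qu b \<phi> \<in> prenex_fm b (Suc n)"
proof -
  assume "\<phi> \<in> prenex_fm b (Suc n)"
  then obtain m \<psi> where "\<phi> = (qu b ^^ m) \<psi>" "\<psi> \<in> prenex_fm (\<not> b) n"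
    unfolding prenex_fm_Suc by auto
  then have "qu b \<phi> = (qu b ^^ Suc m) \<psi>" "Suc m \<ge> 1" "\<psi> \<in> prenex_fm (\<not> b) n" by auto
  then show ?thesis unfolding prenex_fm_Suc by blast
qed

text \<open>Consumes the outer block one quantifier at a time: \<open>switch\<close> is its
  innermost quantifier, \<open>qu\<close> any further one.\<close>

lemma prenex_fm_Suc_induct [consumes 1, case_names switch qu]:
  assumes "\<phi> \<in> prenex_fm b (Suc n)"
    and switch: "\<And>\<phi>. \<phi> \<in> prenex_fm (\<not> b) n \<Longrightarrow> P (qu b \<phi>)"
    and qu: "\<And>\<phi>. \<phi> \<in> prenex_fm b (Suc n) \<Longrightarrow> P \<phi> \<Longrightarrow> P (qu b \<phi>)"
  shows "P \<phi>"
proof -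
  have "(qu b ^^ Suc m) \<psi> \<in> prenex_fm b (Suc n) \<and> P ((qu b ^^ Suc m) \<psi>)"
    if "\<psi> \<in> prenex_fm (\<not> b) n" for m \<psi>
    by (induction m) (use that switch qu prenex_fm_switch prenex_fm_qu in auto)
  moreover obtain m \<psi> where "\<phi> = (qu b ^^ m) \<psi>" "m \<ge> 1" "\<psi> \<in> prenex_fm (\<not> b) n"
    using assms(1) unfolding prenex_fm_Suc by auto
  ultimately show ?thesis by (metis Suc_le_D One_nat_def)
qed

text \<open>
  The \<open>\<Sigma>\<^sub>n\<close> (\<open>b = True\<close>) and \<open>\<Pi>\<^sub>n\<close> (\<open>b = False\<close>) formulas up to provable equivalence in \<open>S\<close>;
  dummy quantifiers make the classes cumulative.
\<close>

inductive hier :: "fm set \<Rightarrow> bool \<Rightarrow> nat \<Rightarrow> fm \<Rightarrow> bool" for S where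
  hier_qf: "qf \<phi> \<Longrightarrow> hier S b 0 \<phi>"
| hier_eqv: "hier S b n \<phi> \<Longrightarrow> eqv S \<phi> \<psi> \<Longrightarrow> hier S b n \<psi>"
| hier_switch: "hier S (\<not> b) n \<phi> \<Longrightarrow> hier S b (Suc n) \<phi>"
| hier_qu: "hier S b (Suc n) \<phi> \<Longrightarrow> hier S b (Suc n) (qu b \<phi>)"

lemma hier_prenex: "\<phi> \<in> prenex_fm b n \<Longrightarrow> hier S b n \<phi>"
proof (induction n arbitrary: b \<phi>)
  case 0 then show ?case by (simp add: hier_qf)
next
  case (Suc n)
  from Suc.prems show ?case
    by (induction rule: prenex_fm_Suc_induct) (auto intro: hier_qu hier_switch Suc.IH)
qed

lemma prenex_hier: "hier S b n \<phi> \<Longrightarrow> \<exists>\<psi> \<in> prenex_fm b n. eqv S \<phi> \<psi>"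
proof (induction rule: hier.induct)
  case (hier_qf \<phi> b) then show ?case by (auto intro: eqv_refl)
next
  case (hier_eqv b n \<phi> \<psi>) then show ?case using eqv_trans eqv_sym by blast
next
  case (hier_switch b n \<phi>)
  then obtain \<psi> where \<psi>: "\<psi> \<in> prenex_fm (\<not> b) n" "eqv S \<phi> \<psi>" by blast
  have "qu b (shift \<psi>) \<in> prenex_fm b (Suc n)"
    using \<psi>(1) by (simp add: prenex_fm_switch shift_def prenex_fm_subst)
  moreover have "eqv S \<phi> (qu b (shift \<psi>))" using \<psi>(2) eqv_qu_shift eqv_trans eqv_sym by blast
  ultimately show ?case by blast
next
  case (hier_qu b n \<phi>) then show ?case using prenex_fm_qu eqv_qu by blast
qed

lemma hier_subst: "hier S b n \<phi> \<Longrightarrow> hier S b n (subst \<sigma> \<phi>)"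
  using hier_prenex prenex_fm_subst prenex_hier eqv_subst eqv_sym hier_eqv by metis

lemma hier_shift: "hier S b n \<phi> \<Longrightarrow> hier S b n (shift \<phi>)"
  unfolding shift_def by (rule hier_subst)

lemma hier_Suc: "hier S b n \<phi> \<Longrightarrow> hier S b (Suc n) \<phi>"
proof (induction rule: hier.induct)
  case (hier_qf \<phi> b) then show ?case by (auto intro: hier.intros)
next
  case (hier_eqv b n \<phi> \<psi>) then show ?case using hier.hier_eqv by blast
next
  case (hier_switch b n \<phi>) then show ?case using hier.hier_switch by blast
next
  case (hier_qu b n \<phi>) then show ?case using hier.hier_qu by blast
qed

lemma hier_mono: "m \<le> n \<Longrightarrow> hier S b m \<phi> \<Longrightarrow> hier S b n \<phi>"
  by (induction n rule: dec_induct) (auto intro: hier_Suc)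

lemma hier_qf_any: "qf \<phi> \<Longrightarrow> hier S b n \<phi>"
  using hier_mono[of 0 n] hier_qf by blast

lemma hier_0_iff: "hier S b 0 \<phi> \<longleftrightarrow> (\<exists>\<psi>. qf \<psi> \<and> eqv S \<phi> \<psi>)"
  using prenex_hier[of S b 0 \<phi>] hier_qf[of _ S b] hier_eqv[of S b 0] eqv_sym by fastforce

text \<open>Rule induction on \<open>hier\<close> lets the level vary; passing through a prenex
  representative keeps it fixed.\<close>

lemma hier_Suc_induct [consumes 1, case_names eqv switch qu]:
  assumes "hier S b (Suc n) \<phi>"
    and eqv: "\<And>\<phi> \<psi>. hier S b (Suc n) \<phi> \<Longrightarrow> P \<phi> \<Longrightarrow> eqv S \<phi> \<psi> \<Longrightarrow> P \<psi>"
    and switch: "\<And>\<phi>. hier S (\<not> b) n \<phi> \<Longrightarrow> P \<phi>"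
    and qu: "\<And>\<phi>. hier S b (Suc n) \<phi> \<Longrightarrow> P \<phi> \<Longrightarrow> P (qu b \<phi>)"
  shows "P \<phi>"
proof -
  obtain \<psi> where \<psi>: "\<psi> \<in> prenex_fm b (Suc n)" "eqv S \<phi> \<psi>" using prenex_hier[OF assms(1)] by blast
  from \<psi>(1) have "P \<psi>"
  proof (induction rule: prenex_fm_Suc_induct)
    case (switch \<phi>) then show ?case by (auto intro: qu assms(3) hier_prenex hier_switch)
  next
    case (qu \<phi>) then show ?case using assms(4) hier_prenex by blast
  qed
  then show ?thesis using eqv[OF hier_prenex[OF \<psi>(1)]] \<psi>(2) eqv_sym by blast
qed

lemma eqv_And_commute: "eqv S (And \<phi> \<psi>) (And \<psi> \<phi>)"
  by (auto simp: eqv_iff prime_And)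

lemma eqv_Or_commute: "eqv S (Or \<phi> \<psi>) (Or \<psi> \<phi>)"
  by (auto simp: eqv_iff prime_Or)

lemma eqv_And_qu: "eqv S (qu b (And \<phi> (shift \<psi>))) (And (qu b \<phi>) \<psi>)"
  by (cases b) (simp_all add: eqv_And_Ex eqv_And_All eqv_sym)

lemma eqv_Or_qu: "b \<or> decidable S \<psi> \<Longrightarrow> eqv S (qu b (Or \<phi> (shift \<psi>))) (Or (qu b \<phi>) \<psi>)"
  by (cases b) (simp_all add: eqv_Or_Ex eqv_Or_All eqv_sym)

text \<open>The outer block of \<phi> is pulled out until \<phi> falls to the opposite class of
  level n, then that of \<psi>, until two formulas of level n meet. Each pull shifts the other
  conjunct, hence the generalisation over it.\<close>

lemma hier_And: "hier S b n \<phi> \<Longrightarrow> hier S b n \<psi> \<Longrightarrow> hier S b n (And \<phi> \<psi>)"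
proof (induction n arbitrary: b \<phi> \<psi>)
  case 0
  then show ?case unfolding hier_0_iff using eqv_And by (metis qf.simps(3))
next
  case (Suc n)
  have switch': "hier S b (Suc n) (And \<phi> \<psi>)"
    if "hier S b (Suc n) \<psi>" "hier S (\<not> b) n \<phi>" for \<phi> \<psi>
    using that
  proof (induction arbitrary: \<phi> rule: hier_Suc_induct)
    case (eqv \<psi> \<psi>') then show ?case using eqv_And eqv_refl hier_eqv by meson
  next
    case (switch \<psi>) then show ?case using Suc.IH hier_switch by blast
  next
    case (qu \<psi>)
    have "hier S b (Suc n) (And (shift \<phi>) \<psi>)" by (rule qu.IH) (rule hier_shift[OF qu.prems])
    then have "hier S b (Suc n) (qu b (And \<psi> (shift \<phi>)))"
      by (rule hier_qu[OF hier_eqv[OF _ eqv_And_commute]])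
    then show ?case by (rule hier_eqv[OF hier_eqv[OF _ eqv_And_qu] eqv_And_commute])
  qed
  from Suc.prems show ?case
  proof (induction arbitrary: \<psi> rule: hier_Suc_induct)
    case (eqv \<phi> \<phi>') then show ?case using eqv_And eqv_refl hier_eqv by meson
  next
    case (switch \<phi>) show ?case by (rule switch'[OF switch.prems(1) switch.hyps])
  next
    case (qu \<phi>)
    then have "hier S b (Suc n) (qu b (And \<phi> (shift \<psi>)))" using hier_qu hier_shift by blast
    then show ?case by (rule hier_eqv[OF _ eqv_And_qu])
  qed
qed

section \<open>Closure of the hierarchy under disjunction and negation, given excluded
  middle\<close>

definition decides :: "fm set \<Rightarrow> nat \<Rightarrow> bool" where
  "decides S n \<longleftrightarrow> (\<forall>b \<phi>. hier S b n \<phi> \<longrightarrow> decidable S \<phi>)"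

lemma decidesD: "decides S n \<Longrightarrow> hier S b n \<phi> \<Longrightarrow> decidable S \<phi>"
  by (auto simp: decides_def)

lemma decides_mono: "m \<le> n \<Longrightarrow> decides S n \<Longrightarrow> decides S m"
  unfolding decides_def using hier_mono by blast

text \<open>Moving a universal quantifier across a disjunction requires the other disjunct to be
  decided. While quantifiers of \<phi> move this is \<psi>; when those of \<psi> move, \<phi> has
  already fallen to level n. So decidability at level n + 1 is asked of one disjunct only.\<close>

lemma hier_Or_Suc:
  assumes "decides S n"
    and "\<And>\<phi> \<psi>. hier S (\<not> b) n \<phi> \<Longrightarrow> hier S (\<not> b) n \<psi> \<Longrightarrow> hier S (\<not> b) n (Or \<phi> \<psi>)"
    and "hier S b (Suc n) \<phi>" "hier S b (Suc n) \<psi>" "b \<or> decidable S \<psi>"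
  shows "hier S b (Suc n) (Or \<phi> \<psi>)"
proof -
  have switch': "hier S b (Suc n) (Or \<phi> \<psi>)"
    if "hier S b (Suc n) \<psi>" "hier S (\<not> b) n \<phi>" for \<phi> \<psi>
    using that
  proof (induction arbitrary: \<phi> rule: hier_Suc_induct)
    case (eqv \<psi> \<psi>')
    show ?case by (rule hier_eqv[OF eqv.IH[OF eqv.prems] eqv_Or[OF eqv_refl eqv.hyps(2)]])
  next
    case (switch \<psi>) then show ?case using assms(2) hier_switch by blast
  next
    case (qu \<psi>)
    have "hier S b (Suc n) (Or (shift \<phi>) \<psi>)" by (rule qu.IH) (rule hier_shift[OF qu.prems])
    then have *: "hier S b (Suc n) (qu b (Or \<psi> (shift \<phi>)))"
      by (rule hier_qu[OF hier_eqv[OF _ eqv_Or_commute]])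
    have "b \<or> decidable S \<phi>" using qu.prems decidesD[OF assms(1)] by blast
    then show ?case by (rule hier_eqv[OF hier_eqv[OF * eqv_Or_qu] eqv_Or_commute])
  qed
  from assms(3-5) show ?thesis
  proof (induction arbitrary: \<psi> rule: hier_Suc_induct)
    case (eqv \<phi> \<phi>')
  show ?case by (rule hier_eqv[OF eqv.IH[OF eqv.prems] eqv_Or[OF eqv.hyps(2) eqv_refl]])
  next
    case (switch \<phi>) show ?case by (rule switch'[OF switch.prems(1) switch.hyps])
  next
    case (qu \<phi>)
    have "hier S b (Suc n) (Or \<phi> (shift \<psi>))"
      using qu.prems decidable_shift by (intro qu.IH hier_shift) auto
    then have "hier S b (Suc n) (qu b (Or \<phi> (shift \<psi>)))" by (rule hier_qu)
    then show ?case using qu.prems(2) by (rule hier_eqv[OF _ eqv_Or_qu])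
  qed
qed

lemma hier_Or: "decides S n \<Longrightarrow> hier S b n \<phi> \<Longrightarrow> hier S b n \<psi> \<Longrightarrow> hier S b n (Or \<phi> \<psi>)"
proof (induction n arbitrary: b \<phi> \<psi>)
  case 0
  then show ?case unfolding hier_0_iff using eqv_Or by (metis qf.simps(4))
next
  case (Suc n)
  then show ?case
    using hier_Or_Suc[of S n b \<phi> \<psi>] decides_mono[of n "Suc n" S] decidesD by auto
qed

lemma hier_Or_above:
  "decides S n \<Longrightarrow> hier S b (Suc n) \<phi> \<Longrightarrow> hier S b (Suc n) \<psi> \<Longrightarrow> b \<or> decidable S \<psi> \<Longrightarrow>
    hier S b (Suc n) (Or \<phi> \<psi>)"
  using hier_Or_Suc hier_Or by blast

lemma hier_Neg_Sigma:
  assumes "\<And>\<phi>. hier S False n \<phi> \<Longrightarrow> hier S True n (Neg \<phi>)" "hier S True (Suc n) \<phi>"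
  shows "hier S False (Suc n) (Neg \<phi>)"
  using assms(2)
proof (induction rule: hier_Suc_induct)
  case (eqv \<phi> \<psi>) then show ?case using hier_eqv eqv_Imp eqv_refl by meson
next
  case (switch \<phi>) then show ?case using assms(1) hier_switch[of S False n] by auto
next
  case (qu \<phi>)
  then have "hier S False (Suc n) (All (Neg \<phi>))" using hier_qu[of S False] by auto
  then show ?case using eqv_Neg_Ex eqv_sym hier_eqv by auto
qed

text \<open>A universal \<phi> is decided through its counterexample formula
  \<open>Ex (Neg \<phi>)\<close>, which is existential of the same level and thus covered by
  \<open>lem\<close>; the same formula is a prenex form of the negation.\<close>

lemma decides_Suc:
  assumes "decides S n" and neg: "\<And>b \<phi>. hier S b n \<phi> \<Longrightarrow> hier S (\<not> b) n (Neg \<phi>)"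
    and lem: "\<And>\<phi>. hier S True (Suc n) \<phi> \<Longrightarrow> decidable S \<phi>"
  shows "decides S (Suc n) \<and> (\<forall>b \<phi>. hier S b (Suc n) \<phi> \<longrightarrow> hier S (\<not> b) (Suc n) (Neg \<phi>))"
proof -
  have Pi: "decidable S \<phi> \<and> hier S True (Suc n) (Neg \<phi>)" if "hier S False (Suc n) \<phi>" for \<phi>
    using that
  proof (induction rule: hier_Suc_induct)
    case (eqv \<phi> \<psi>)
    then show ?case by (meson decidable_eqv eqv_Imp eqv_refl hier_eqv)
  next
    case (switch \<phi>)
    then show ?case using decidesD[OF assms(1)] neg[of True \<phi>] hier_switch[of S True n] by auto
  next
    case (qu \<phi>)
    then have ex: "hier S True (Suc n) (Ex (Neg \<phi>))" using hier_qu[of S True] by auto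
    then show ?case
      using decidable_All[of S \<phi>] lem[OF ex] qu.IH hier_eqv[OF ex] eqv_sym by auto
  qed
  have "hier S (\<not> b) (Suc n) (Neg \<phi>)" if "hier S b (Suc n) \<phi>" for b \<phi>
    using that Pi neg[of False] hier_Neg_Sigma[of S n] by (cases b) auto
  moreover have "decidable S \<phi>" if "hier S b (Suc n) \<phi>" for b \<phi>
    using that Pi lem by (cases b) auto
  ultimately show ?thesis by (auto simp: decides_def)
qed

text \<open>The claim about negations is carried through the induction because the counterexample
  formula of the next level contains the negated matrix.\<close>

lemma decides_if_Sigma:
  assumes "\<And>\<phi>. hier S True n \<phi> \<Longrightarrow> decidable S \<phi>"
  shows "decides S n \<and> (\<forall>b \<phi>. hier S b n \<phi> \<longrightarrow> hier S (\<not> b) n (Neg \<phi>))"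
  using assms
proof (induction n)
  case 0
  have "hier S c 0 \<phi>" if "hier S b 0 \<phi>" for b c \<phi> using that unfolding hier_0_iff .
  moreover have "hier S b 0 (Neg \<phi>)" if "hier S b 0 \<phi>" for b \<phi>
    using that unfolding hier_0_iff by (metis eqv_Imp eqv_refl qf.simps(2) qf.simps(5))
  ultimately show ?case using 0 unfolding decides_def by blast
next
  case (Suc n)
  have "decides S n \<and> (\<forall>b \<phi>. hier S b n \<phi> \<longrightarrow> hier S (\<not> b) n (Neg \<phi>))"
    using Suc.IH Suc.prems hier_Suc by blast
  then show ?case using decides_Suc Suc.prems by blast
qed

lemma hier_Neg: "decides S n \<Longrightarrow> hier S b n \<phi> \<Longrightarrow> hier S (\<not> b) n (Neg \<phi>)"
  using decides_if_Sigma[of S n] decidesD by blast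

lemma hier_Imp:
  "decides S n \<Longrightarrow> hier S (\<not> b) n \<phi> \<Longrightarrow> hier S b n \<psi> \<Longrightarrow> hier S b n (Imp \<phi> \<psi>)"
  using hier_Or[of S n b "Neg \<phi>" \<psi>] hier_Neg[of S n "\<not> b" \<phi>] decidesD eqv_Imp_Or eqv_sym hier_eqv
  by (metis (full_types))

lemma decides_iff_LEM: "decides S n \<longleftrightarrow> proves_all S (LEM (Sigma_fm n))"
proof
  assume "decides S n"
  then show "proves_all S (LEM (Sigma_fm n))"
    using hier_prenex[of _ True n S]
    by (auto simp: proves_all_def LEM_def prenex_fm_def decides_def decidable_def)
next
  assume "proves_all S (LEM (Sigma_fm n))"
  then have "decidable S \<phi>" if "\<phi> \<in> prenex_fm True n" for \<phi>
    using that by (auto simp: proves_all_def LEM_def prenex_fm_def decidable_def)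
  then show "decides S n" using decides_if_Sigma prenex_hier decidable_eqv eqv_sym by meson
qed

text \<open>Existential quantifiers of \<phi> move outside until the rest is Pi_n. That rest is
  decided and can be absorbed into the Pi_{n+1} disjunct, so the level rises by one only.\<close>

lemma hier_Sigma_Or_Pi:
  assumes "decides S n" "hier S True (Suc n) \<phi>" "hier S False (Suc n) \<psi>"
  shows "hier S True (Suc (Suc n)) (Or \<phi> \<psi>)"
  using assms(2,3)
proof (induction arbitrary: \<psi> rule: hier_Suc_induct)
  case (eqv \<phi> \<phi>')
  show ?case by (rule hier_eqv[OF eqv.IH[OF eqv.prems] eqv_Or[OF eqv.hyps(2) eqv_refl]])
next
  case (switch \<phi>)
  then have "hier S False (Suc n) \<phi>" "decidable S \<phi>"
    using hier_Suc decidesD[OF assms(1)] by auto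
  then have "hier S False (Suc n) (Or \<psi> \<phi>)" using hier_Or_above assms(1) switch.prems by blast
  then show ?case using hier_switch[of S True "Suc n"] hier_eqv eqv_Or_commute by (metis (full_types))
next
  case (qu \<phi>)
  then have "hier S True (Suc (Suc n)) (Ex (Or \<phi> (shift \<psi>)))"
    using hier_qu[of S True] hier_shift by auto
  then show ?case using eqv_Or_Ex eqv_sym hier_eqv by auto
qed

text \<open>
  Over \<open>LEM(\<Sigma>\<^sub>n)\<close> the formula \<open>\<phi> \<or> \<not>\<phi>\<close> with \<open>\<phi> \<in> \<Sigma>\<^sub>n\<^sub>+\<^sub>1\<close> is itself \<open>\<Sigma>\<^sub>n\<^sub>+\<^sub>2\<close>, so the rule applies to
  its double negation.
\<close>

lemma decides_if_DNE_R:
  assumes "decides S 0" "DNE_R (Sigma_fm (Suc k)) S"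
  shows "decides S k"
proof -
  have dne: "S \<turnstile> \<phi>" if \<phi>: "hier S True (Suc k) \<phi>" "S \<turnstile> Neg (Neg \<phi>)" for \<phi>
  proof -
    obtain \<psi> where \<psi>: "\<psi> \<in> Sigma_fm (Suc k)" "eqv S \<phi> \<psi>"
      using prenex_hier[OF \<phi>(1)] by (auto simp: prenex_fm_def)
    have "S \<turnstile> Neg (Neg \<psi>)"
      using \<phi>(2) \<psi>(2) eqv_Imp eqv_refl eqv_provable by meson
    then show ?thesis using assms(2) \<psi> eqv_provable unfolding DNE_R_def by blast
  qed
  have "n \<le> k \<Longrightarrow> decides S n" for n
  proof (induction n)
    case 0 show ?case by (rule assms(1))
  next
    case (Suc n)
    then have n: "decides S n" by simp
    have "decidable S \<phi>" if \<phi>: "hier S True (Suc n) \<phi>" for \<phi>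
    proof -
      have "hier S False (Suc n) (Neg \<phi>)" using hier_Neg_Sigma[OF _ \<phi>] hier_Neg[OF n, of False] by simp
      then have "hier S True (Suc (Suc n)) (Or \<phi> (Neg \<phi>))" by (rule hier_Sigma_Or_Pi[OF n \<phi>])
      \<comment> \<open>The level n + 2 of the disjunction stays within k + 1 because n + 1 \<le>
        k.\<close>
      then have "hier S True (Suc k) (Or \<phi> (Neg \<phi>))" by (rule hier_mono[rotated]) (use Suc.prems in simp)
      moreover have "S \<turnstile> Neg (Neg (Or \<phi> (Neg \<phi>)))"
        by (simp add: provable_iff prime_simps) (meson order_refl order_trans)
      ultimately show ?thesis unfolding decidable_def by (rule dne)
    qed
    then show ?case using decides_if_Sigma by blast
  qed
  then show ?thesis by simp
qed

section \<open>Arithmetic in HA\<close>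


lemma HA_mem: "subtheory HA S \<Longrightarrow> \<phi> \<in> HA \<Longrightarrow> M \<in> prime_theories S \<Longrightarrow> \<phi> \<in> M"
  unfolding subtheory_def using provable_axiom provable_iff by blast

lemma provable_induct:
  assumes "subtheory HA S" "S \<turnstile> inst \<phi> zero"
    "S \<turnstile> Imp \<phi> (subst (case_nat (succ (Var 0)) (\<lambda>n. Var (Suc n))) \<phi>)"
  shows "S \<turnstile> \<phi>"
proof -
  have "S \<turnstile> All (Imp \<phi> (subst (case_nat (succ (Var 0)) (\<lambda>n. Var (Suc n))) \<phi>))"
    using assms(3) provable_All by blast
  moreover have "S \<turnstile> Imp (inst \<phi> zero)
      (Imp (All (Imp \<phi> (subst (case_nat (succ (Var 0)) (\<lambda>n. Var (Suc n))) \<phi>))) (All \<phi>))"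
    using assms(1) provable_axiom[OF HA.induction] unfolding subtheory_def by blast
  ultimately have "S \<turnstile> All \<phi>" using assms(2) provable_MP by blast
  then show ?thesis by (simp add: provable_All)
qed

text \<open>Induction used as a case split. The transposition \<open>\<pi>\<close> brings variable n
  to position 0, on which \<open>provable_induct\<close> acts; applying it again brings n
  back.\<close>

lemma provable_cases_var:
  assumes "subtheory HA S" "S \<turnstile> subst (Var(n := zero)) \<phi>" "S \<turnstile> subst (Var(n := succ (Var n))) \<phi>"
  shows "S \<turnstile> \<phi>"
proof -
  define \<pi> where "\<pi> i = (if i = 0 then n else if i = n then 0 else i)" for i
  have \<pi>: "\<pi> (\<pi> i) = i" "\<pi> n = 0" "i \<noteq> n \<Longrightarrow> \<pi> i \<noteq> 0" for i by (auto simp: \<pi>_def)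
  let ?\<psi> = "subst (\<lambda>i. Var (\<pi> i)) \<phi>"
  have "S \<turnstile> subst (\<lambda>i. case_nat zero Var (\<pi> i)) (subst (Var(n := zero)) \<phi>)"
    using assms(2) by (rule provable_subst)
  also have "(\<lambda>i. tsubst (\<lambda>i. case_nat zero Var (\<pi> i)) ((Var(n := zero)) i)) =
      (\<lambda>i. case_nat zero Var (\<pi> i))"
    using \<pi>(2) by (auto simp: fun_eq_iff)
  then have "subst (\<lambda>i. case_nat zero Var (\<pi> i)) (subst (Var(n := zero)) \<phi>) = inst ?\<psi> zero"
    by (simp add: inst_def subst_subst)
  finally have 0: "S \<turnstile> inst ?\<psi> zero" .
  let ?\<sigma> = "case_nat (succ (Var 0)) (\<lambda>n. Var (Suc n))"
  have "S \<turnstile> subst (\<lambda>i. Var (\<pi> i)) (subst (Var(n := succ (Var n))) \<phi>)"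
    using assms(3) by (rule provable_subst)
  also have "(\<lambda>i. tsubst (\<lambda>i. Var (\<pi> i)) ((Var(n := succ (Var n))) i)) = (\<lambda>i. ?\<sigma> (\<pi> i))"
    by (rule ext) (use \<pi>(2,3) in \<open>force split: nat.split\<close>)
  then have "subst (\<lambda>i. Var (\<pi> i)) (subst (Var(n := succ (Var n))) \<phi>) = subst ?\<sigma> ?\<psi>"
    by (simp add: subst_subst)
  finally have "S \<turnstile> Imp ?\<psi> (subst ?\<sigma> ?\<psi>)" unfolding provable_Imp_iff unfolding provable_iff by simp
  with 0 have "S \<turnstile> ?\<psi>" by (rule provable_induct[OF assms(1)])
  then have "S \<turnstile> subst (\<lambda>i. Var (\<pi> i)) ?\<psi>" by (rule provable_subst)
  then show ?thesis by (simp add: subst_subst \<pi>)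
qed

context
  fixes S M assumes HA: "subtheory HA S" and M: "M \<in> prime_theories S"
begin

lemma eqM_refl: "Eq t t \<in> M"
  using HA_mem[OF HA HA.eq_refl M] .

lemma eqM_inst: "Eq s t \<in> M \<Longrightarrow> inst \<phi> s \<in> M \<Longrightarrow> inst \<phi> t \<in> M"
  using HA_mem[OF HA HA.eq_subst M, of s t \<phi>] M by (auto simp: prime_Imp)

text \<open>Leibniz's law for the property of being equal to s, where the shift protects s from the
  instantiation. The next two lemmas vary the property.\<close>

lemma eqM_sym: "Eq s t \<in> M \<Longrightarrow> Eq t s \<in> M"
  using eqM_inst[of s t "Eq (Var 0) (tsubst (\<lambda>n. Var (Suc n)) s)"] eqM_refl[of s]
  by (simp add: inst_def)

lemma eqM_trans: "Eq r s \<in> M \<Longrightarrow> Eq s t \<in> M \<Longrightarrow> Eq r t \<in> M"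
  using eqM_inst[of s t "Eq (tsubst (\<lambda>n. Var (Suc n)) r) (Var 0)"]
  by (simp add: inst_def)

lemma eqM_cong: "Eq s t \<in> M \<Longrightarrow> Eq (tsubst (case_nat s Var) u) (tsubst (case_nat t Var) u) \<in> M"
  using eqM_inst[of s t "Eq (tsubst (\<lambda>n. Var (Suc n)) (tsubst (case_nat s Var) u)) u"]
    eqM_refl[of "tsubst (case_nat s Var) u"]
  by (simp add: inst_def)

lemma eqM_succ: "Eq (succ s) (succ t) \<in> M \<longleftrightarrow> Eq s t \<in> M"
  using eqM_cong[of s t "succ (Var 0)"] HA_mem[OF HA HA.succ_inj M, of s t] M
  by (auto simp: prime_Imp)

lemma eqM_succ_zero: "Eq (succ t) zero \<notin> M"
  using HA_mem[OF HA HA.succ_not_zero M, of t] M by (auto simp: prime_simps)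

lemma eqM_zero_succ: "Eq zero (succ t) \<notin> M"
  using eqM_sym eqM_succ_zero by blast

end

text \<open>Induction on the first argument with the second one quantified; for the second a case
  split suffices. Arbitrary terms then replace the two variables.\<close>

lemma decidable_Eq:
  assumes HA: "subtheory HA S"
  shows "decidable S (Eq s t)"
proof -
  let ?d = "\<lambda>s t. Or (Eq s t) (Neg (Eq s t))"
  let ?\<phi> = "All (?d (Var 1) (Var 0))"
  have refl: "Eq r r \<in> M" if "M \<in> prime_theories S" for M r using eqM_refl[OF HA that] .
  have neg: "Neg (Eq zero (succ r)) \<in> M" "Neg (Eq (succ r) zero) \<in> M" if "M \<in> prime_theories S" for M r
    using that eqM_zero_succ[OF HA] eqM_succ_zero[OF HA] by (auto simp: prime_simps)
  have "S \<turnstile> ?\<phi>"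
  proof (rule provable_induct[OF HA])
    have "S \<turnstile> ?d zero (Var 0)"
      by (rule provable_cases_var[OF HA, of 0]) (use refl neg in \<open>auto simp: provable_iff prime_Or\<close>)
    then show "S \<turnstile> inst ?\<phi> zero" by (simp add: inst_def provable_All)
    have "S \<turnstile> Imp (shift ?\<phi>) (?d (succ (Var 1)) (Var 0))"
    proof (rule provable_cases_var[OF HA, of 0])
      show "S \<turnstile> subst (Var(0 := zero)) (Imp (shift ?\<phi>) (?d (succ (Var 1)) (Var 0)))"
        using neg by (auto simp: provable_Imp_iff prime_Or)
      have "?d (succ (Var 1)) (succ (Var 0)) \<in> M" if M: "M \<in> prime_theories S" and "shift ?\<phi> \<in> M" for M
      proof -
        have "?d (Var 1) (Var 0) \<in> M" using prime_shift_All[OF that] .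
        moreover have "Eq (succ (Var 1)) (succ (Var 0)) \<in> N \<longleftrightarrow> Eq (Var 1) (Var 0) \<in> N"
          if "N \<in> prime_theories S" for N using eqM_succ[OF HA that] .
        ultimately show ?thesis using M by (auto simp: prime_simps)
      qed
      moreover have "subst (Var(0 := succ (Var 0))) (shift ?\<phi>) = shift ?\<phi>"
        by (simp add: shift_def subst_subst)
      ultimately show "S \<turnstile> subst (Var(0 := succ (Var 0))) (Imp (shift ?\<phi>) (?d (succ (Var 1)) (Var 0)))"
        by (simp add: provable_Imp_iff)
    qed
    then show "S \<turnstile> Imp ?\<phi> (subst (case_nat (succ (Var 0)) (\<lambda>n. Var (Suc n))) ?\<phi>)"
      by (simp add: Imp_All_iff)
  qed
  then have "S \<turnstile> ?d (Var 1) (Var 0)" by (simp add: provable_All)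
  from provable_subst[OF this, of "case_nat t (\<lambda>_. s)"] show ?thesis
    by (simp add: decidable_def)
qed

lemma decidable_qf: "subtheory HA S \<Longrightarrow> qf \<phi> \<Longrightarrow> decidable S \<phi>"
  by (induction \<phi>)
    (simp_all add: decidable_Eq decidable_Bot decidable_And decidable_Or decidable_Imp)

lemma decides_0: "subtheory HA S \<Longrightarrow> decides S 0"
  unfolding decides_def hier_0_iff using decidable_qf decidable_eqv eqv_sym by blast

section \<open>Addition, triangular numbers and Cantor pairing inside HA\<close>

text \<open>Recursion on the first argument; the step function receives (y, value, x), so
  \<open>PProj 3 1\<close> is the value so far.\<close>

definition PPlus :: prfun where
  "PPlus = PRec (PProj 1 0) (PComp 3 PSucc [PProj 3 1])"

text \<open>Triangular numbers: the step sends (y, v) to S (y + v).\<close>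

definition PTri :: prfun where
  "PTri = PRec PZero (PComp 2 PSucc [PPlus])"

lemma PPlus_wf [simp]: "arity PPlus = 2" "wf_prfun PPlus"
  by (simp_all add: PPlus_def)

lemma PTri_wf [simp]: "arity PTri = 1" "wf_prfun PTri"
  by (simp_all add: PTri_def)

lift_definition add_tm :: "tm \<Rightarrow> tm \<Rightarrow> tm" is "\<lambda>s t. RFn PPlus [s, t]" by simp
lift_definition tri_tm :: "tm \<Rightarrow> tm" is "\<lambda>t. RFn PTri [t]" by simp

text \<open>The Cantor pairing function.\<close>

definition pair_tm :: "tm \<Rightarrow> tm \<Rightarrow> tm" where
  "pair_tm s t = add_tm s (tri_tm (add_tm s t))"

lemma tsubst_plus [simp]: "tsubst \<sigma> (add_tm s t) = add_tm (tsubst \<sigma> s) (tsubst \<sigma> t)"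
  by transfer simp

lemma tsubst_tri [simp]: "tsubst \<sigma> (tri_tm t) = tri_tm (tsubst \<sigma> t)"
  by transfer simp

lemma tsubst_pair [simp]: "tsubst \<sigma> (pair_tm s t) = pair_tm (tsubst \<sigma> s) (tsubst \<sigma> t)"
  by (simp add: pair_tm_def)

lemma prim_rec_Abs:
  assumes "wf_rtm r" "wf_rtm r'" "defining_eq r r'"
  shows "Eq (Abs_tm r) (Abs_tm r') \<in> HA"
  using assms by (intro HA.prim_rec) (simp add: Abs_tm_inverse)

lemma wf_Rep_tm [simp]: "wf_rtm (Rep_tm t)"
  using Rep_tm by simp

context
  fixes S M assumes HA: "subtheory HA S" and M: "M \<in> prime_theories S"
begin

lemma eqM_defining:
  "wf_rtm r \<Longrightarrow> wf_rtm r' \<Longrightarrow> defining_eq r r' \<Longrightarrow> Eq (Abs_tm r) (Abs_tm r') \<in> M"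
  using HA_mem[OF HA prim_rec_Abs M] by blast

lemma eqM_succ_defining:
  "wf_rtm r \<Longrightarrow> wf_rtm r' \<Longrightarrow> defining_eq r r' \<Longrightarrow>
    Eq (Abs_tm (RFn PSucc [r])) (Abs_tm (RFn PSucc [r'])) \<in> M"
  using eqM_succ[OF HA M, of "Abs_tm r" "Abs_tm r'"] eqM_defining[of r r']
  by (simp add: succ.abs_eq eq_onp_def)

lemma eqM_plus_zero: "Eq (add_tm zero t) t \<in> M"
proof -
  let ?t = "Rep_tm t"
  have "Eq (Abs_tm (RFn PPlus [RFn PZero [], ?t])) (Abs_tm (RFn (PProj 1 0) [?t])) \<in> M"
    unfolding PPlus_def by (rule eqM_defining) (auto intro: defining_eq.intros)
  moreover have "Eq (Abs_tm (RFn (PProj 1 0) [?t])) (Abs_tm ?t) \<in> M"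
    by (rule eqM_defining) (auto intro: defining_eq.intros(1)[of 0 1 "[?t]", simplified])
  moreover have "Abs_tm (RFn PPlus [RFn PZero [], ?t]) = add_tm zero t"
    by (simp add: add_tm_def zero_def Abs_tm_inverse)
  ultimately show ?thesis using eqM_trans[OF HA M] by (simp add: Rep_tm_inverse)
qed

lemma eqM_plus_succ: "Eq (add_tm (succ s) t) (succ (add_tm s t)) \<in> M"
proof -
  let ?s = "Rep_tm s" and ?t = "Rep_tm t"
  let ?p = "RFn PPlus [?s, ?t]"
  let ?h = "RFn (PComp 3 PSucc [PProj 3 1]) [?s, ?p, ?t]"
  let ?q = "RFn (PProj 3 1) [?s, ?p, ?t]"
  have "Eq (Abs_tm (RFn PPlus [RFn PSucc [?s], ?t])) (Abs_tm ?h) \<in> M"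
    by (rule eqM_defining) (auto simp: PPlus_def intro: defining_eq.intros)
  moreover have "Eq (Abs_tm ?h) (Abs_tm (RFn PSucc [?q])) \<in> M"
    by (rule eqM_defining) (auto intro: defining_eq.intros(2)[of 3 PSucc "[PProj 3 1]", simplified])
  moreover have "Eq (Abs_tm (RFn PSucc [?q])) (Abs_tm (RFn PSucc [?p])) \<in> M"
    by (rule eqM_succ_defining) (auto intro: defining_eq.intros(1)[of 1 3 "[?s, ?p, ?t]", simplified])
  moreover have "Abs_tm (RFn PPlus [RFn PSucc [?s], ?t]) = add_tm (succ s) t"
    by (simp add: add_tm_def succ_def Abs_tm_inverse)
  moreover have "Abs_tm (RFn PSucc [?p]) = succ (add_tm s t)"
    by (simp add: add_tm_def succ_def Abs_tm_inverse)
  ultimately show ?thesis using eqM_trans[OF HA M] by metis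
qed

lemma eqM_tri_zero: "Eq (tri_tm zero) zero \<in> M"
proof -
  have "Eq (Abs_tm (RFn PTri [RFn PZero []])) (Abs_tm (RFn PZero [])) \<in> M"
    by (rule eqM_defining) (auto simp: PTri_def intro: defining_eq.intros)
  moreover have "Abs_tm (RFn PTri [RFn PZero []]) = tri_tm zero" "Abs_tm (RFn PZero []) = zero"
    by (simp_all add: tri_tm_def zero_def Abs_tm_inverse)
  ultimately show ?thesis by simp
qed

lemma eqM_tri_succ: "Eq (tri_tm (succ t)) (succ (add_tm t (tri_tm t))) \<in> M"
proof -
  let ?t = "Rep_tm t"
  let ?r = "RFn PTri [?t]"
  let ?h = "RFn (PComp 2 PSucc [PPlus]) [?t, ?r]"
  have "Eq (Abs_tm (RFn PTri [RFn PSucc [?t]])) (Abs_tm ?h) \<in> M"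
    by (rule eqM_defining) (auto simp: PTri_def intro: defining_eq.intros)
  moreover have "Eq (Abs_tm ?h) (Abs_tm (RFn PSucc [RFn PPlus [?t, ?r]])) \<in> M"
    by (rule eqM_defining) (auto intro: defining_eq.intros(2)[of 2 PSucc "[PPlus]", simplified])
  moreover have "Abs_tm (RFn PTri [RFn PSucc [?t]]) = tri_tm (succ t)"
    by (simp add: tri_tm_def succ_def Abs_tm_inverse)
  moreover have "Abs_tm (RFn PSucc [RFn PPlus [?t, ?r]]) = succ (add_tm t (tri_tm t))"
    by (simp add: add_tm_def tri_tm_def succ_def Abs_tm_inverse)
  ultimately show ?thesis using eqM_trans[OF HA M] by metis
qed

lemma eqM_plus_cong: "Eq s s' \<in> M \<Longrightarrow> Eq t t' \<in> M \<Longrightarrow> Eq (add_tm s t) (add_tm s' t') \<in> M"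
  using eqM_cong[OF HA M, of s s' "add_tm (Var 0) (tsubst (\<lambda>n. Var (Suc n)) t)"]
    eqM_cong[OF HA M, of t t' "add_tm (tsubst (\<lambda>n. Var (Suc n)) s') (Var 0)"] eqM_trans[OF HA M]
  by simp

lemma eqM_tri_cong: "Eq t t' \<in> M \<Longrightarrow> Eq (tri_tm t) (tri_tm t') \<in> M"
  using eqM_cong[OF HA M, of t t' "tri_tm (Var 0)"] by simp

end

text \<open>Addition recurses on its first argument, so laws about the second one need
  induction.\<close>

lemma plus_zero_right: "subtheory HA S \<Longrightarrow> S \<turnstile> Eq (add_tm t zero) t"
proof -
  assume HA: "subtheory HA S"
  have "S \<turnstile> Eq (add_tm (Var 0) zero) (Var 0)"
  proof (rule provable_induct[OF HA])
    show "S \<turnstile> inst (Eq (add_tm (Var 0) zero) (Var 0)) zero"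
      using eqM_plus_zero[OF HA] by (simp add: inst_def provable_iff)
    have "Eq (add_tm (succ (Var 0)) zero) (succ (Var 0)) \<in> M"
      if M: "M \<in> prime_theories S" and "Eq (add_tm (Var 0) zero) (Var 0) \<in> M" for M
      using that eqM_plus_succ[OF HA M] eqM_succ[OF HA M] eqM_trans[OF HA M] by metis
    then show "S \<turnstile> Imp (Eq (add_tm (Var 0) zero) (Var 0))
        (subst (case_nat (succ (Var 0)) (\<lambda>n. Var (Suc n))) (Eq (add_tm (Var 0) zero) (Var 0)))"
      by (simp add: provable_Imp_iff)
  qed
  from provable_subst[OF this, of "\<lambda>_. t"] show ?thesis by simp
qed

lemma plus_succ_right: "subtheory HA S \<Longrightarrow> S \<turnstile> Eq (add_tm s (succ t)) (succ (add_tm s t))"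
proof -
  assume HA: "subtheory HA S"
  let ?\<phi> = "\<lambda>x. Eq (add_tm x (succ (Var 1))) (succ (add_tm x (Var 1)))"
  have "S \<turnstile> ?\<phi> (Var 0)"
  proof (rule provable_induct[OF HA])
    have "Eq (add_tm zero (succ r)) (succ (add_tm zero r)) \<in> M" if M: "M \<in> prime_theories S" for M r
      using eqM_plus_zero[OF HA M] eqM_succ[OF HA M] eqM_sym[OF HA M] eqM_trans[OF HA M] by meson
    then show "S \<turnstile> inst (?\<phi> (Var 0)) zero" by (simp add: inst_def provable_iff)
    have "?\<phi> (succ (Var 0)) \<in> M" if M: "M \<in> prime_theories S" and "?\<phi> (Var 0) \<in> M" for M
    proof -
      have "Eq (add_tm (succ (Var 0)) (succ (Var 1))) (succ (add_tm (Var 0) (succ (Var 1)))) \<in> M"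
        using eqM_plus_succ[OF HA M] .
      moreover have "Eq (succ (add_tm (Var 0) (succ (Var 1)))) (succ (succ (add_tm (Var 0) (Var 1)))) \<in> M"
        using that(2) eqM_succ[OF HA M] by simp
      moreover have "Eq (succ (succ (add_tm (Var 0) (Var 1)))) (succ (add_tm (succ (Var 0)) (Var 1))) \<in> M"
        using eqM_plus_succ[OF HA M] eqM_succ[OF HA M] eqM_sym[OF HA M] by simp
      ultimately show ?thesis using eqM_trans[OF HA M] by blast
    qed
    then show "S \<turnstile> Imp (?\<phi> (Var 0)) (subst (case_nat (succ (Var 0)) (\<lambda>n. Var (Suc n))) (?\<phi> (Var 0)))"
      by (simp add: provable_Imp_iff)
  qed
  from provable_subst[OF this, of "case_nat s (\<lambda>_. t)"] show ?thesis by simp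
qed

context
  fixes S M assumes HA: "subtheory HA S" and M: "M \<in> prime_theories S"
begin

lemma pair_zero_zero: "Eq (pair_tm zero zero) zero \<in> M"
proof -
  have "Eq (pair_tm zero zero) (tri_tm (add_tm zero zero)) \<in> M"
    unfolding pair_tm_def by (rule eqM_plus_zero[OF HA M])
  moreover have "Eq (tri_tm (add_tm zero zero)) (tri_tm zero) \<in> M"
    by (intro eqM_tri_cong[OF HA M] eqM_plus_zero[OF HA M])
  ultimately show ?thesis using eqM_tri_zero[OF HA M] eqM_trans[OF HA M] by blast
qed

text \<open>The pairs (s + 1, t) and (s, t + 1) lie on the same diagonal, the former right after the
  latter.\<close>

lemma pair_succ: "Eq (pair_tm (succ s) t) (succ (pair_tm s (succ t))) \<in> M"
proof -
  have "Eq (add_tm (succ s) t) (add_tm s (succ t)) \<in> M"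
    using eqM_plus_succ[OF HA M, of s t] plus_succ_right[OF HA, of s t] M
      eqM_trans[OF HA M] eqM_sym[OF HA M] by (meson provable_iff)
  then have "Eq (add_tm s (tri_tm (add_tm (succ s) t))) (pair_tm s (succ t)) \<in> M"
    unfolding pair_tm_def by (rule eqM_plus_cong[OF HA M eqM_refl[OF HA M] eqM_tri_cong[OF HA M]])
  then show ?thesis
    using eqM_plus_succ[OF HA M] eqM_succ[OF HA M] eqM_trans[OF HA M] unfolding pair_tm_def by blast
qed

text \<open>The diagonal that ends in (t, 0) is followed by the one that starts at (0, t +
  1).\<close>

lemma pair_zero_succ: "Eq (pair_tm zero (succ t)) (succ (pair_tm t zero)) \<in> M"
proof -
  have "Eq (pair_tm zero (succ t)) (tri_tm (add_tm zero (succ t))) \<in> M"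
    unfolding pair_tm_def by (rule eqM_plus_zero[OF HA M])
  moreover have "Eq (tri_tm (add_tm zero (succ t))) (tri_tm (succ t)) \<in> M"
    by (intro eqM_tri_cong[OF HA M] eqM_plus_zero[OF HA M])
  moreover have "Eq (tri_tm (succ t)) (succ (add_tm t (tri_tm t))) \<in> M" by (rule eqM_tri_succ[OF HA M])
  moreover have "Eq (add_tm t zero) t \<in> M" using plus_zero_right[OF HA] M provable_iff by blast
  then have "Eq (succ (pair_tm t zero)) (succ (add_tm t (tri_tm t))) \<in> M"
    unfolding pair_tm_def
    using eqM_plus_cong[OF HA M] eqM_tri_cong[OF HA M] eqM_refl[OF HA M] eqM_succ[OF HA M] by blast
  ultimately show ?thesis using eqM_trans[OF HA M] eqM_sym[OF HA M] by blast
qed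

text \<open>The shape of a pair determines the pair one step earlier on the walk; this turns
  surjectivity and injectivity into inductions on the code.\<close>

lemma succ_eq_pair:
  "Eq (succ z) (pair_tm zero zero) \<notin> M"
  "Eq (succ z) (pair_tm zero (succ t)) \<in> M \<longleftrightarrow> Eq z (pair_tm t zero) \<in> M"
  "Eq (succ z) (pair_tm (succ s) t) \<in> M \<longleftrightarrow> Eq z (pair_tm s (succ t)) \<in> M"
  using pair_zero_zero pair_succ[of s t] pair_zero_succ[of t] eqM_trans[OF HA M] eqM_sym[OF HA M]
    eqM_succ[OF HA M] eqM_succ_zero[OF HA M] by blast+

lemma zero_eq_pair:
  "Eq zero (pair_tm zero (succ t)) \<notin> M"
  "Eq zero (pair_tm (succ s) t) \<notin> M"
  using pair_succ[of s t] pair_zero_succ[of t] eqM_trans[OF HA M] eqM_zero_succ[OF HA M] by blast+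

end

section \<open>Pairing and the constant domain rule\<close>


definition is_pair :: "tm \<Rightarrow> fm" where
  "is_pair t = Ex (Ex (Eq (tsubst (\<lambda>n. Var (Suc (Suc n))) t) (pair_tm (Var 1) (Var 0))))"

lemma subst_is_pair [simp]: "subst \<sigma> (is_pair t) = is_pair (tsubst \<sigma> t)"
  by (simp add: is_pair_def)

lemma shift_is_pair [simp]: "shift (is_pair t) = is_pair (tsubst (\<lambda>n. Var (Suc n)) t)"
  by (simp add: shift_def)

lemma is_pairI: "M \<in> prime_theories S \<Longrightarrow> Eq t (pair_tm r s) \<in> M \<Longrightarrow> is_pair t \<in> M"
  unfolding is_pair_def
  by (rule prime_inst_Ex[where t = r], assumption, simp add: inst_def,
      rule prime_inst_Ex[where t = s], assumption, simp add: inst_def)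

text \<open>Induction on the code along the walk: after (x, 0) comes (0, x + 1), and after (x, y +
  1) comes (x + 1, y).\<close>

lemma pair_surj:
  assumes HA: "subtheory HA S"
  shows "S \<turnstile> is_pair t"
proof -
  have "S \<turnstile> is_pair (Var 0)"
  proof (rule provable_induct[OF HA])
    show "S \<turnstile> inst (is_pair (Var 0)) zero"
      using is_pairI[of _ S zero zero zero] pair_zero_zero[OF HA] eqM_sym[OF HA]
      by (simp add: inst_def provable_iff)
    have "S \<turnstile> Imp (Eq (Var 2) (pair_tm (Var 1) (Var 0))) (is_pair (succ (Var 2)))"
    proof (rule provable_cases_var[OF HA, of 0])
      show "S \<turnstile> subst (Var(0 := zero)) (Imp (Eq (Var 2) (pair_tm (Var 1) (Var 0))) (is_pair (succ (Var 2))))"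
        using is_pairI[of _ S "succ (Var 2)" zero "succ (Var 1)"] succ_eq_pair(2)[OF HA]
        by (simp add: provable_Imp_iff)
      show "S \<turnstile> subst (Var(0 := succ (Var 0))) (Imp (Eq (Var 2) (pair_tm (Var 1) (Var 0))) (is_pair (succ (Var 2))))"
        using is_pairI[of _ S "succ (Var 2)" "succ (Var 1)" "Var 0"] succ_eq_pair(3)[OF HA]
        by (simp add: provable_Imp_iff)
    qed
    then have "S \<turnstile> Imp (is_pair (Var 0)) (is_pair (succ (Var 0)))"
      by (subst is_pair_def) (simp add: Imp_Ex_iff numeral_2_eq_2)
    then show "S \<turnstile> Imp (is_pair (Var 0))
        (subst (case_nat (succ (Var 0)) (\<lambda>n. Var (Suc n))) (is_pair (Var 0)))" by simp
  qed
  from provable_subst[OF this, of "\<lambda>_. t"] show ?thesis by simp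
qed

section \<open>Injectivity of pairing\<close>

definition pair_eq :: "tm \<Rightarrow> tm \<Rightarrow> tm \<Rightarrow> tm \<Rightarrow> tm \<Rightarrow> fm" where
  "pair_eq t r s r' s' =
     Imp (And (Eq t (pair_tm r s)) (Eq t (pair_tm r' s'))) (And (Eq r r') (Eq s s'))"

text \<open>Uniqueness of components is stated for a given code so that induction on the code
  applies; the components stay quantified because they change from a code to its
  predecessor.\<close>

definition pair_inj :: "tm \<Rightarrow> fm" where
  "pair_inj t = (All ^^ 4) (pair_eq (tsubst (\<lambda>n. Var (n + 4)) t) (Var 3) (Var 2) (Var 1) (Var 0))"

lemma subst_pair_eq [simp]: "subst \<sigma> (pair_eq t r s r' s') =
    pair_eq (tsubst \<sigma> t) (tsubst \<sigma> r) (tsubst \<sigma> s) (tsubst \<sigma> r') (tsubst \<sigma> s')"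
  by (simp add: pair_eq_def)

lemma subst_pair_inj [simp]: "subst \<sigma> (pair_inj t) = pair_inj (tsubst \<sigma> t)"
  by (simp add: pair_inj_def numeral_eq_Suc)

lemma prime_inst_many: "M \<in> prime_theories S \<Longrightarrow> (All ^^ n) \<phi> \<in> M \<Longrightarrow>
    subst (\<lambda>i. if i < n then \<sigma> i else Var (i - n)) \<phi> \<in> M"
  using deriv_inst_many[of S M n \<phi> \<sigma>] prime_member[of M S] by simp

lemma pair_injD: "M \<in> prime_theories S \<Longrightarrow> pair_inj t \<in> M \<Longrightarrow> pair_eq t r s r' s' \<in> M"
  \<comment> \<open>The variables 3, 2, 1, 0 in \<open>pair_inj\<close> stand for r, s, r',
    s'.\<close>
  using prime_inst_many[of M S 4 _ "\<lambda>i. if i = 0 then s' else if i = 1 then r' else if i = 2 then s else r"]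
  unfolding pair_inj_def by fastforce

lemma prime_pair_eq: "M \<in> prime_theories S \<Longrightarrow> pair_eq t r s r' s' \<in> M \<longleftrightarrow>
    (\<forall>N \<in> prime_theories S. M \<subseteq> N \<longrightarrow> Eq t (pair_tm r s) \<in> N \<longrightarrow> Eq t (pair_tm r' s') \<in> N \<longrightarrow>
      Eq r r' \<in> N \<and> Eq s s' \<in> N)"
  by (auto simp: pair_eq_def prime_simps)

text \<open>The three shapes are the branches of the walk: the origin, the start of a later
  diagonal, and a step along a diagonal.\<close>

lemma pair_cases:
  assumes HA: "subtheory HA S"
    and "S \<turnstile> subst (Var(i := zero, j := zero)) \<phi>"
    and "S \<turnstile> subst (Var(i := zero, j := succ (Var j))) \<phi>"
    and "S \<turnstile> subst (Var(i := succ (Var i))) \<phi>"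
    and "i \<noteq> j"
  shows "S \<turnstile> \<phi>"
proof (rule provable_cases_var[OF HA, of i])
  have *: "(\<lambda>n. tsubst (Var(j := u)) ((Var(i := zero)) n)) = Var(i := zero, j := u)" for u
    using \<open>i \<noteq> j\<close> by (auto simp: fun_eq_iff)
  show "S \<turnstile> subst (Var(i := zero)) \<phi>"
    by (rule provable_cases_var[OF HA, of j]) (use assms(2,3) * in \<open>simp_all add: subst_subst\<close>)
qed (rule assms(4))

text \<open>Only (0, 0) has code zero; every other shape makes the premise false.\<close>

lemma pair_inj_zero: "subtheory HA S \<Longrightarrow> S \<turnstile> pair_eq zero (Var 3) (Var 2) (Var 1) (Var 0)"
proof -
  assume HA: "subtheory HA S"
  have triv: "pair_eq zero r s r' s' \<in> M"
    if "\<And>N. N \<in> prime_theories S \<Longrightarrow> Eq zero (pair_tm r s) \<notin> N" "M \<in> prime_theories S" for r s r' s' M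
    using that by (simp add: prime_pair_eq)
  have triv': "pair_eq zero r s r' s' \<in> M"
    if "\<And>N. N \<in> prime_theories S \<Longrightarrow> Eq zero (pair_tm r' s') \<notin> N" "M \<in> prime_theories S" for r s r' s' M
    using that by (simp add: prime_pair_eq)
  note z = zero_eq_pair[OF HA]
  show ?thesis
  proof (rule pair_cases[OF HA, of 3 2], goal_cases)
    case 1
    show ?case
      by (rule pair_cases[OF HA, of 1 0])
        (use z triv' eqM_refl[OF HA] in \<open>simp_all add: provable_iff prime_pair_eq\<close>)
  qed (use z triv in \<open>simp_all add: provable_iff\<close>)
qed

text \<open>Both decompositions of the successor are stepped back to decompositions of its
  predecessor, where the induction hypothesis applies. If their shapes differ, it would equate zero
  with a successor; the origin is excluded outright.\<close>

lemma pair_inj_succ: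
  assumes HA: "subtheory HA S"
  shows "S \<turnstile> Imp (pair_inj (Var 4)) (pair_eq (succ (Var 4)) (Var 3) (Var 2) (Var 1) (Var 0))"
proof -
  let ?z = "Var 4"
  let ?G = "\<lambda>r s r' s'. Imp (pair_inj ?z) (pair_eq (succ ?z) r s r' s')"
  have IH: "Eq r r' \<in> M \<and> Eq s s' \<in> M"
    if "M \<in> prime_theories S" "pair_inj ?z \<in> M" "Eq ?z (pair_tm r s) \<in> M" "Eq ?z (pair_tm r' s') \<in> M"
    for M r s r' s'
    using pair_injD[OF that(1,2), of r s r' s'] that by (auto simp: prime_pair_eq)
  have G: "S \<turnstile> ?G r s r' s'" if "\<And>M. M \<in> prime_theories S \<Longrightarrow> pair_inj ?z \<in> M \<Longrightarrow>
      Eq (succ ?z) (pair_tm r s) \<in> M \<Longrightarrow> Eq (succ ?z) (pair_tm r' s') \<in> M \<Longrightarrow>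
      Eq r r' \<in> M \<and> Eq s s' \<in> M" for r s r' s'
    unfolding provable_Imp_iff using that prime_pair_eq by (meson subsetD)
  note p = succ_eq_pair[OF HA]
  note e = eqM_refl[OF HA] eqM_succ[OF HA] eqM_zero_succ[OF HA] eqM_succ_zero[OF HA]
  have zz: "S \<turnstile> ?G zero zero r' s'" for r' s' by (rule G) (use p in auto)
  have zz': "S \<turnstile> ?G r s zero zero" for r s by (rule G) (use p in auto)
  have g2: "S \<turnstile> ?G zero (succ y) zero (succ y')" for y y'
  proof (rule G)
    fix M assume M: "M \<in> prime_theories S" "pair_inj ?z \<in> M"
      and eq: "Eq (succ ?z) (pair_tm zero (succ y)) \<in> M"
        "Eq (succ ?z) (pair_tm zero (succ y')) \<in> M"
    from eq have "Eq ?z (pair_tm y zero) \<in> M" "Eq ?z (pair_tm y' zero) \<in> M"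
      by (simp_all only: p[OF M(1)])
    from IH[OF M this] show "Eq zero zero \<in> M \<and> Eq (succ y) (succ y') \<in> M"
      by (simp add: e[OF M(1)])
  qed
  have g3: "S \<turnstile> ?G zero (succ y) (succ x') y'" for y x' y'
  proof (rule G)
    fix M assume M: "M \<in> prime_theories S" "pair_inj ?z \<in> M"
      and eq: "Eq (succ ?z) (pair_tm zero (succ y)) \<in> M"
        "Eq (succ ?z) (pair_tm (succ x') y') \<in> M"
    from eq have "Eq ?z (pair_tm y zero) \<in> M" "Eq ?z (pair_tm x' (succ y')) \<in> M"
      by (simp_all only: p[OF M(1)])
    from IH[OF M this] show "Eq zero (succ x') \<in> M \<and> Eq (succ y) y' \<in> M"
      by (simp add: e[OF M(1)])
  qed
  have g4: "S \<turnstile> ?G (succ x) y zero (succ y')" for x y y'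
  proof (rule G)
    fix M assume M: "M \<in> prime_theories S" "pair_inj ?z \<in> M"
      and eq: "Eq (succ ?z) (pair_tm (succ x) y) \<in> M"
        "Eq (succ ?z) (pair_tm zero (succ y')) \<in> M"
    from eq have "Eq ?z (pair_tm x (succ y)) \<in> M" "Eq ?z (pair_tm y' zero) \<in> M"
      by (simp_all only: p[OF M(1)])
    from IH[OF M this] show "Eq (succ x) zero \<in> M \<and> Eq y (succ y') \<in> M"
      by (simp add: e[OF M(1)])
  qed
  have g5: "S \<turnstile> ?G (succ x) y (succ x') y'" for x y x' y'
  proof (rule G)
    fix M assume M: "M \<in> prime_theories S" "pair_inj ?z \<in> M"
      and eq: "Eq (succ ?z) (pair_tm (succ x) y) \<in> M"
        "Eq (succ ?z) (pair_tm (succ x') y') \<in> M"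
    from eq have "Eq ?z (pair_tm x (succ y)) \<in> M" "Eq ?z (pair_tm x' (succ y')) \<in> M"
      by (simp_all only: p[OF M(1)])
    from IH[OF M this] show "Eq (succ x) (succ x') \<in> M \<and> Eq y y' \<in> M"
      by (simp add: e[OF M(1)])
  qed
  show ?thesis
  proof (rule pair_cases[OF HA, of 3 2], goal_cases)
    case 1 show ?case using zz by simp
  next
    case 2
    show ?case by (rule pair_cases[OF HA, of 1 0]) (use zz' g2 g3 in simp_all)
  next
    case 3
    show ?case by (rule pair_cases[OF HA, of 1 0]) (use zz' g4 g5 in simp_all)
  qed simp
qed

lemma pair_injective:
  assumes HA: "subtheory HA S" and M: "M \<in> prime_theories S" and "Eq (pair_tm r s) (pair_tm r' s') \<in> M"
  shows "Eq r r' \<in> M" "Eq s s' \<in> M"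
proof -
  have "S \<turnstile> pair_inj (Var 0)"
  proof (rule provable_induct[OF HA])
    show "S \<turnstile> inst (pair_inj (Var 0)) zero"
      using pair_inj_zero[OF HA] by (simp add: inst_def pair_inj_def provable_All numeral_eq_Suc)
    have "S \<turnstile> Imp (pair_inj (Var 0)) (pair_inj (succ (Var 0)))"
      using pair_inj_succ[OF HA]
      by (subst (2) pair_inj_def) (simp add: Imp_All_iff shift_def numeral_eq_Suc)
    then show "S \<turnstile> Imp (pair_inj (Var 0))
        (subst (case_nat (succ (Var 0)) (\<lambda>n. Var (Suc n))) (pair_inj (Var 0)))" by simp
  qed
  from provable_subst[OF this, of "\<lambda>_. pair_tm r s"] have "pair_inj (pair_tm r s) \<in> M"
    using M by (simp add: provable_iff)
  then have "pair_eq (pair_tm r s) r s r' s' \<in> M" by (rule pair_injD[OF M])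
  then show "Eq r r' \<in> M" "Eq s s' \<in> M"
    using M assms(3) eqM_refl[OF HA M] unfolding prime_pair_eq[OF M] by blast+
qed

lemma eqM_upd:
  assumes "subtheory HA S" "M \<in> prime_theories S" "Eq s t \<in> M" "subst (\<sigma>(i := s)) \<phi> \<in> M"
  shows "subst (\<sigma>(i := t)) \<phi> \<in> M"
proof -
  let ?\<phi> = "subst ((\<lambda>j. tsubst (\<lambda>n. Var (Suc n)) (\<sigma> j))(i := Var 0)) \<phi>"
  have "inst ?\<phi> u = subst (\<sigma>(i := u)) \<phi>" for u
    unfolding inst_def subst_subst by (rule arg_cong[of _ _ "\<lambda>\<sigma>. subst \<sigma> \<phi>"]) (auto simp: fun_eq_iff)
  then show ?thesis using eqM_inst[OF assms(1-3), of ?\<phi>] assms(4) by simp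
qed

text \<open>\<open>on_pair \<phi>\<close> says of variable 0 that it codes a pair satisfying \<open>\<phi>\<close>, which speaks about the
  components through the variables 1 and 0.\<close>

definition on_pair :: "fm \<Rightarrow> fm" where
  "on_pair \<phi> = Ex (Ex (And (Eq (Var 2) (pair_tm (Var 1) (Var 0))) (subst (up (up (\<lambda>n. Var (Suc n)))) \<phi>)))"

lemma Ex_on_pair: "S \<turnstile> Imp (Ex (on_pair \<phi>)) (Ex (Ex \<phi>))"
proof -
  have "S \<turnstile> Imp (on_pair \<phi>) (Ex (Ex (subst (up (up (\<lambda>n. Var (Suc n)))) \<phi>)))"
    unfolding on_pair_def by (intro Imp_Ex_mono) (simp add: provable_Imp_iff prime_And)
  then show ?thesis by (simp add: Imp_Ex_iff shift_def)
qed

text \<open>Surjectivity of pairing: the number in variable 0 has components, and at these \<phi> or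
  \<psi> holds.\<close>

lemma on_pair_Or:
  assumes "subtheory HA S" "S \<turnstile> Or \<phi> \<psi>"
  shows "S \<turnstile> Or (on_pair \<phi>) (on_pair \<psi>)"
proof -
  let ?s = "subst (up (up (\<lambda>n. Var (Suc n))))"
  let ?e = "Eq (Var 2) (pair_tm (Var 1) (Var 0))"
  have *: "S \<turnstile> Imp (And ?e (?s \<chi>)) (shift (shift (on_pair \<chi>)))" for \<chi>
    unfolding on_pair_def
    using provable_Imp_iff[of S "on_pair \<chi>" "on_pair \<chi>"]
    by (simp only: Imp_Ex_iff[symmetric]) (simp add: provable_Imp_iff)
  have "S \<turnstile> ?s (Or \<phi> \<psi>)" using assms(2) by (rule provable_subst)
  then have "S \<turnstile> Imp ?e (shift (shift (Or (on_pair \<phi>) (on_pair \<psi>))))"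
    using *[of \<phi>] *[of \<psi>] by (auto simp: provable_Imp_iff provable_iff[of S "Or _ _"] prime_And prime_Or)
  then have "S \<turnstile> Imp (Ex (Ex ?e)) (Or (on_pair \<phi>) (on_pair \<psi>))" by (simp only: Imp_Ex_iff)
  moreover have "S \<turnstile> Ex (Ex ?e)"
    using pair_surj[OF assms(1), of "Var 0"] by (simp add: is_pair_def numeral_2_eq_2)
  ultimately show ?thesis by (rule provable_MP)
qed

text \<open>Injectivity of pairing: at the code of (x, y), \<open>on_pair \<phi>\<close> asserts
  \<phi> of some components, and these must equal x and y.\<close>

lemma All_on_pair:
  assumes HA: "subtheory HA S"
  shows "S \<turnstile> Imp (All (on_pair \<phi>)) (All (All \<phi>))"
proof -
  let ?\<tau> = "\<lambda>n. Var (Suc (Suc (n :: nat)))"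
  \<comment> \<open>Inside \<open>?K\<close> the variables 3 and 2 are the given components, 1 and 0
    the decoded ones; the parameters of \<phi>, from index 2 on, stand under four variables instead
    of two.\<close>
  let ?\<rho> = "case_nat (Var 0) (case_nat (Var 1) (\<lambda>n. Var (n + 4)))"
  let ?K = "Ex (Ex (And (Eq (pair_tm (Var 3) (Var 2)) (pair_tm (Var 1) (Var 0))) (subst ?\<rho> \<phi>)))"
  have "(\<lambda>n. tsubst (up (up (case_nat (pair_tm (Var 1) (Var 0)) ?\<tau>))) (up (up (\<lambda>n. Var (Suc n))) n)) = ?\<rho>"
    by (rule ext) (simp add: numeral_eq_Suc split: nat.split)
  then have K: "subst (case_nat (pair_tm (Var 1) (Var 0)) ?\<tau>) (on_pair \<phi>) = ?K"
    by (simp add: on_pair_def subst_subst numeral_eq_Suc)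
  have "S \<turnstile> Imp (And (Eq (pair_tm (Var 3) (Var 2)) (pair_tm (Var 1) (Var 0))) (subst ?\<rho> \<phi>)) (shift (shift \<phi>))"
    unfolding provable_Imp_iff
  proof (intro ballI impI)
    fix M assume M: "M \<in> prime_theories S"
      "And (Eq (pair_tm (Var 3) (Var 2)) (pair_tm (Var 1) (Var 0))) (subst ?\<rho> \<phi>) \<in> M"
    then have \<phi>: "subst ?\<rho> \<phi> \<in> M"
      and pair: "Eq (pair_tm (Var 3) (Var 2)) (pair_tm (Var 1) (Var 0)) \<in> M"
      by (simp_all only: prime_And)
    have e: "Eq (Var 1) (Var 3) \<in> M" "Eq (Var 0) (Var 2) \<in> M"
      using pair_injective[OF HA M(1) pair] by (simp_all only: eqM_sym[OF HA M(1)])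
    have "?\<rho> = ?\<tau>(0 := Var 0, 1 := Var 1)" by (rule ext) (simp add: numeral_eq_Suc split: nat.split)
    then have "subst (?\<tau>(0 := Var 0, 1 := Var 3)) \<phi> \<in> M" using eqM_upd[OF HA M(1) e(1)] \<phi> by simp
    then have "subst (?\<tau>(1 := Var 3, 0 := Var 0)) \<phi> \<in> M" by (simp add: fun_upd_twist)
    then have "subst (?\<tau>(1 := Var 3, 0 := Var 2)) \<phi> \<in> M" by (rule eqM_upd[OF HA M(1) e(2)])
    moreover have "?\<tau>(1 := Var 3, 0 := Var 2) = ?\<tau>" by (rule ext) (simp add: numeral_eq_Suc)
    ultimately show "shift (shift \<phi>) \<in> M" by (simp add: shift_def subst_subst)
  qed
  then have "S \<turnstile> Imp ?K \<phi>" by (simp only: Imp_Ex_iff)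
  moreover have "?K \<in> M" if M: "M \<in> prime_theories S" and "shift (shift (All (on_pair \<phi>))) \<in> M" for M
  proof -
    have "All (subst (up ?\<tau>) (on_pair \<phi>)) \<in> M" using that(2) by (simp add: shift_def subst_subst up_comp)
    from prime_inst_All[OF M this, of "pair_tm (Var 1) (Var 0)"] show ?thesis
      unfolding subst_up_inst K .
  qed
  ultimately show ?thesis unfolding Imp_All_iff by (simp add: provable_Imp_iff)
qed

lemma Imp_All_pow: "S \<turnstile> Imp \<phi> \<psi> \<Longrightarrow> S \<turnstile> Imp ((All ^^ n) \<phi>) ((All ^^ n) \<psi>)"
  by (induction n) (simp_all add: Imp_All_mono)

lemma Imp_Ex_pow: "S \<turnstile> Imp \<phi> \<psi> \<Longrightarrow> S \<turnstile> Imp ((Ex ^^ n) \<phi>) ((Ex ^^ n) \<psi>)"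
  by (induction n) (simp_all add: Imp_Ex_mono)

text \<open>The quantifiers introduced by \<open>on_pair\<close> are existential, so an existential
  class of positive level absorbs them.\<close>

lemma hier_on_pair: "hier S True (Suc n) \<phi> \<Longrightarrow> hier S True (Suc n) (on_pair \<phi>)"
  unfolding on_pair_def using hier_qu[of S True n] hier_And hier_subst hier_qf_any by simp

lemma Imp_All_Neg_pow: "S \<turnstile> Imp ((All ^^ n) (Neg \<phi>)) (Neg ((Ex ^^ n) \<phi>))"
proof (induction n)
  case 0 show ?case by (simp add: provable_Imp_iff)
next
  case (Suc n)
  have "S \<turnstile> Imp (All (Neg ((Ex ^^ n) \<phi>))) (Neg (Ex ((Ex ^^ n) \<phi>)))"
    using eqv_Neg_Ex by (simp add: eqv_def)
  from Imp_trans[OF Imp_All_mono[OF Suc] this] show ?case by simp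
qed

text \<open>
  The rule moves a single quantifier, and the result \<open>\<forall>x \<psi>\<close> is too complex for it to be applied again; a
  block of quantifiers is therefore first contracted to one by pairing.
\<close>

lemma decides_if_CD_R:
  assumes HA: "subtheory HA S" and "CD_R (Sigma_fm k) S"
  shows "decides S k"
proof -
  have cd: "S \<turnstile> Or \<phi> (All \<psi>)"
    if hyps: "hier S True k \<phi>" "hier S True k \<psi>" "S \<turnstile> Or (shift \<phi>) \<psi>" for \<phi> \<psi>
  proof -
    obtain \<phi>' \<psi>' where *: "\<phi>' \<in> Sigma_fm k" "eqv S \<phi> \<phi>'" "\<psi>' \<in> Sigma_fm k" "eqv S \<psi> \<psi>'"
      using prenex_hier[OF hyps(1)] prenex_hier[OF hyps(2)] by (auto simp: prenex_fm_def)
    have "S \<turnstile> Or (shift \<phi>') \<psi>'"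
      using hyps(3) eqv_provable eqv_Or[OF eqv_shift[OF *(2)] *(4)] by blast
    then have "S \<turnstile> Or \<phi>' (All \<psi>')" using assms(2) *(1,3) by (simp add: CD_R_def provable_All)
    then show ?thesis using eqv_provable eqv_Or[OF *(2) eqv_All[OF *(4)]] by blast
  qed
  have block: "S \<turnstile> Or ((Ex ^^ Suc m) A) ((All ^^ Suc m) B)"
    if "Suc n \<le> k" "hier S True (Suc n) A" "hier S True (Suc n) B" "S \<turnstile> Or A B" for n m A B
    using that(2-4)
  proof (induction m arbitrary: A B)
    case 0
    \<comment> \<open>Weakening A to \<open>Ex A\<close> makes the first disjunct independent of
      variable 0, as the rule demands.\<close>
    have "S \<turnstile> Or (shift (Ex A)) B"
      using 0(3) prime_shift_Ex[of _ S A] by (auto simp: provable_iff prime_Or)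
    then show ?case using cd[of "Ex A" B] 0 hier_qu[of S True n A] hier_mono[OF that(1)] by simp
  next
    case (Suc m)
    \<comment> \<open>Coding merges two innermost quantifiers in both blocks at once and leaves the
      new matrices in Sigma_{n+1}.\<close>
    have "S \<turnstile> Or ((Ex ^^ Suc m) (on_pair A)) ((All ^^ Suc m) (on_pair B))"
      by (intro Suc.IH hier_on_pair on_pair_Or[OF HA] Suc.prems)
    moreover have "S \<turnstile> Imp ((Ex ^^ Suc m) (on_pair A)) ((Ex ^^ Suc (Suc m)) A)"
      using Imp_Ex_pow[OF Ex_on_pair[of S A], of m] by (simp add: funpow_swap1)
    moreover have "S \<turnstile> Imp ((All ^^ Suc m) (on_pair B)) ((All ^^ Suc (Suc m)) B)"
      using Imp_All_pow[OF All_on_pair[OF HA, of B], of m] by (simp add: funpow_swap1)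
    ultimately show ?case
      by (simp add: provable_Imp_iff provable_iff[of S "Or _ _"] prime_Or del: funpow.simps) blast
  qed
  have "n \<le> k \<Longrightarrow> decides S n" for n
  proof (induction n)
    case 0 show ?case by (rule decides_0[OF HA])
  next
    case (Suc n)
    then have n: "decides S n" by simp
    have "decidable S \<phi>" if \<phi>: "\<phi> \<in> Sigma_fm (Suc n)" for \<phi>
    proof -
      obtain m A where A: "\<phi> = (Ex ^^ Suc m) A" "A \<in> Pi_fm n"
        using \<phi> by (auto simp del: funpow.simps simp: Suc_le_eq gr0_conv_Suc)
      then have "hier S False n A" using hier_prenex[of A False n S] by (simp add: prenex_fm_def)
      \<comment> \<open>A is decided at level n, and both A and its negation lie in Sigma_{n+1};
        this is the theorem fed to the rule.\<close>
      then have "hier S True (Suc n) A" "hier S True (Suc n) (Neg A)" "S \<turnstile> Or A (Neg A)"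
        using hier_switch[of S True n A] hier_Neg[OF n, of False A] hier_Suc[of S True n] decidesD[OF n]
        by (auto simp: decidable_def)
      then have "S \<turnstile> Or \<phi> ((All ^^ Suc m) (Neg A))" using block Suc.prems unfolding A(1) by blast
      then show ?thesis
        using Imp_All_Neg_pow[of S "Suc m" A] unfolding A(1)[symmetric] decidable_def
        by (simp add: provable_Imp_iff provable_iff[of S "Or _ _"] prime_Or del: funpow.simps) blast
    qed
    then show ?case unfolding decides_iff_LEM
      by (auto simp: proves_all_def LEM_def decidable_def simp del: Sigma_fm.simps)
  qed
  then show ?thesis by simp
qed

section \<open>Degree and the negative translation\<close>


definition sgn_of :: "bool \<Rightarrow> sign" where
  "sgn_of b = (if b then Plus else Minus)"

lemma flip_sgn_of [simp]: "flip (sgn_of b) = sgn_of (\<not> b)"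
  by (simp add: sgn_of_def)

lemma flip_eq_iff: "flip a = c \<longleftrightarrow> a = flip c"
  by (cases a; cases c) simp_all

lemma sgn_of_eq [simp]: "sgn_of b = sgn_of c \<longleftrightarrow> b = c"
  by (auto simp: sgn_of_def)

lemma alt_qu: "alt (qu b \<phi>) = {s \<in> alt \<phi>. first s = Some (sgn_of b)}
    \<union> {sgn_of b # s | s. s \<in> alt \<phi> \<and> first s \<noteq> Some (sgn_of b)}"
  by (cases b) (simp_all add: sgn_of_def)

lemma first_alt_qu: "s \<in> alt (qu b \<phi>) \<Longrightarrow> first s = Some (sgn_of b)"
  by (auto simp: alt_qu)

lemma deg_le_iff: "deg \<phi> \<le> k \<longleftrightarrow> (\<forall>s \<in> alt \<phi>. length s \<le> k)"
  unfolding deg_def using finite_alt[of \<phi>] alt_nonempty[of \<phi>] by (subst Max_le_iff) auto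

lemma Fplus_iff: "\<phi> \<in> Fplus_fm k \<longleftrightarrow> (\<forall>s \<in> alt \<phi>. length s \<le> k)"
  by (simp add: Fplus_fm_def deg_le_iff)

lemma Fplus_simps:
  "Eq s t \<in> Fplus_fm k" "Bot \<in> Fplus_fm k"
  "And \<phi> \<psi> \<in> Fplus_fm k \<longleftrightarrow> \<phi> \<in> Fplus_fm k \<and> \<psi> \<in> Fplus_fm k"
  "Or \<phi> \<psi> \<in> Fplus_fm k \<longleftrightarrow> \<phi> \<in> Fplus_fm k \<and> \<psi> \<in> Fplus_fm k"
  "Imp \<phi> \<psi> \<in> Fplus_fm k \<longleftrightarrow> \<phi> \<in> Fplus_fm k \<and> \<psi> \<in> Fplus_fm k"
  by (auto simp: Fplus_iff ball_Un)

lemma alt_subformula: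
  "s \<in> alt \<phi> \<Longrightarrow> first s = Some (sgn_of b) \<and> s \<in> alt (qu b \<phi>) \<or> sgn_of b # s \<in> alt (qu b \<phi>)"
  by (auto simp: alt_qu)

lemma Fplus_qu: "qu b \<phi> \<in> Fplus_fm k \<Longrightarrow> \<phi> \<in> Fplus_fm k"
  unfolding Fplus_iff using alt_subformula[of _ \<phi> b]
  by (metis Suc_leD length_Cons)

text \<open>Negation and the change of quantifier both flip signs, so path lengths are preserved.
  The possible extra path \<open>[Plus]\<close> stems from the \<open>Bot\<close> in
  \<open>Neg \<phi>\<close>; it fits because \<open>All \<phi>\<close> has a nonempty path.\<close>

lemma Fplus_Ex_Neg: "All \<phi> \<in> Fplus_fm k \<Longrightarrow> Ex (Neg \<phi>) \<in> Fplus_fm k"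
proof -
  assume all: "All \<phi> \<in> Fplus_fm k"
  obtain s where s: "s \<in> alt (All \<phi>)" using alt_nonempty by blast
  then have "s \<noteq> []" using first_alt_qu[of s False \<phi>] by auto
  then have "1 \<le> length s" by (cases s) simp_all
  with s all have k: "1 \<le> k" unfolding Fplus_iff by (meson order_trans)
  have *: "\<exists>u \<in> alt (All \<phi>). length t \<le> length u" if t: "t \<in> alt (Ex (Neg \<phi>))" "t \<noteq> [Plus]" for t
  proof -
    obtain u where u: "u \<in> alt (Neg \<phi>)" and tu: "t = u \<and> first u = Some Plus \<or> t = Plus # u \<and> first u \<noteq> Some Plus"
      using t(1) alt_qu[of True "Neg \<phi>"] by (auto simp: sgn_of_def)
    obtain s where s: "s \<in> alt \<phi>" "u = map flip s"
      using u t tu by (auto simp: flip_eq_iff)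
    have "first u = Some Plus \<longleftrightarrow> first s = Some Minus"
      using s(2) by (cases s) (auto simp: flip_eq_iff)
    then have "t = u \<and> s \<in> alt (All \<phi>) \<or> t = Plus # u \<and> Minus # s \<in> alt (All \<phi>)"
      using s(1) tu by auto
    then show ?thesis using s(2) by (metis length_Cons length_map order_refl)
  qed
  have "length t \<le> k" if t: "t \<in> alt (Ex (Neg \<phi>))" for t
  proof (cases "t = [Plus]")
    case False
    from *[OF t False] obtain u where "u \<in> alt (All \<phi>)" "length t \<le> length u" by blast
    then show ?thesis using all unfolding Fplus_iff by (meson order_trans)
  qed (use k in simp)
  then show ?thesis unfolding Fplus_iff by blast
qed

lemma qf_if_alt: "\<forall>s \<in> alt \<phi>. s = [] \<Longrightarrow> qf \<phi>"
proof (induction \<phi>)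
  case (All \<phi>)
  then have False using first_alt_qu[of _ False \<phi>] alt_nonempty[of "All \<phi>"] by fastforce
  then show ?case ..
next
  case (Ex \<phi>)
  then have False using first_alt_qu[of _ True \<phi>] alt_nonempty[of "Ex \<phi>"] by fastforce
  then show ?case ..
qed auto

section \<open>From alternation paths to prenex classes\<close>

text \<open>Refines the degree bound by a polarity: paths of full length must start with the sign of
  b. The exception at k = 0 is for the empty path, which has no first symbol.\<close>

definition alt_bounded :: "bool \<Rightarrow> nat \<Rightarrow> fm \<Rightarrow> bool" where
  "alt_bounded b k \<phi> \<longleftrightarrow>
     (\<forall>s \<in> alt \<phi>. length s \<le> k \<and> (length s = k \<longrightarrow> k = 0 \<or> first s = Some (sgn_of b)))"

lemma alt_bounded_simps:
  "alt_bounded b k (And \<phi> \<psi>) \<longleftrightarrow> alt_bounded b k \<phi> \<and> alt_bounded b k \<psi>"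
  "alt_bounded b k (Or \<phi> \<psi>) \<longleftrightarrow> alt_bounded b k \<phi> \<and> alt_bounded b k \<psi>"
  by (auto simp: alt_bounded_def)

lemma alt_bounded_Imp:
  "alt_bounded b k (Imp \<phi> \<psi>) \<longleftrightarrow> alt_bounded (\<not> b) k \<phi> \<and> alt_bounded b k \<psi>"
proof -
  have "first (map flip s) = Some (sgn_of b) \<longleftrightarrow> first s = Some (sgn_of (\<not> b))" for s
    by (cases s) (auto simp: flip_eq_iff)
  then show ?thesis unfolding alt_bounded_def alt.simps ball_Un by simp
qed

lemma alt_bounded_qu: "alt_bounded b (Suc k) (qu b \<phi>) \<Longrightarrow> alt_bounded b (Suc k) \<phi>"
  unfolding alt_bounded_def using alt_subformula[of _ \<phi> b] by fastforce

text \<open>All paths of a quantified formula start with the sign of its quantifier; if this is the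
  wrong sign none has full length, and the bound drops by one.\<close>

lemma alt_bounded_switch: "alt_bounded b (Suc k) (qu (\<not> b) \<phi>) \<Longrightarrow> alt_bounded (\<not> b) k (qu (\<not> b) \<phi>)"
  unfolding alt_bounded_def using first_alt_qu[of _ "\<not> b" \<phi>] by (fastforce simp: le_Suc_eq)

text \<open>Prenex normal form by counting alternations. The outer induction on k handles a
  quantifier of the wrong sign, the inner one on the formula the rest; excluded middle pays for
  \<open>Or\<close> and \<open>Imp\<close>.\<close>

lemma hier_alt_bounded: "decides S k \<Longrightarrow> alt_bounded b k \<phi> \<Longrightarrow> hier S b k \<phi>"
proof (induction k arbitrary: b \<phi>)
  case 0
  then show ?case using qf_if_alt[of \<phi>] by (auto simp: alt_bounded_def hier_qf)
next
  case (Suc k)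
  have switch: "hier S b (Suc k) (qu (\<not> b) \<phi>)" if "alt_bounded b (Suc k) (qu (\<not> b) \<phi>)" for b \<phi>
    using Suc.IH[OF decides_mono[OF _ Suc.prems(1)] alt_bounded_switch[OF that]] hier_switch by simp
  have same: "hier S b (Suc k) (qu b \<phi>)"
    if "\<And>b. alt_bounded b (Suc k) \<phi> \<Longrightarrow> hier S b (Suc k) \<phi>" "alt_bounded b (Suc k) (qu b \<phi>)" for b \<phi>
    using hier_qu that alt_bounded_qu by blast
  from Suc.prems(2) show ?case
  proof (induction \<phi> arbitrary: b)
    case (And \<phi> \<psi>)
    then show ?case by (auto simp only: alt_bounded_simps intro!: hier_And)
  next
    case (Or \<phi> \<psi>)
    then show ?case by (auto simp only: alt_bounded_simps intro!: hier_Or Suc.prems(1))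
  next
    case (Imp \<phi> \<psi>)
    then show ?case by (auto simp only: alt_bounded_Imp intro!: hier_Imp Suc.prems(1))
  next
    case (All \<phi>)
    show ?case
      using same[OF All.IH, of False] switch[of True \<phi>] All.prems by (cases b) simp_all
  next
    case (Ex \<phi>)
    show ?case
      using same[OF Ex.IH, of True] switch[of False \<phi>] Ex.prems by (cases b) simp_all
  qed (simp_all add: hier_qf_any)
qed

lemma alt_bounded_Fplus: "qu b \<phi> \<in> Fplus_fm k \<Longrightarrow> alt_bounded b k (qu b \<phi>)"
  unfolding alt_bounded_def Fplus_iff using first_alt_qu by blast

text \<open>The paths of a quantified formula share their first sign, so its plain degree bound is
  already the polarised one and places it in the hierarchy. Connectives preserve
  decidability.\<close>

lemma decidable_Fplus:
  assumes HA: "subtheory HA S" and k: "decides S k"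
  shows "\<phi> \<in> Fplus_fm k \<Longrightarrow> decidable S \<phi>"
proof (induction \<phi>)
  case (All \<phi>)
  then have "alt_bounded False k (All \<phi>)" using alt_bounded_Fplus[of False \<phi>] by simp
  then show ?case by (rule decidesD[OF k hier_alt_bounded[OF k]])
next
  case (Ex \<phi>)
  then have "alt_bounded True k (Ex \<phi>)" using alt_bounded_Fplus[of True \<phi>] by simp
  then show ?case by (rule decidesD[OF k hier_alt_bounded[OF k]])
qed (simp_all add: Fplus_simps decidable_Eq[OF HA] decidable_Bot decidable_And decidable_Or decidable_Imp)

section \<open>The negative translation relative to C and its soundness\<close>

abbreviation dn :: "fm \<Rightarrow> fm \<Rightarrow> fm" where
  "dn C \<phi> \<equiv> Imp (Imp \<phi> C) C"

text \<open>The Goedel-Gentzen translation with C for falsity. C may have free variables, hence its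
  shift under quantifiers.\<close>

primrec tr :: "fm \<Rightarrow> fm \<Rightarrow> fm" where
  "tr (Eq s t) C = dn C (Eq s t)"
| "tr Bot C = C"
| "tr (And \<phi> \<psi>) C = And (tr \<phi> C) (tr \<psi> C)"
| "tr (Or \<phi> \<psi>) C = dn C (Or (tr \<phi> C) (tr \<psi> C))"
| "tr (Imp \<phi> \<psi>) C = Imp (tr \<phi> C) (tr \<psi> C)"
| "tr (All \<phi>) C = All (tr \<phi> (shift C))"
| "tr (Ex \<phi>) C = dn C (Ex (tr \<phi> (shift C)))"

lemma subst_tr: "subst \<sigma> (tr \<phi> C) = tr (subst \<sigma> \<phi>) (subst \<sigma> C)"
  by (induction \<phi> arbitrary: \<sigma> C) (simp_all add: shift_subst)

lemma shift_tr: "shift (tr \<phi> C) = tr (shift \<phi>) (shift C)"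
  by (simp add: shift_def subst_tr)

lemma inst_tr: "inst (tr \<phi> (shift C)) t = tr (inst \<phi> t) C"
  by (metis inst_def inst_shift subst_tr)

lemma prime_ImpE: "M \<in> prime_theories S \<Longrightarrow> Imp \<phi> \<psi> \<in> M \<Longrightarrow> \<phi> \<in> M \<Longrightarrow> \<psi> \<in> M"
  using prime_Imp by blast

lemma prime_ImpI:
  "M \<in> prime_theories S \<Longrightarrow> (\<And>N. N \<in> prime_theories S \<Longrightarrow> M \<subseteq> N \<Longrightarrow> \<phi> \<in> N \<Longrightarrow> \<psi> \<in> N) \<Longrightarrow>
    Imp \<phi> \<psi> \<in> M"
  using prime_Imp by blast

lemma dnI: "M \<in> prime_theories S \<Longrightarrow> \<phi> \<in> M \<Longrightarrow> dn C \<phi> \<in> M"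
  by (rule prime_ImpI) (auto intro: prime_ImpE)

text \<open>\<open>dn C\<close> acts as a monad with unit \<open>dnI\<close> and this bind; the step
  is needed at all later worlds because implications look there.\<close>

lemma dn_bind:
  assumes M: "M \<in> prime_theories S" and "dn C \<phi> \<in> M"
    and step: "\<And>N. N \<in> prime_theories S \<Longrightarrow> M \<subseteq> N \<Longrightarrow> \<phi> \<in> N \<Longrightarrow> dn C \<psi> \<in> N"
  shows "dn C \<psi> \<in> M"
proof (rule prime_ImpI[OF M])
  fix N assume N: "N \<in> prime_theories S" "M \<subseteq> N" "Imp \<psi> C \<in> N"
  have "Imp \<phi> C \<in> N"
  proof (rule prime_ImpI[OF N(1)])
    fix K assume K: "K \<in> prime_theories S" "N \<subseteq> K" "\<phi> \<in> K"
    then have "dn C \<psi> \<in> K" using step N(2) by blast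
    then show "C \<in> K" using prime_ImpE[OF K(1)] K(2) N(3) by blast
  qed
  then show "C \<in> N" using prime_ImpE[OF N(1)] assms(2) N(2) by blast
qed

lemma dn_mono: "S \<turnstile> Imp \<phi> \<psi> \<Longrightarrow> S \<turnstile> Imp (dn C \<phi>) (dn C \<psi>)"
  unfolding provable_Imp_iff
proof (intro ballI impI)
  fix M assume *: "\<forall>M \<in> prime_theories S. \<phi> \<in> M \<longrightarrow> \<psi> \<in> M"
    and M: "M \<in> prime_theories S" "dn C \<phi> \<in> M"
  show "dn C \<psi> \<in> M"
    by (rule dn_bind[OF M]) (rule dnI, use * in simp_all)
qed

definition stable :: "fm set \<Rightarrow> fm \<Rightarrow> fm \<Rightarrow> bool" where
  "stable S C \<phi> \<longleftrightarrow> S \<turnstile> Imp (dn C \<phi>) \<phi>"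

text \<open>The form of use: towards a stable goal, \<open>dn C \<phi>\<close> may be opened to
  \<phi>.\<close>

lemma stable_bind:
  assumes "stable S C \<psi>" and M: "M \<in> prime_theories S" "dn C \<phi> \<in> M"
    and "\<And>N. N \<in> prime_theories S \<Longrightarrow> M \<subseteq> N \<Longrightarrow> \<phi> \<in> N \<Longrightarrow> \<psi> \<in> N"
  shows "\<psi> \<in> M"
proof -
  have "dn C \<psi> \<in> M" by (rule dn_bind[OF M]) (rule dnI, use assms(4) in simp_all)
  then show ?thesis using assms(1) M(1) by (simp add: stable_def provable_Imp_iff)
qed

lemma stable_self: "stable S C C"
  unfolding stable_def provable_Imp_iff
proof (intro ballI impI)
  fix M assume M: "M \<in> prime_theories S" "dn C C \<in> M"
  have "Imp C C \<in> M" by (rule prime_ImpI[OF M(1)])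
  then show "C \<in> M" using prime_ImpE[OF M] by simp
qed

lemma stable_dn: "stable S C (dn C \<phi>)"
  unfolding stable_def provable_Imp_iff
proof (intro ballI impI)
  fix M assume M: "M \<in> prime_theories S" "dn C (dn C \<phi>) \<in> M"
  show "dn C \<phi> \<in> M" by (rule dn_bind[OF M])
qed

lemma stable_And:
  assumes "stable S C \<phi>" "stable S C \<psi>"
  shows "stable S C (And \<phi> \<psi>)"
  unfolding stable_def provable_Imp_iff
proof (intro ballI impI)
  fix M assume M: "M \<in> prime_theories S" "dn C (And \<phi> \<psi>) \<in> M"
  have "\<phi> \<in> M" by (rule stable_bind[OF assms(1) M]) (simp add: prime_And)
  moreover have "\<psi> \<in> M" by (rule stable_bind[OF assms(2) M]) (simp add: prime_And)
  ultimately show "And \<phi> \<psi> \<in> M" by (simp add: prime_And[OF M(1)])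
qed

lemma stable_Imp:
  assumes "stable S C \<psi>"
  shows "stable S C (Imp \<phi> \<psi>)"
  unfolding stable_def provable_Imp_iff
proof (intro ballI impI)
  fix M assume M: "M \<in> prime_theories S" "dn C (Imp \<phi> \<psi>) \<in> M"
  show "Imp \<phi> \<psi> \<in> M"
  proof (rule prime_ImpI[OF M(1)])
    fix N assume N: "N \<in> prime_theories S" "M \<subseteq> N" "\<phi> \<in> N"
    show "\<psi> \<in> N"
      by (rule stable_bind[OF assms N(1), of "Imp \<phi> \<psi>"]) (use M(2) N prime_ImpE in blast)+
  qed
qed

lemma stable_All:
  assumes "stable S (shift C) \<phi>"
  shows "stable S C (All \<phi>)"
proof -
  have "S \<turnstile> Imp (dn (shift C) (shift (All \<phi>))) (dn (shift C) \<phi>)"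
    by (rule dn_mono) (auto simp: provable_Imp_iff dest: shift_AllD)
  then show ?thesis using assms Imp_trans unfolding stable_def Imp_All_iff shift_simps by blast
qed

text \<open>\<open>Or\<close> and \<open>Ex\<close> carry \<open>dn C\<close> in the translation to
  secure this; it is what makes their elimination rules sound.\<close>

lemma stable_tr: "stable S C (tr \<phi> C)"
  by (induction \<phi> arbitrary: C)
    (simp_all add: stable_self stable_dn stable_And stable_Imp stable_All)

text \<open>C is generalised because the rules that open a quantifier continue with
  \<open>shift C\<close>.\<close>

lemma tr_sound:
  assumes "deriv P \<Gamma> \<phi>" and P: "\<And>\<phi> C. \<phi> \<in> P \<Longrightarrow> S \<turnstile> tr \<phi> C"
  shows "deriv S ((\<lambda>\<psi>. tr \<psi> C) ` \<Gamma>) (tr \<phi> C)"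
  using assms(1)
proof (induction arbitrary: C rule: deriv.induct)
  case (Axiom \<phi> \<Gamma>) then show ?case using P[of \<phi> C] by (simp add: provable_iff deriv_iff)
next
  case (Assume \<phi> \<Gamma>) then show ?case by (auto intro: deriv.Assume)
next
  case (BotE \<Gamma> \<phi>)
  \<comment> \<open>Ex falso relative to C: from C follows \<open>dn C Bot\<close>, and the goal is
    stable.\<close>
  have "tr \<phi> C \<in> M" if M: "M \<in> prime_theories S" "C \<in> M" for M
  proof -
    have "dn C Bot \<in> M" by (rule prime_ImpI[OF M(1)]) (use M(2) in blast)
    then show ?thesis by (rule stable_bind[OF stable_tr M(1)]) (simp add: prime_Bot)
  qed
  then show ?case using BotE.IH[of C] by (simp add: deriv_iff)
next
  case (AndI \<Gamma> \<phi> \<psi>)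
  show ?case using deriv.AndI[OF AndI.IH] by simp
next
  case (AndE1 \<Gamma> \<phi> \<psi>)
  show ?case using deriv.AndE1[of S _ "tr \<phi> C"] AndE1.IH[of C] by simp
next
  case (AndE2 \<Gamma> \<phi> \<psi>)
  show ?case using deriv.AndE2[of S _ "tr \<phi> C"] AndE2.IH[of C] by simp
next
  case (OrI1 \<Gamma> \<phi> \<psi>)
  show ?case using OrI1.IH[of C] dnI[of _ S "Or (tr \<phi> C) (tr \<psi> C)" C] by (simp add: deriv_iff prime_Or)
next
  case (OrI2 \<Gamma> \<psi> \<phi>)
  show ?case using OrI2.IH[of C] dnI[of _ S "Or (tr \<phi> C) (tr \<psi> C)" C] by (simp add: deriv_iff prime_Or)
next
  case (OrE \<Gamma> \<phi> \<psi> \<chi>)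
  show ?case unfolding deriv_iff
  proof (intro ballI impI)
    fix M assume M: "M \<in> prime_theories S" "(\<lambda>\<psi>. tr \<psi> C) ` \<Gamma> \<subseteq> M"
    then have "dn C (Or (tr \<phi> C) (tr \<psi> C)) \<in> M" using OrE.IH(1)[of C] by (simp add: deriv_iff)
    then show "tr \<chi> C \<in> M"
    proof (rule stable_bind[OF stable_tr M(1)])
      fix N assume N: "N \<in> prime_theories S" "M \<subseteq> N" "Or (tr \<phi> C) (tr \<psi> C) \<in> N"
      then have "(\<lambda>\<psi>. tr \<psi> C) ` \<Gamma> \<subseteq> N" using M(2) by blast
      then show "tr \<chi> C \<in> N"
        using N(1,3) OrE.IH(2,3)[of C] by (auto simp: deriv_iff prime_Or)
    qed
  qed
next
  case (ImpI \<phi> \<Gamma> \<psi>)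
  show ?case using deriv.ImpI[of S "tr \<phi> C" _ "tr \<psi> C"] ImpI.IH[of C] by simp
next
  case (ImpE \<Gamma> \<phi> \<psi>)
  show ?case using deriv.ImpE[of S _ "tr \<phi> C"] ImpE.IH[of C] by simp
next
  case (AllI \<Gamma> \<phi>)
  have "(\<lambda>\<psi>. tr \<psi> (shift C)) ` shift ` \<Gamma> = shift ` (\<lambda>\<psi>. tr \<psi> C) ` \<Gamma>"
    by (simp add: image_image shift_tr)
  then show ?case using deriv.AllI[of S _ "tr \<phi> (shift C)"] AllI.IH[of "shift C"] by simp
next
  case (AllE \<Gamma> \<phi> t)
  show ?case using deriv.AllE[of S _ "tr \<phi> (shift C)" t] AllE.IH[of C] by (simp add: inst_tr)
next
  case (ExI \<Gamma> \<phi> t)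
  show ?case using ExI.IH[of C] prime_inst_Ex[of _ S "tr \<phi> (shift C)" t] dnI[of _ S "Ex (tr \<phi> (shift C))" C]
    by (simp add: deriv_iff inst_tr)
next
  case (ExE \<Gamma> \<phi> \<chi>)
  let ?\<Gamma> = "(\<lambda>\<psi>. tr \<psi> C) ` \<Gamma>"
  have "(\<lambda>\<psi>. tr \<psi> (shift C)) ` shift ` \<Gamma> = shift ` ?\<Gamma>"
    by (simp add: image_image shift_tr)
  then have body: "deriv S (insert (tr \<phi> (shift C)) (shift ` ?\<Gamma>)) (shift (tr \<chi> C))"
    using ExE.IH(2)[of "shift C"] by (simp add: shift_tr)
  show ?case unfolding deriv_iff
  proof (intro ballI impI)
    fix M assume M: "M \<in> prime_theories S" "?\<Gamma> \<subseteq> M"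
    then have "dn C (Ex (tr \<phi> (shift C))) \<in> M" using ExE.IH(1)[of C] by (simp add: deriv_iff)
    then show "tr \<chi> C \<in> M"
    proof (rule stable_bind[OF stable_tr M(1)])
      fix N assume N: "N \<in> prime_theories S" "M \<subseteq> N" "Ex (tr \<phi> (shift C)) \<in> N"
      \<comment> \<open>The context grows to the whole world N, so that the conclusion of
        \<open>ExE\<close> becomes a member of N.\<close>
      have "deriv S (insert (tr \<phi> (shift C)) (shift ` N)) (shift (tr \<chi> C))"
        using body by (rule deriv_weaken) (use M(2) N(2) in blast)
      then have "deriv S N (tr \<chi> C)" using deriv.ExE[OF deriv.Assume[OF N(3)]] by blast
      then show "tr \<chi> C \<in> N" by (rule prime_closed[OF N(1)])
    qed
  qed
qed

text \<open>Equality premises \<open>dn C (Eq s t)\<close> are opened towards stable goals; an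
  induction axiom becomes the induction axiom for the translated formula.\<close>

lemma tr_HA:
  assumes HA: "subtheory HA S" and "\<phi> \<in> HA"
  shows "S \<turnstile> tr \<phi> C"
  using assms(2)
proof cases
  case (eq_refl t)
  then show ?thesis using eqM_refl[OF HA] dnI[of _ S "Eq t t" C] by (simp add: provable_iff)
next
  case (eq_subst s t \<psi>)
  let ?a = "tr \<psi> (shift C)"
  have "Imp (tr (inst \<psi> s) C) (tr (inst \<psi> t) C) \<in> M" if M: "M \<in> prime_theories S" "dn C (Eq s t) \<in> M" for M
  proof (rule stable_bind[OF stable_Imp[OF stable_tr] M])
    fix N assume N: "N \<in> prime_theories S" "M \<subseteq> N" "Eq s t \<in> N"
    have "Imp (Eq s t) (Imp (inst ?a s) (inst ?a t)) \<in> N" by (rule HA_mem[OF HA HA.eq_subst N(1)])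
    then show "Imp (tr (inst \<psi> s) C) (tr (inst \<psi> t) C) \<in> N"
      using prime_ImpE[OF N(1)] N(3) by (simp add: inst_tr)
  qed
  then show ?thesis using eq_subst by (simp add: provable_Imp_iff)
next
  case (succ_not_zero t)
  have "C \<in> M" if M: "M \<in> prime_theories S" "dn C (Eq (succ t) zero) \<in> M" for M
    using stable_bind[OF stable_self M] eqM_succ_zero[OF HA] by blast
  then show ?thesis using succ_not_zero by (simp add: provable_Imp_iff)
next
  case (succ_inj s t)
  have "S \<turnstile> Imp (Eq (succ s) (succ t)) (Eq s t)"
    using eqM_succ[OF HA] by (simp add: provable_Imp_iff)
  then show ?thesis using succ_inj dn_mono by simp
next
  case (prim_rec s t)
  then show ?thesis using HA_mem[OF HA HA.prim_rec] dnI[of _ S "Eq s t" C] by (simp add: provable_iff)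
next
  case (induction \<psi>)
  let ?\<sigma> = "case_nat (succ (Var 0)) (\<lambda>n. Var (Suc n))"
  have "subst ?\<sigma> (tr \<psi> (shift C)) = tr (subst ?\<sigma> \<psi>) (shift C)"
    by (simp add: subst_tr) (simp add: shift_def subst_subst)
  then show ?thesis
    using HA_mem[OF HA HA.induction[of "tr \<psi> (shift C)"]] induction by (simp add: provable_iff inst_tr)
qed

text \<open>With C as falsity, this is the intuitionistic irrefutability of excluded middle.\<close>

lemma tr_LEM: "S \<turnstile> tr (Or \<phi> (Neg \<phi>)) C"
  unfolding provable_iff tr.simps
proof
  fix M assume M: "M \<in> prime_theories S"
  let ?a = "tr \<phi> C"
  show "dn C (Or ?a (Imp ?a C)) \<in> M"
  proof (rule prime_ImpI[OF M])
    fix N assume N: "N \<in> prime_theories S" "Imp (Or ?a (Imp ?a C)) C \<in> N"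
    have *: "C \<in> K" if "K \<in> prime_theories S" "N \<subseteq> K" "?a \<in> K \<or> Imp ?a C \<in> K" for K
      using prime_ImpE[OF that(1)] N(2) that by (meson prime_Or subsetD)
    then have "Imp ?a C \<in> N" using prime_ImpI[OF N(1)] by blast
    then show "C \<in> N" using * N(1) by blast
  qed
qed

lemma tr_PA: "subtheory HA S \<Longrightarrow> \<phi> \<in> PA \<Longrightarrow> S \<turnstile> tr \<phi> C"
  using tr_HA tr_LEM by (auto simp: PA_def LEM_def simp del: tr.simps)

section \<open>Conservation\<close>


lemma eqv_dn: "eqv S \<phi> \<psi> \<Longrightarrow> eqv S (dn C \<phi>) (dn C \<psi>)"
  by (intro eqv_Imp eqv_refl)

lemma stable_Or_decidable:
  assumes "decidable S \<phi>"
  shows "stable S C (Or \<phi> C)"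
  unfolding stable_def provable_Imp_iff
proof (intro ballI impI)
  fix M assume M: "M \<in> prime_theories S" "dn C (Or \<phi> C) \<in> M"
  show "Or \<phi> C \<in> M"
  proof (cases "\<phi> \<in> M")
    case False
    then have neg: "\<phi> \<notin> N" if "N \<in> prime_theories S" "M \<subseteq> N" for N
      using that assms M(1) by (auto simp: decidable_iff)
    have "C \<in> M"
      by (rule stable_bind[OF stable_self M]) (use neg in \<open>auto simp: prime_Or\<close>)
    then show ?thesis by (simp add: prime_Or[OF M(1)])
  qed (simp add: prime_Or[OF M(1)])
qed

lemma eqv_dn_decidable: "decidable S \<phi> \<Longrightarrow> eqv S (dn C (Or \<phi> C)) (Or \<phi> C)"
  using stable_Or_decidable[of S \<phi> C] dnI[of _ S "Or \<phi> C" C]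
  by (simp add: eqv_def stable_def) (simp add: provable_Imp_iff)

lemma eqv_dn_Or_self: "eqv S (dn C \<phi>) (dn C (Or \<phi> C))"
proof (rule eqvI)
  show "S \<turnstile> Imp (dn C \<phi>) (dn C (Or \<phi> C))"
    by (rule dn_mono) (simp add: provable_Imp_iff prime_Or)
  have "dn C \<phi> \<in> M" if M: "M \<in> prime_theories S" "dn C (Or \<phi> C) \<in> M" for M
  proof (rule dn_bind[OF M])
    fix N assume N: "N \<in> prime_theories S" "Or \<phi> C \<in> N"
    then consider "\<phi> \<in> N" | "C \<in> N" by (auto simp: prime_Or)
    then show "dn C \<phi> \<in> N"
    proof cases
      case 1 then show ?thesis by (rule dnI[OF N(1)])
    next
      case 2 then show ?thesis by (intro prime_ImpI[OF N(1)]) blast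
    qed
  qed
  then show "S \<turnstile> Imp (dn C (Or \<phi> C)) (dn C \<phi>)" by (simp add: provable_Imp_iff)
qed

text \<open>On decided formulas the translation merely adds C as an alternative: each
  \<open>dn C\<close> collapses by \<open>eqv_dn_decidable\<close>.\<close>

lemma tr_Fplus:
  assumes HA: "subtheory HA S" and k: "decides S k"
  shows "\<phi> \<in> Fplus_fm k \<Longrightarrow> eqv S (tr \<phi> C) (Or \<phi> C)"
proof (induction \<phi> arbitrary: C)
  case (Eq s t)
  show ?case
    using eqv_trans[OF eqv_dn_Or_self eqv_dn_decidable[OF decidable_Eq[OF HA]]] by simp
next
  case Bot
  show ?case by (simp add: eqv_iff prime_simps)
next
  case (And \<phi> \<psi>)
  then have "eqv S (tr (And \<phi> \<psi>) C) (And (Or \<phi> C) (Or \<psi> C))"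
    by (simp add: Fplus_simps eqv_And)
  moreover have "eqv S (And (Or \<phi> C) (Or \<psi> C)) (Or (And \<phi> \<psi>) C)"
    by (auto simp: eqv_iff prime_And prime_Or)
  ultimately show ?case by (rule eqv_trans)
next
  case (Or \<phi> \<psi>)
  then have "eqv S (tr (Or \<phi> \<psi>) C) (dn C (Or (Or \<phi> C) (Or \<psi> C)))"
    by (simp add: Fplus_simps eqv_dn eqv_Or)
  moreover have "eqv S (dn C (Or (Or \<phi> C) (Or \<psi> C))) (dn C (Or (Or \<phi> \<psi>) C))"
    by (rule eqv_dn) (auto simp: eqv_iff prime_Or)
  moreover have "eqv S (dn C (Or (Or \<phi> \<psi>) C)) (Or (Or \<phi> \<psi>) C)"
    by (rule eqv_dn_decidable) (rule decidable_Fplus[OF HA k Or.prems])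
  ultimately show ?case using eqv_trans by blast
next
  case (Imp \<phi> \<psi>)
  then have \<phi>: "decidable S \<phi>" using decidable_Fplus[OF HA k] by (simp add: Fplus_simps)
  have "eqv S (tr (Imp \<phi> \<psi>) C) (Imp (Or \<phi> C) (Or \<psi> C))"
    using Imp by (simp add: Fplus_simps eqv_Imp)
  moreover have "eqv S (Imp (Or \<phi> C) (Or \<psi> C)) (Imp \<phi> (Or \<psi> C))"
    by (auto simp: eqv_iff prime_Imp prime_Or)
  moreover have "eqv S (Imp \<phi> (Or \<psi> C)) (Or (Neg \<phi>) (Or \<psi> C))" by (rule eqv_Imp_Or[OF \<phi>])
  moreover have "eqv S (Or (Neg \<phi>) (Or \<psi> C)) (Or (Or (Neg \<phi>) \<psi>) C)"
    by (auto simp: eqv_iff prime_Or)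
  moreover have "eqv S (Or (Or (Neg \<phi>) \<psi>) C) (Or (Imp \<phi> \<psi>) C)"
    by (rule eqv_Or[OF eqv_sym[OF eqv_Imp_Or[OF \<phi>]] eqv_refl])
  ultimately show ?case by (meson eqv_trans)
next
  case (Ex \<phi>)
  then have "\<phi> \<in> Fplus_fm k" using Fplus_qu[of True \<phi>] by simp
  then have "eqv S (tr (Ex \<phi>) C) (dn C (Ex (Or \<phi> (shift C))))"
    using eqv_dn[OF eqv_Ex[OF Ex.IH]] by simp
  moreover have "eqv S (dn C (Ex (Or \<phi> (shift C)))) (dn C (Or (Ex \<phi>) C))"
    by (rule eqv_dn[OF eqv_sym[OF eqv_Or_Ex]])
  moreover have "eqv S (dn C (Or (Ex \<phi>) C)) (Or (Ex \<phi>) C)"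
    by (rule eqv_dn_decidable) (rule decidable_Fplus[OF HA k Ex.prems])
  ultimately show ?case by (meson eqv_trans)
next
  case (All \<phi>)
  then have \<phi>: "\<phi> \<in> Fplus_fm k" using Fplus_qu[of False \<phi>] by simp
  then have 1: "eqv S (tr (All \<phi>) C) (All (Or \<phi> (shift C)))" using eqv_All[OF All.IH] by simp
  \<comment> \<open>C cannot be decided, so \<open>All \<phi>\<close> is decided instead;
    \<open>Fplus_Ex_Neg\<close> keeps its counterexample formula within degree k.\<close>
  have neg: "eqv S (Neg (All \<phi>)) (Ex (Neg \<phi>))" and dec: "decidable S (All \<phi>)"
    using decidable_All[of S \<phi>] decidable_Fplus[OF HA k] \<phi> Fplus_Ex_Neg All.prems by blast+
  \<comment> \<open>At a counterexample to \<phi> the disjunction can hold only through C.\<close>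
  have "S \<turnstile> Imp (Ex (Neg \<phi>)) (Imp (All (Or \<phi> (shift C))) C)"
    unfolding Imp_Ex_iff shift_simps unfolding provable_Imp_iff
  proof (intro ballI impI)
    fix M assume M: "M \<in> prime_theories S" "Neg \<phi> \<in> M"
    show "Imp (shift (All (Or \<phi> (shift C)))) (shift C) \<in> M"
    proof (rule prime_ImpI[OF M(1)])
      fix N assume N: "N \<in> prime_theories S" "M \<subseteq> N" "shift (All (Or \<phi> (shift C))) \<in> N"
      have "Or \<phi> (shift C) \<in> N" by (rule prime_shift_All[OF N(1,3)])
      moreover have "\<phi> \<notin> N" using M(2) N(1,2) prime_ImpE[OF N(1), of \<phi> Bot] prime_Bot by blast
      ultimately show "shift C \<in> N" by (simp add: prime_Or[OF N(1)])
    qed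
  qed
  then have "C \<in> M" if "M \<in> prime_theories S" "Neg (All \<phi>) \<in> M" "All (Or \<phi> (shift C)) \<in> M" for M
    using that neg prime_ImpE[OF that(1), of "All (Or \<phi> (shift C))" C] by (simp add: eqv_iff provable_Imp_iff)
  then have "S \<turnstile> Imp (All (Or \<phi> (shift C))) (Or (All \<phi>) C)"
    using dec by (simp add: decidable_def provable_Imp_iff) (simp add: provable_iff prime_Or, blast)
  moreover have "S \<turnstile> Imp (Or (All \<phi>) C) (All (Or \<phi> (shift C)))"
    unfolding Imp_All_iff by (auto simp: provable_Imp_iff prime_Or dest: shift_AllD)
  ultimately show ?case using eqv_trans[OF 1 eqvI] by blast
qed

text \<open>
  A formula \<open>\<phi> \<in> \<J>\<^sub>k\<^sub>+\<^sub>1\<close> has a positive form \<open>P\<close>, built from degree \<open>\<le> k\<close> formulas by \<open>\<and>\<close>, \<open>\<or>\<close>, \<open>\<exists>\<close>,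
  which implies \<open>\<phi>\<close> and is classically equivalent to it; for \<open>\<phi> \<in> \<R>\<^sub>k\<^sub>+\<^sub>1\<close>, \<open>P\<close> is such a form of \<open>\<not>\<phi>\<close>.
\<close>

definition positive_form :: "fm set \<Rightarrow> fm \<Rightarrow> fm \<Rightarrow> bool" where
  "positive_form S \<phi> P \<longleftrightarrow> S \<turnstile> Imp P \<phi> \<and> (\<forall>C. S \<turnstile> Imp (tr \<phi> C) (dn C P))"

definition negative_form :: "fm set \<Rightarrow> fm \<Rightarrow> fm \<Rightarrow> bool" where
  "negative_form S \<phi> N \<longleftrightarrow> S \<turnstile> Imp N (Neg \<phi>) \<and> (\<forall>C. S \<turnstile> Imp (Imp N C) (tr \<phi> C))"

context
  fixes S :: "fm set"
begin

lemma positive_form_Fplus: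
  assumes "subtheory HA S" "decides S k" "\<phi> \<in> Fplus_fm k"
  shows "positive_form S \<phi> \<phi>"
proof -
  have "S \<turnstile> Imp (tr \<phi> C) (dn C \<phi>)" for C
    using tr_Fplus[OF assms, of C] dnI[of _ S "Or \<phi> C" C] eqv_dn_Or_self[of S \<phi> C]
    by (simp add: eqv_iff provable_Imp_iff)
  then show ?thesis by (simp add: positive_form_def provable_Imp_iff)
qed

text \<open>Deciding \<phi> turns the premise \<open>Imp (Neg \<phi>) C\<close> into
  \<open>Or \<phi> C\<close>, which is equivalent to the translation.\<close>

lemma negative_form_Fplus:
  assumes "subtheory HA S" "decides S k" "\<phi> \<in> Fplus_fm k"
  shows "negative_form S \<phi> (Neg \<phi>)"
proof -
  have "S \<turnstile> Imp (Imp (Neg \<phi>) C) (Or \<phi> C)" for C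
    using decidable_Fplus[OF assms] prime_ImpE[of _ S "Neg \<phi>" C]
    by (auto simp: decidable_def provable_Imp_iff provable_iff[of S "Or _ _"] prime_Or)
  moreover have "S \<turnstile> Imp (Or \<phi> C) (tr \<phi> C)" for C
    using tr_Fplus[OF assms, of C] by (simp add: eqv_def)
  ultimately have "S \<turnstile> Imp (Imp (Neg \<phi>) C) (tr \<phi> C)" for C by (rule Imp_trans)
  then show ?thesis by (simp add: negative_form_def provable_Imp_iff)
qed

lemma positive_form_And:
  assumes "positive_form S \<phi> P" "positive_form S \<psi> Q"
  shows "positive_form S (And \<phi> \<psi>) (And P Q)"
proof -
  have "dn C (And P Q) \<in> M" if M: "M \<in> prime_theories S" "And (tr \<phi> C) (tr \<psi> C) \<in> M" for C M
  proof -
    have "dn C P \<in> M" "dn C Q \<in> M"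
      using assms M by (simp_all add: positive_form_def provable_Imp_iff prime_And)
    from this(1) show ?thesis
    proof (rule dn_bind[OF M(1)])
      fix N assume N: "N \<in> prime_theories S" "M \<subseteq> N" "P \<in> N"
      with \<open>dn C Q \<in> M\<close> have "dn C Q \<in> N" by blast
      then show "dn C (And P Q) \<in> N"
      proof (rule dn_bind[OF N(1)])
        fix K assume K: "K \<in> prime_theories S" "N \<subseteq> K" "Q \<in> K"
        then have "And P Q \<in> K" using N(3) by (auto simp: prime_And)
        then show "dn C (And P Q) \<in> K" by (rule dnI[OF K(1)])
      qed
    qed
  qed
  moreover have "S \<turnstile> Imp (And P Q) (And \<phi> \<psi>)"
    using assms by (simp add: positive_form_def provable_Imp_iff prime_And)
  ultimately show ?thesis by (simp add: positive_form_def provable_Imp_iff)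
qed

lemma positive_form_Or:
  assumes "positive_form S \<phi> P" "positive_form S \<psi> Q"
  shows "positive_form S (Or \<phi> \<psi>) (Or P Q)"
proof -
  have sub: "S \<turnstile> Imp (dn C P) (dn C (Or P Q))" "S \<turnstile> Imp (dn C Q) (dn C (Or P Q))" for C
    by (intro dn_mono, simp add: provable_Imp_iff prime_Or)+
  have "dn C (Or P Q) \<in> M" if M: "M \<in> prime_theories S" "dn C (Or (tr \<phi> C) (tr \<psi> C)) \<in> M" for C M
  proof (rule dn_bind[OF M])
    fix N assume N: "N \<in> prime_theories S" "Or (tr \<phi> C) (tr \<psi> C) \<in> N"
    then have "dn C P \<in> N \<or> dn C Q \<in> N"
      using assms by (auto simp: positive_form_def provable_Imp_iff prime_Or)
    then show "dn C (Or P Q) \<in> N" using sub[of C] N(1) by (auto simp: provable_Imp_iff)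
  qed
  moreover have "S \<turnstile> Imp (Or P Q) (Or \<phi> \<psi>)"
    using assms by (auto simp: positive_form_def provable_Imp_iff prime_Or)
  ultimately show ?thesis by (simp add: positive_form_def provable_Imp_iff)
qed

lemma positive_form_Ex:
  assumes "positive_form S \<phi> P"
  shows "positive_form S (Ex \<phi>) (Ex P)"
proof -
  have "S \<turnstile> Imp (dn (shift C) P) (dn (shift C) (shift (Ex P)))" for C
    by (rule dn_mono) (auto simp: provable_Imp_iff intro: prime_shift_Ex)
  then have ex: "S \<turnstile> Imp (Ex (tr \<phi> (shift C))) (dn C (Ex P))" for C
    using assms Imp_trans unfolding positive_form_def Imp_Ex_iff shift_simps by blast
  have "dn C (Ex P) \<in> M" if M: "M \<in> prime_theories S" "dn C (Ex (tr \<phi> (shift C))) \<in> M" for C M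
    by (rule dn_bind[OF M]) (use ex in \<open>simp add: provable_Imp_iff\<close>)
  moreover have "S \<turnstile> Imp (Ex P) (Ex \<phi>)" using assms by (simp add: positive_form_def Imp_Ex_mono)
  ultimately show ?thesis by (simp add: positive_form_def provable_Imp_iff)
qed

text \<open>If N and P both imply C, the translated premise holds by way of N; the translated
  conclusion then yields \<open>dn C P\<close>, and with it C.\<close>

lemma positive_form_Imp:
  assumes "negative_form S \<phi> N" "positive_form S \<psi> P"
  shows "positive_form S (Imp \<phi> \<psi>) (Or N P)"
proof -
  have "dn C (Or N P) \<in> M" if M: "M \<in> prime_theories S" "Imp (tr \<phi> C) (tr \<psi> C) \<in> M" for C M
  proof (rule prime_ImpI[OF M(1)])
    fix K assume K: "K \<in> prime_theories S" "M \<subseteq> K" "Imp (Or N P) C \<in> K"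
    have "Imp N C \<in> K" "Imp P C \<in> K" using K(1,3) by (auto simp: prime_Imp prime_Or)
    then have "tr \<phi> C \<in> K" using assms(1) K(1) by (simp add: negative_form_def provable_Imp_iff)
    then have "tr \<psi> C \<in> K" using prime_ImpE[OF K(1)] M(2) K(2) by blast
    then have "dn C P \<in> K" using assms(2) K(1) by (simp add: positive_form_def provable_Imp_iff)
    then show "C \<in> K" using prime_ImpE[OF K(1)] \<open>Imp P C \<in> K\<close> by blast
  qed
  moreover have "Imp \<phi> \<psi> \<in> M" if M: "M \<in> prime_theories S" "Or N P \<in> M" for M
  proof (rule prime_ImpI[OF M(1)])
    fix K assume K: "K \<in> prime_theories S" "M \<subseteq> K" "\<phi> \<in> K"
    then have "\<not> N \<in> M" using assms(1) M(1) prime_ImpE[OF K(1), of \<phi> Bot] prime_Bot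
      by (auto simp: negative_form_def provable_Imp_iff)
    then have "P \<in> K" using M K(2) by (auto simp: prime_Or)
    then show "\<psi> \<in> K" using assms(2) K(1) by (simp add: positive_form_def provable_Imp_iff)
  qed
  ultimately show ?thesis by (simp add: positive_form_def provable_Imp_iff)
qed

lemma negative_form_And:
  assumes "negative_form S \<phi> N" "negative_form S \<psi> P"
  shows "negative_form S (And \<phi> \<psi>) (Or N P)"
proof -
  have "And (tr \<phi> C) (tr \<psi> C) \<in> M" if M: "M \<in> prime_theories S" "Imp (Or N P) C \<in> M" for C M
  proof -
    have "Imp N C \<in> M" "Imp P C \<in> M" using M by (auto simp: prime_Imp prime_Or)
    then show ?thesis using assms M(1) by (simp add: negative_form_def provable_Imp_iff prime_And)
  qed
  moreover have "Neg (And \<phi> \<psi>) \<in> M" if M: "M \<in> prime_theories S" "Or N P \<in> M" for M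
  proof -
    have "Neg \<phi> \<in> M \<or> Neg \<psi> \<in> M"
      using assms M by (auto simp: negative_form_def provable_Imp_iff prime_Or)
    then show ?thesis using M(1) by (auto simp: prime_Imp prime_And)
  qed
  ultimately show ?thesis by (simp add: negative_form_def provable_Imp_iff)
qed

text \<open>The disjuncts are tried in turn. Under P, the formula N leads to C, so the translated
  \<phi> holds and gives C. Hence P implies C, and the translated \<psi> holds.\<close>

lemma negative_form_Or:
  assumes "negative_form S \<phi> N" "negative_form S \<psi> P"
  shows "negative_form S (Or \<phi> \<psi>) (And N P)"
proof -
  have "dn C (Or (tr \<phi> C) (tr \<psi> C)) \<in> M" if M: "M \<in> prime_theories S" "Imp (And N P) C \<in> M" for C M
  proof (rule prime_ImpI[OF M(1)])
    fix K assume K: "K \<in> prime_theories S" "M \<subseteq> K" "Imp (Or (tr \<phi> C) (tr \<psi> C)) C \<in> K"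
    have *: "C \<in> L" if "L \<in> prime_theories S" "K \<subseteq> L" "tr \<phi> C \<in> L \<or> tr \<psi> C \<in> L" for L
      using that K(3) prime_ImpE[OF that(1), of "Or (tr \<phi> C) (tr \<psi> C)" C] by (auto simp: prime_Or)
    have "Imp P C \<in> K"
    proof (rule prime_ImpI[OF K(1)])
      fix L assume L: "L \<in> prime_theories S" "K \<subseteq> L" "P \<in> L"
      have "Imp N C \<in> L"
      proof (rule prime_ImpI[OF L(1)])
        fix L' assume L': "L' \<in> prime_theories S" "L \<subseteq> L'" "N \<in> L'"
        then have "And N P \<in> L'" using L(3) by (auto simp: prime_And)
        then show "C \<in> L'" using prime_ImpE[OF L'(1)] M(2) K(2) L(2) L'(2) by blast
      qed
      then have "tr \<phi> C \<in> L" using assms(1) L(1) by (simp add: negative_form_def provable_Imp_iff)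
      then show "C \<in> L" using * L(1,2) by blast
    qed
    then have "tr \<psi> C \<in> K" using assms(2) K(1) by (simp add: negative_form_def provable_Imp_iff)
    then show "C \<in> K" using * K(1) by blast
  qed
  moreover have "Neg (Or \<phi> \<psi>) \<in> M" if M: "M \<in> prime_theories S" "And N P \<in> M" for M
  proof -
    have "Neg \<phi> \<in> M \<and> Neg \<psi> \<in> M"
      using assms M by (auto simp: negative_form_def provable_Imp_iff prime_And)
    then show ?thesis using M(1) by (auto simp: prime_Imp prime_Or)
  qed
  ultimately show ?thesis by (simp add: negative_form_def provable_Imp_iff)
qed

text \<open>The premise \<open>Imp (Ex N) C\<close> becomes \<open>Imp N (shift C)\<close> under the
  quantifier, which is the hypothesis that the form of \<phi> requires.\<close>

lemma negative_form_All:
  assumes "negative_form S \<phi> N"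
  shows "negative_form S (All \<phi>) (Ex N)"
proof -
  have "Imp N (shift C) \<in> M" if M: "M \<in> prime_theories S" "Imp (shift (Ex N)) (shift C) \<in> M" for C M
    by (rule prime_ImpI[OF M(1)]) (use M(2) prime_shift_Ex[of _ S N] prime_ImpE in blast)
  then have "S \<turnstile> Imp (shift (Imp (Ex N) C)) (tr \<phi> (shift C))" for C
    using assms by (simp add: negative_form_def provable_Imp_iff)
  then have "S \<turnstile> Imp (Imp (Ex N) C) (tr (All \<phi>) C)" for C
    by (simp only: tr.simps Imp_All_iff)
  moreover have "S \<turnstile> Imp (Ex N) (Neg (All \<phi>))"
    using Imp_trans[OF Imp_Ex_mono Imp_Ex_Neg] assms by (simp add: negative_form_def)
  ultimately show ?thesis by (simp add: negative_form_def)
qed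

lemma negative_form_Imp:
  assumes "positive_form S \<phi> P" "negative_form S \<psi> N"
  shows "negative_form S (Imp \<phi> \<psi>) (And P N)"
proof -
  have "Imp (tr \<phi> C) (tr \<psi> C) \<in> M" if M: "M \<in> prime_theories S" "Imp (And P N) C \<in> M" for C M
  proof (rule prime_ImpI[OF M(1)])
    fix K assume K: "K \<in> prime_theories S" "M \<subseteq> K" "tr \<phi> C \<in> K"
    then have P: "dn C P \<in> K" using assms(1) by (simp add: positive_form_def provable_Imp_iff)
    have "Imp N C \<in> K"
    proof (rule prime_ImpI[OF K(1)])
      fix L assume L: "L \<in> prime_theories S" "K \<subseteq> L" "N \<in> L"
      have "Imp P C \<in> L"
      proof (rule prime_ImpI[OF L(1)])
        fix L' assume L': "L' \<in> prime_theories S" "L \<subseteq> L'" "P \<in> L'"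
        then have "And P N \<in> L'" using L(3) by (auto simp: prime_And)
        then show "C \<in> L'" using prime_ImpE[OF L'(1)] M(2) K(2) L(2) L'(2) by blast
      qed
      then show "C \<in> L" using prime_ImpE[OF L(1)] P L(2) by blast
    qed
    then show "tr \<psi> C \<in> K" using assms(2) K(1) by (simp add: negative_form_def provable_Imp_iff)
  qed
  moreover have "Neg (Imp \<phi> \<psi>) \<in> M" if M: "M \<in> prime_theories S" "And P N \<in> M" for M
  proof (rule prime_ImpI[OF M(1)])
    fix K assume K: "K \<in> prime_theories S" "M \<subseteq> K" "Imp \<phi> \<psi> \<in> K"
    have "\<phi> \<in> K" "Neg \<psi> \<in> K"
      using assms M K(1,2) by (auto simp: positive_form_def negative_form_def provable_Imp_iff prime_And)
    then show "Bot \<in> K" using prime_ImpE[OF K(1)] K(3) by blast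
  qed
  ultimately show ?thesis by (simp add: negative_form_def provable_Imp_iff)
qed

lemma is_J_positive_form:
  assumes "subtheory HA S" "decides S k"
  shows "is_R n \<phi> \<Longrightarrow> n = Suc k \<Longrightarrow> \<exists>N. negative_form S \<phi> N"
    and "is_J n \<phi> \<Longrightarrow> n = Suc k \<Longrightarrow> \<exists>P. positive_form S \<phi> P"
proof (induction rule: is_R_is_J.inducts)
  case (2 \<phi> j) then show ?case using negative_form_Fplus[OF assms, of \<phi>] by auto
next
  case (3 j \<phi> \<psi>) then show ?case using negative_form_And by meson
next
  case (4 j \<phi> \<psi>) then show ?case using negative_form_Or by meson
next
  case (5 j \<phi>) then show ?case using negative_form_All by meson
next
  case (6 j \<phi> \<psi>) then show ?case using negative_form_Imp by meson
next
  case (8 \<phi> j) then show ?case using positive_form_Fplus[OF assms, of \<phi>] by auto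
next
  case (9 j \<phi> \<psi>) then show ?case using positive_form_And by meson
next
  case (10 j \<phi> \<psi>) then show ?case using positive_form_Or by meson
next
  case (11 j \<phi>) then show ?case using positive_form_Ex by meson
next
  case (12 j \<phi> \<psi>) then show ?case using positive_form_Imp by meson
qed simp_all

lemma tr_is_J:
  assumes "subtheory HA S" "decides S k" "is_J (Suc k) \<phi>"
  shows "S \<turnstile> Imp (tr \<phi> C) (dn C \<phi>)"
proof -
  obtain P where "positive_form S \<phi> P" using is_J_positive_form(2)[OF assms] by blast
  then show ?thesis unfolding positive_form_def using dn_mono Imp_trans by blast
qed

lemma tr_is_Q:
  assumes "subtheory HA S" "decides S k" "is_Q (Suc k) \<phi>"
  shows "S \<turnstile> Imp \<phi> (tr \<phi> C)"
proof -
  have "is_Q n \<phi> \<Longrightarrow> n = Suc k \<Longrightarrow> S \<turnstile> Imp \<phi> (tr \<phi> C)" for n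
  proof (induction arbitrary: C rule: is_Q.induct)
    case (2 k s t) then show ?case using dnI[of _ S "Eq s t" C] by (simp add: provable_Imp_iff)
  next
    case (3 k) then show ?case by (simp add: provable_Imp_iff prime_Bot)
  next
    case (4 k \<phi> \<psi>) then show ?case by (simp add: provable_Imp_iff prime_And)
  next
    case (5 k \<phi> \<psi>)
    then show ?case using dnI[of _ S "Or (tr \<phi> C) (tr \<psi> C)" C]
      by (auto simp: provable_Imp_iff prime_Or)
  next
    case (6 k \<phi>) then show ?case by (simp add: Imp_All_mono)
  next
    case (7 k \<phi>)
    then have "S \<turnstile> Imp (Ex \<phi>) (Ex (tr \<phi> (shift C)))" by (simp add: Imp_Ex_mono)
    then show ?case using dnI[of _ S "Ex (tr \<phi> (shift C))" C] by (simp add: provable_Imp_iff)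
  next
    case (8 k \<phi> \<psi>)
    have "Imp (tr \<phi> C) (tr \<psi> C) \<in> M" if M: "M \<in> prime_theories S" "Imp \<phi> \<psi> \<in> M" for M
    proof (rule prime_ImpI[OF M(1)])
      fix N assume N: "N \<in> prime_theories S" "M \<subseteq> N" "tr \<phi> C \<in> N"
      \<comment> \<open>The premise is in J, so its translation yields \<open>dn C \<phi>\<close>;
        the goal is stable, so \<phi> may be assumed and fed to the original implication.\<close>
      have "dn C \<phi> \<in> N" using tr_is_J[OF assms(1,2)] 8 N by (simp add: provable_Imp_iff)
      then show "tr \<psi> C \<in> N"
      proof (rule stable_bind[OF stable_tr N(1)])
        fix K assume K: "K \<in> prime_theories S" "N \<subseteq> K" "\<phi> \<in> K"
        then have "\<psi> \<in> K" using prime_ImpE[OF K(1)] M(2) N(2) by blast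
        then show "tr \<psi> C \<in> K" using 8 K(1) by (simp add: provable_Imp_iff)
      qed
    qed
    then show ?case by (simp add: provable_Imp_iff)
  qed simp
  then show ?thesis using assms(3) by blast
qed

end

text \<open>Passing from J to V is free: conjunctions and universal closures are provable exactly
  when their parts are.\<close>

theorem conservative_V:
  assumes HA: "subtheory HA S" and k: "decides S k" and "X \<subseteq> S" "\<forall>\<phi> \<in> X. is_Q (Suc k) \<phi>"
  shows "conservative (V_fm (Suc k)) (PA \<union> X) S"
proof -
  have ax: "S \<turnstile> tr \<phi> C" if "\<phi> \<in> PA \<union> X" for \<phi> C
    using that tr_PA[OF HA] tr_is_Q[OF HA k] assms(3,4) provable_axiom provable_MP by blast
  have J: "S \<turnstile> \<phi>" if "is_J (Suc k) \<phi>" "PA \<union> X \<turnstile> \<phi>" for \<phi>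
  proof -
    have "S \<turnstile> tr \<phi> \<phi>" using tr_sound[OF that(2)[unfolded provable_def] ax] by (simp add: provable_def)
    then have "S \<turnstile> dn \<phi> \<phi>" by (rule provable_MP[OF tr_is_J[OF HA k that(1)]])
    then show ?thesis using stable_self[of S \<phi>] provable_MP unfolding stable_def by blast
  qed
  have "is_V n \<phi> \<Longrightarrow> n = Suc k \<Longrightarrow> PA \<union> X \<turnstile> \<phi> \<Longrightarrow> S \<turnstile> \<phi>" for n \<phi>
  proof (induction rule: is_V.induct)
    case (1 k \<phi>) then show ?case using J by blast
  next
    case (2 k \<phi> \<psi>) then show ?case by (simp add: provable_iff prime_And)
  next
    case (3 k \<phi>) then show ?case by (simp add: provable_All)
  qed
  then show ?thesis by (auto simp: conservative_def V_fm_def)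
qed

section \<open>Duals and the equivalences\<close>


lemma dual_qu: "dual (qu b \<phi>) = qu (\<not> b) (dual \<phi>)"
  by (simp add: qu_def)

lemma dual_qf: "qf \<phi> \<Longrightarrow> dual \<phi> = Neg \<phi>"
  by (cases \<phi>) simp_all

lemma dual_subst: "dual (subst \<sigma> \<phi>) = subst \<sigma> (dual \<phi>)"
  by (induction \<phi> arbitrary: \<sigma>) simp_all

lemma dual_shift: "dual (shift \<phi>) = shift (dual \<phi>)"
  by (simp add: shift_def dual_subst)

lemma dual_prenex: "\<phi> \<in> prenex_fm b n \<Longrightarrow> dual \<phi> \<in> prenex_fm (\<not> b) n"
proof (induction n arbitrary: b \<phi>)
  case 0 then show ?case by (simp add: dual_qf)
next
  case (Suc n)
  from Suc.prems show ?case
  proof (induction rule: prenex_fm_Suc_induct)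
    case (switch \<phi>)
    then show ?case unfolding dual_qu by (intro prenex_fm_switch Suc.IH)
  next
    case (qu \<phi>) then show ?case unfolding dual_qu by (intro prenex_fm_qu)
  qed
qed

text \<open>Holds for all formulas, since \<open>dual\<close> defaults to \<open>Neg\<close> at
  anything but a quantifier.\<close>

lemma Imp_dual_Neg: "S \<turnstile> Imp (dual \<phi>) (Neg \<phi>)"
proof (induction \<phi>)
  case (All \<phi>)
  from Imp_trans[OF Imp_Ex_mono[OF this] Imp_Ex_Neg] show ?case by simp
next
  case (Ex \<phi>)
  from Imp_All_mono[OF this] eqv_Neg_Ex[of S \<phi>] show ?case
    unfolding eqv_def dual.simps using Imp_trans by blast
qed (simp_all add: provable_Imp_iff)

lemma Imp_qu_mono: "S \<turnstile> Imp \<phi> \<psi> \<Longrightarrow> S \<turnstile> Imp (qu b \<phi>) (qu b \<psi>)"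
  by (cases b) (simp_all add: Imp_All_mono Imp_Ex_mono)

text \<open>Dualising twice only puts a double negation on the matrix, which is decidable.\<close>

lemma Imp_dual_dual:
  assumes HA: "subtheory HA S"
  shows "\<phi> \<in> prenex_fm b n \<Longrightarrow> S \<turnstile> Imp (dual (dual \<phi>)) \<phi>"
proof (induction n arbitrary: b \<phi>)
  case 0
  then have "decidable S \<phi>" using decidable_qf[OF HA] by simp
  then have "S \<turnstile> Imp (Neg (Neg \<phi>)) \<phi>"
    using prime_ImpE[of _ S "Neg \<phi>" Bot] prime_Bot[of _ S]
    by (auto simp: decidable_def provable_Imp_iff provable_iff[of S "Or _ _"] prime_Or)
  then show ?case using 0 by (simp add: dual_qf)
next
  case (Suc n)
  from Suc.prems show ?case
  proof (induction rule: prenex_fm_Suc_induct)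
    case (switch \<phi>) then show ?case using Imp_qu_mono Suc.IH by (simp add: dual_qu)
  next
    case (qu \<phi>) then show ?case using Imp_qu_mono by (simp add: dual_qu)
  qed
qed

text \<open>\<open>dual\<close> need not respect provable equivalence, so a formula moved to a
  higher class is tracked together with its dual. The dummy quantifier goes innermost, next to the
  matrix.\<close>

lemma prenex_pad:
  "\<phi> \<in> prenex_fm b n \<Longrightarrow> \<exists>\<psi> \<in> prenex_fm b (Suc n). eqv S \<phi> \<psi> \<and> eqv S (dual \<phi>) (dual \<psi>)"
proof (induction n arbitrary: b \<phi>)
  case 0
  have "qu b (shift \<phi>) \<in> prenex_fm b (Suc 0)"
    using 0 by (intro prenex_fm_switch) (simp add: shift_def)
  moreover have "eqv S \<phi> (qu b (shift \<phi>))" by (rule eqv_sym[OF eqv_qu_shift])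
  moreover have "eqv S (dual \<phi>) (dual (qu b (shift \<phi>)))"
    unfolding dual_qu dual_shift by (rule eqv_sym[OF eqv_qu_shift])
  ultimately show ?case by blast
next
  case (Suc n)
  from Suc.prems show ?case
  proof (induction rule: prenex_fm_Suc_induct)
    case (switch \<phi>)
    then obtain \<psi> where "\<psi> \<in> prenex_fm (\<not> b) (Suc n)" "eqv S \<phi> \<psi>" "eqv S (dual \<phi>) (dual \<psi>)"
      using Suc.IH by blast
    then show ?case by (intro bexI[of _ "qu b \<psi>"]) (simp_all add: dual_qu eqv_qu prenex_fm_switch)
  next
    case (qu \<phi>)
    then obtain \<psi> where "\<psi> \<in> prenex_fm b (Suc (Suc n))" "eqv S \<phi> \<psi>" "eqv S (dual \<phi>) (dual \<psi>)"
      by blast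
    then show ?case by (intro bexI[of _ "qu b \<psi>"]) (simp_all add: dual_qu eqv_qu prenex_fm_qu)
  qed
qed

lemma Or_Ex_All:
  assumes "S \<turnstile> Or \<phi> \<psi>" "decidable S (Ex \<phi>)"
  shows "S \<turnstile> Or (Ex \<phi>) (All \<psi>)"
proof -
  have "S \<turnstile> Imp (Neg (Ex \<phi>)) (All \<psi>)" unfolding Imp_All_iff shift_simps
    unfolding provable_Imp_iff
  proof (intro ballI impI)
    fix M assume M: "M \<in> prime_theories S" "Neg (shift (Ex \<phi>)) \<in> M"
    have "\<phi> \<notin> M"
      using prime_shift_Ex[OF M(1), of \<phi>] prime_ImpE[OF M] prime_Bot[OF M(1)] by blast
    then show "\<psi> \<in> M" using assms(1) M(1) by (auto simp: provable_iff prime_Or)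
  qed
  then show ?thesis
    using assms(2) by (auto simp: decidable_def provable_Imp_iff provable_iff[of S "Or _ _"] prime_Or)
qed

lemma Or_dual:
  assumes dec: "\<And>\<phi>. decidable S \<phi>"
  shows "\<phi> \<in> prenex_fm b n \<Longrightarrow> S \<turnstile> Or \<phi> (dual \<phi>)"
proof (induction n arbitrary: b \<phi>)
  case 0 then show ?case using dec[of \<phi>] by (simp add: dual_qf decidable_def)
next
  case (Suc n)
  have qu: "S \<turnstile> Or (qu b \<phi>) (dual (qu b \<phi>))" if "S \<turnstile> Or \<phi> (dual \<phi>)" for b \<phi>
  proof (cases b)
    case True
    then show ?thesis using Or_Ex_All[OF that dec] by simp
  next
    case False
    have "S \<turnstile> Or (dual \<phi>) \<phi>" using that eqv_provable[OF eqv_Or_commute] by blast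
    then have "S \<turnstile> Or (Ex (dual \<phi>)) (All \<phi>)" by (rule Or_Ex_All[OF _ dec])
    then show ?thesis using False eqv_provable[OF eqv_Or_commute] by simp
  qed
  from Suc.prems show ?case
    by (induction rule: prenex_fm_Suc_induct) (use qu Suc.IH in blast)+
qed

text \<open>The rule is applied to \<phi> and its dual, which contradict each other. Both are padded
  to Pi_{k+1}: \<phi> by an outer dummy \<open>All\<close>, the dual by an inner dummy quantifier.
  The conclusion, \<open>dual \<phi>\<close> or its dual, decides \<phi>.\<close>

lemma decides_if_DMLD_R:
  assumes HA: "subtheory HA S" and dmld: "DMLD_R (Pi_fm (Suc k)) S"
  shows "decides S k"
proof -
  have "decidable S \<phi>" if \<phi>: "\<phi> \<in> prenex_fm True k" for \<phi>
  proof -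
    have \<phi>1: "All (shift \<phi>) \<in> prenex_fm False (Suc k)"
      using prenex_fm_switch[of "shift \<phi>" False k] \<phi> by (simp add: shift_def prenex_fm_subst)
    have "dual \<phi> \<in> prenex_fm False k" using dual_prenex[OF \<phi>] by simp
    then obtain \<psi> where \<psi>: "\<psi> \<in> prenex_fm False (Suc k)" "eqv S (dual \<phi>) \<psi>"
      "eqv S (dual (dual \<phi>)) (dual \<psi>)" using prenex_pad by blast
    have *: "eqv S (And \<phi> (dual \<phi>)) (And (All (shift \<phi>)) \<psi>)"
      by (rule eqv_And[OF eqv_sym[OF eqv_All_shift] \<psi>(2)])
    have "Bot \<in> M" if M: "M \<in> prime_theories S" "And \<phi> (dual \<phi>) \<in> M" for M
      using M Imp_dual_Neg[of S \<phi>] prime_ImpE[OF M(1), of \<phi> Bot]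
      by (simp add: provable_Imp_iff prime_And)
    then have "S \<turnstile> Neg (And \<phi> (dual \<phi>))" by (simp add: provable_Imp_iff)
    then have "S \<turnstile> Neg (And (All (shift \<phi>)) \<psi>)"
      using eqv_provable[OF eqv_Imp[OF * eqv_refl]] by blast
    then have "S \<turnstile> Or (dual (All (shift \<phi>))) (dual \<psi>)"
      using dmld \<phi>1 \<psi>(1) by (simp add: DMLD_R_def prenex_fm_def del: Pi_fm.simps dual.simps)
    then have or: "S \<turnstile> Or (Ex (shift (dual \<phi>))) (dual \<psi>)" by (simp add: dual_shift)
    have "S \<turnstile> Or (dual \<phi>) (dual (dual \<phi>))"
      using or eqv_provable[OF eqv_Or[OF eqv_Ex_shift eqv_sym[OF \<psi>(3)]]] by blast
    then show ?thesis
      using Imp_dual_Neg[of S \<phi>] Imp_dual_dual[OF HA \<phi>]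
      by (auto simp: decidable_def provable_Imp_iff provable_iff[of S "Or _ _"] prime_Or)
  qed
  then show ?thesis unfolding decides_iff_LEM
    by (auto simp: proves_all_def LEM_def prenex_fm_def decidable_def)
qed

section \<open>Alternation paths of prenex formulas and inclusions between the classes\<close>

primrec alt_path :: "bool \<Rightarrow> nat \<Rightarrow> sign list" where
  "alt_path b 0 = []"
| "alt_path b (Suc n) = sgn_of b # alt_path (\<not> b) n"

lemma length_alt_path [simp]: "length (alt_path b n) = n"
  by (induction n arbitrary: b) simp_all

lemma first_alt_path: "first (alt_path (\<not> b) n) \<noteq> Some (sgn_of b)"
  by (cases n) simp_all

lemma alt_qu_singleton:
  assumes "alt \<phi> = {p}"
  shows "alt (qu b \<phi>) = {if first p = Some (sgn_of b) then p else sgn_of b # p}"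
  unfolding alt_qu assms by auto

lemma alt_prenex: "\<phi> \<in> prenex_fm b n \<Longrightarrow> alt \<phi> = {alt_path b n}"
proof (induction n arbitrary: b \<phi>)
  case 0 then show ?case by (simp add: alt_qf)
next
  case (Suc n)
  from Suc.prems show ?case
  proof (induction rule: prenex_fm_Suc_induct)
    case (switch \<phi>)
    then have "alt \<phi> = {alt_path (\<not> b) n}" by (rule Suc.IH)
    from alt_qu_singleton[OF this] show ?case using first_alt_path[of b n] by simp
  next
    case (qu \<phi>)
    from alt_qu_singleton[OF qu.IH] show ?case by simp
  qed
qed

lemma prenex_Fplus: "\<phi> \<in> prenex_fm b n \<Longrightarrow> \<phi> \<in> Fplus_fm n"
  by (simp add: Fplus_iff alt_prenex)

lemma Sigma_is_J: "\<phi> \<in> prenex_fm True (Suc k) \<Longrightarrow> is_J (Suc k) \<phi>"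
proof (induction rule: prenex_fm_Suc_induct)
  case (switch \<phi>)
  then show ?case using prenex_Fplus is_R_is_J.intros(8,11) by simp
next
  case (qu \<phi>) then show ?case using is_R_is_J.intros(11) by simp
qed

lemma Pi_is_V: "\<phi> \<in> prenex_fm False (Suc (Suc k)) \<Longrightarrow> is_V (Suc k) \<phi>"
proof (induction rule: prenex_fm_Suc_induct)
  case (switch \<phi>)
  then show ?case using Sigma_is_J is_V.intros(1,3) by simp
next
  case (qu \<phi>) then show ?case using is_V.intros(3) by simp
qed

lemma alt_bounded_switch_Fplus:
  "alt_bounded b (Suc k) (qu (\<not> b) \<phi>) \<Longrightarrow> qu (\<not> b) \<phi> \<in> Fplus_fm k"
  using alt_bounded_switch[of b k \<phi>] unfolding alt_bounded_def Fplus_iff by blast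

text \<open>Both halves go together since \<open>Imp\<close> swaps polarity. A quantifier of the
  wrong sign forces degree at most k, and both classes contain such formulas.\<close>

lemma alt_bounded_is_J_is_R:
  "(alt_bounded True (Suc k) \<phi> \<longrightarrow> is_J (Suc k) \<phi>) \<and> (alt_bounded False (Suc k) \<phi> \<longrightarrow> is_R (Suc k) \<phi>)"
proof (induction \<phi>)
  case (Eq s t) show ?case using is_R_is_J.intros(2,8) Fplus_simps(1) by blast
next
  case Bot show ?case using is_R_is_J.intros(2,8) Fplus_simps(2) by blast
next
  case (And \<phi> \<psi>)
  then show ?case unfolding alt_bounded_simps using is_R_is_J.intros(3,9)[of k \<phi> \<psi>] by blast
next
  case (Or \<phi> \<psi>)
  then show ?case unfolding alt_bounded_simps using is_R_is_J.intros(4,10)[of k \<phi> \<psi>] by blast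
next
  case (Imp \<phi> \<psi>)
  then show ?case unfolding alt_bounded_Imp using is_R_is_J.intros(6,12)[of k \<phi> \<psi>] by simp
next
  case (All \<phi>)
  have "All \<phi> \<in> Fplus_fm k" if "alt_bounded True (Suc k) (All \<phi>)"
    using alt_bounded_switch_Fplus[of True k \<phi>] that by simp
  moreover have "alt_bounded False (Suc k) \<phi>" if "alt_bounded False (Suc k) (All \<phi>)"
    using alt_bounded_qu[of False k \<phi>] that by simp
  ultimately show ?case using All is_R_is_J.intros(5)[of k \<phi>] is_R_is_J.intros(8)[of "All \<phi>" k] by blast
next
  case (Ex \<phi>)
  have "Ex \<phi> \<in> Fplus_fm k" if "alt_bounded False (Suc k) (Ex \<phi>)"
    using alt_bounded_switch_Fplus[of False k \<phi>] that by simp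
  moreover have "alt_bounded True (Suc k) \<phi>" if "alt_bounded True (Suc k) (Ex \<phi>)"
    using alt_bounded_qu[of True k \<phi>] that by simp
  ultimately show ?case using Ex is_R_is_J.intros(11)[of k \<phi>] is_R_is_J.intros(2)[of "Ex \<phi>" k] by blast
qed

lemma E_is_J: "\<phi> \<in> E_fm (Suc k) \<Longrightarrow> is_J (Suc k) \<phi>"
proof -
  assume E: "\<phi> \<in> E_fm (Suc k)"
  then have "\<forall>s \<in> alt \<phi>. length s \<le> Suc k" using deg_le_iff[of \<phi> "Suc k"] by (simp add: E_fm_def F_fm_def)
  with E have "alt_bounded True (Suc k) \<phi>" by (simp add: alt_bounded_def E_fm_def sgn_of_def)
  then show ?thesis using alt_bounded_is_J_is_R by blast
qed

text \<open>A false formula with alternating dummy quantifiers, made to raise degrees without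
  changing meaning.\<close>

primrec alt_Bot :: "bool \<Rightarrow> nat \<Rightarrow> fm" where
  "alt_Bot b 0 = Bot"
| "alt_Bot b (Suc n) = qu b (alt_Bot (\<not> b) n)"

lemma alt_Bot_prenex: "alt_Bot b n \<in> prenex_fm b n"
  by (induction n arbitrary: b) (simp_all add: prenex_fm_switch)

lemma alt_Bot_eqv: "eqv S (alt_Bot b n) Bot"
proof (induction n arbitrary: b)
  case 0 show ?case by (simp add: eqv_refl)
next
  case (Suc n)
  have "eqv S (qu b (alt_Bot (\<not> b) n)) (qu b (shift Bot))" using eqv_qu[OF Suc.IH] by simp
  then show ?case using eqv_trans[OF _ eqv_qu_shift] by simp
qed

text \<open>\<open>E_fm (Suc k)\<close> asks for degree exactly k + 1, so a false Sigma_{k+1}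
  disjunct is added. The resulting formula does not depend on S and can be used in both
  theories.\<close>

lemma F_E_eqv: "\<phi> \<in> F_fm k \<Longrightarrow> \<exists>\<psi> \<in> E_fm (Suc k). \<forall>S. eqv S \<phi> \<psi>"
proof (intro bexI allI)
  fix S
  show "eqv S \<phi> (Or \<phi> (alt_Bot True (Suc k)))"
    using alt_Bot_eqv[of S True "Suc k"] by (simp add: eqv_iff prime_Or prime_Bot del: alt_Bot.simps)
next
  assume "\<phi> \<in> F_fm k"
  then have \<phi>: "\<forall>s \<in> alt \<phi>. length s \<le> k" using deg_le_iff[of \<phi> k] by (simp add: F_fm_def)
  let ?\<psi> = "Or \<phi> (alt_Bot True (Suc k))"
  have alt: "alt ?\<psi> = alt \<phi> \<union> {alt_path True (Suc k)}"
    using alt_prenex[OF alt_Bot_prenex, of True "Suc k"] by (simp del: alt_Bot.simps alt_path.simps)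
  have "\<forall>s \<in> alt \<phi>. length s \<le> Suc k" using \<phi> le_SucI by blast
  then have "deg ?\<psi> \<le> Suc k" unfolding deg_le_iff alt ball_Un by (simp del: alt_path.simps)
  moreover have "\<not> deg ?\<psi> \<le> k" unfolding deg_le_iff alt ball_Un by (simp del: alt_path.simps)
  ultimately have "deg ?\<psi> = Suc k" by simp
  moreover have "\<forall>s \<in> alt ?\<psi>. length s = Suc k \<longrightarrow> first s = Some Plus"
    unfolding alt ball_Un using \<phi> by (simp add: sgn_of_def) (metis Suc_n_not_le_n)
  ultimately show "?\<psi> \<in> E_fm (Suc k)" unfolding E_fm_def F_fm_def by blast
qed

text \<open>The degree is exactly k because quantifier blocks are nonempty.\<close>

lemma Sigma_or_Pi_F: "\<phi> \<in> Sigma_or_Pi k \<Longrightarrow> \<phi> \<in> F_fm k"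
proof -
  assume "\<phi> \<in> Sigma_or_Pi k"
  then obtain \<sigma> \<pi> where "\<phi> = Or \<sigma> \<pi>" "\<sigma> \<in> prenex_fm True k" "\<pi> \<in> prenex_fm False k"
    by (auto simp: Sigma_or_Pi_def prenex_fm_def)
  then have "alt \<phi> = {alt_path True k, alt_path False k}" by (simp add: alt_prenex insert_commute)
  then show ?thesis by (simp add: F_fm_def deg_def)
qed

lemma subtheory_trans: "subtheory S T \<Longrightarrow> subtheory T U \<Longrightarrow> subtheory S U"
  by (simp add: subtheory_def)

lemma subtheory_axioms: "(\<And>\<phi>. \<phi> \<in> S \<Longrightarrow> T \<turnstile> \<phi>) \<Longrightarrow> subtheory S T"
  unfolding subtheory_def using provable_trans by blast

theorem theorem5p9:
  fixes k :: nat and T X :: "fm set"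
  assumes "semi_classical T"
    and "\<forall>\<phi> \<in> X. sentence \<phi> \<and> \<phi> \<in> Q_fm (k + 1)"
  shows "pairwise_equivalent
    [conservative (V_fm (k + 1)) (PA \<union> X) (T \<union> X),
     conservative (Pi_fm (k + 2)) (PA \<union> X) (T \<union> X),
     conservative (Sigma_fm (k + 1)) (PA \<union> X) (T \<union> X),
     DNE_R (Sigma_fm (k + 1)) (T \<union> X),
     DMLD_R (Pi_fm (k + 1)) (T \<union> X),
     conservative (E_fm (k + 1)) (PA \<union> X) (T \<union> X),
     conservative (F_fm k) (PA \<union> X) (T \<union> X),
     conservative (Sigma_or_Pi k) (PA \<union> X) (T \<union> X),
     proves_all (T \<union> X) (LEM (Sigma_fm k)),
     proves_all (T \<union> X) (CD (Sigma_fm k)),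
     CD_R (Sigma_fm k) (T \<union> X)]"
proof -
  let ?S = "T \<union> X" and ?P = "PA \<union> X"
  have "subtheory T ?S" "subtheory PA ?P" by (intro subtheory_axioms provable_axiom; simp)+
  have HA: "subtheory HA ?S"
    using assms(1) \<open>subtheory T ?S\<close> subtheory_trans unfolding semi_classical_def by blast
  have "subtheory T ?P"
    using assms(1) \<open>subtheory PA ?P\<close> subtheory_trans unfolding semi_classical_def by blast
  \<comment> \<open>Carries the premises of the rules over to the classical theory.\<close>
  then have SP: "?P \<turnstile> \<phi>" if "?S \<turnstile> \<phi>" for \<phi>
    using provable_trans[OF that] provable_axiom[of _ T] provable_axiom[of _ ?P]
    unfolding subtheory_def by blast
  have dec: "decidable ?P \<phi>" for \<phi>
    unfolding decidable_def by (rule provable_axiom) (auto simp: PA_def LEM_def)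

  let ?V = "conservative (V_fm (Suc k)) ?P ?S"
  \<comment> \<open>The hub: the implications below form cycles that all pass through it.\<close>
  let ?LEM = "proves_all ?S (LEM (Sigma_fm k))"
  have V_mono: "conservative \<Gamma> ?P ?S" if ?V "\<And>\<phi>. \<phi> \<in> \<Gamma> \<Longrightarrow> is_V (Suc k) \<phi>" for \<Gamma>
    using that by (auto simp: conservative_def V_fm_def)

  have 1: ?V if ?LEM
  proof (rule conservative_V[OF HA])
    show "decides ?S k" using that by (simp add: decides_iff_LEM)
    show "\<forall>\<phi> \<in> X. is_Q (Suc k) \<phi>" using assms(2) by (simp add: Q_fm_def)
  qed simp
  have 2: "conservative (Pi_fm (Suc (Suc k))) ?P ?S" if ?V
    by (rule V_mono[OF that]) (use Pi_is_V in \<open>simp add: prenex_fm_def\<close>)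
  \<comment> \<open>A dummy universal quantifier turns a Sigma_{k+1} formula into an equivalent
    Pi_{k+2} formula.\<close>
  have 3: "conservative (Sigma_fm (Suc k)) ?P ?S" if "conservative (Pi_fm (Suc (Suc k))) ?P ?S"
    unfolding conservative_def
  proof (intro ballI impI)
    fix \<phi> assume \<phi>: "\<phi> \<in> Sigma_fm (Suc k)" "?P \<turnstile> \<phi>"
    then have "All (shift \<phi>) \<in> prenex_fm False (Suc (Suc k))"
      using prenex_fm_switch[of "shift \<phi>" False "Suc k"] prenex_fm_subst[of \<phi> True "Suc k"]
      by (simp add: shift_def prenex_fm_def)
    moreover have "?P \<turnstile> All (shift \<phi>)" using \<phi>(2) eqv_provable[OF eqv_All_shift] by blast
    ultimately have "?S \<turnstile> All (shift \<phi>)"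
      using that unfolding conservative_def prenex_fm_def by (metis (full_types))
    then show "?S \<turnstile> \<phi>" using eqv_provable[OF eqv_All_shift] by blast
  qed
  have 4: "DNE_R (Sigma_fm (Suc k)) ?S" if "conservative (Sigma_fm (Suc k)) ?P ?S"
    unfolding DNE_R_def
  proof (intro ballI impI)
    fix \<phi> assume \<phi>: "\<phi> \<in> Sigma_fm (Suc k)" "?S \<turnstile> Neg (Neg \<phi>)"
    have "?P \<turnstile> \<phi>"
      using SP[OF \<phi>(2)] dec[of \<phi>] prime_ImpE[of _ ?P "Neg \<phi>" Bot] prime_Bot[of _ ?P]
      by (auto simp: decidable_def provable_iff prime_Or)
    then show "?S \<turnstile> \<phi>" using that \<phi>(1) unfolding conservative_def by blast
  qed
  have 49: ?LEM if "DNE_R (Sigma_fm (Suc k)) ?S"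
    using decides_if_DNE_R[OF decides_0[OF HA] that] by (simp add: decides_iff_LEM)
  have 5: "DMLD_R (Pi_fm (Suc k)) ?S" if ?V
    unfolding DMLD_R_def
  proof (intro ballI impI)
    fix \<phi> \<psi> assume \<phi>: "\<phi> \<in> Pi_fm (Suc k)" and \<psi>: "\<psi> \<in> Pi_fm (Suc k)" and "?S \<turnstile> Neg (And \<phi> \<psi>)"
    then have "?P \<turnstile> Neg (And \<phi> \<psi>)" using SP by blast
    moreover have "?P \<turnstile> Or \<phi> (dual \<phi>)" "?P \<turnstile> Or \<psi> (dual \<psi>)"
      using Or_dual[OF dec, of _ False "Suc k"] \<phi> \<psi> by (simp_all add: prenex_fm_def)
    ultimately have "?P \<turnstile> Or (dual \<phi>) (dual \<psi>)"
      using prime_ImpE[of _ ?P "And \<phi> \<psi>" Bot] prime_Bot[of _ ?P]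
      by (auto simp: provable_iff prime_Or prime_And)
    moreover have "is_J (Suc k) (dual \<phi>)" "is_J (Suc k) (dual \<psi>)"
      using dual_prenex[of _ False "Suc k"] \<phi> \<psi> by (simp_all add: Sigma_is_J prenex_fm_def)
    \<comment> \<open>The disjunction of two Sigma_{k+1} formulas is not itself prenex but lies in
      J, so conservation for V applies to it directly.\<close>
    then have "is_V (Suc k) (Or (dual \<phi>) (dual \<psi>))" by (intro is_V.intros(1) is_R_is_J.intros(10))
    ultimately show "?S \<turnstile> Or (dual \<phi>) (dual \<psi>)" using that by (simp add: conservative_def V_fm_def)
  qed
  have 59: ?LEM if "DMLD_R (Pi_fm (Suc k)) ?S"
    using decides_if_DMLD_R[OF HA that] by (simp add: decides_iff_LEM)
  have 6: "conservative (E_fm (Suc k)) ?P ?S" if ?V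
    by (rule V_mono[OF that]) (intro is_V.intros(1) E_is_J)
  have 7: "conservative (F_fm k) ?P ?S" if "conservative (E_fm (Suc k)) ?P ?S"
    unfolding conservative_def
  proof (intro ballI impI)
    fix \<phi> assume \<phi>: "\<phi> \<in> F_fm k" "?P \<turnstile> \<phi>"
    obtain \<psi> where \<psi>: "\<psi> \<in> E_fm (Suc k)" "\<And>S. eqv S \<phi> \<psi>" using F_E_eqv[OF \<phi>(1)] by blast
    then show "?S \<turnstile> \<phi>"
      using that \<phi>(2) eqv_provable[OF \<psi>(2)[of ?P]] eqv_provable[OF \<psi>(2)[of ?S]]
      unfolding conservative_def by blast
  qed
  have 8: "conservative (Sigma_or_Pi k) ?P ?S" if "conservative (F_fm k) ?P ?S"
    using that Sigma_or_Pi_F unfolding conservative_def by blast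
  \<comment> \<open>Classically \<open>Or \<phi> (dual \<phi>)\<close> holds and, with the dual in
    place of the negation, it belongs to the class; the dual then implies the negation
    intuitionistically.\<close>
  have 89: ?LEM if "conservative (Sigma_or_Pi k) ?P ?S"
    unfolding proves_all_def LEM_def
  proof clarify
    fix \<phi> assume \<phi>: "\<phi> \<in> Sigma_fm k"
    then have "Or \<phi> (dual \<phi>) \<in> Sigma_or_Pi k" "?P \<turnstile> Or \<phi> (dual \<phi>)"
      using dual_prenex[of \<phi> True k] Or_dual[OF dec, of \<phi> True k]
      by (auto simp: Sigma_or_Pi_def prenex_fm_def)
    then have "?S \<turnstile> Or \<phi> (dual \<phi>)" using that unfolding conservative_def by blast
    then show "?S \<turnstile> Or \<phi> (Neg \<phi>)"
      using Imp_dual_Neg[of ?S \<phi>]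
      by (auto simp: provable_Imp_iff provable_iff[of ?S "Or _ _"] prime_Or)
  qed
  have 10: "proves_all ?S (CD (Sigma_fm k))" if ?LEM
    unfolding proves_all_def CD_def
  proof clarify
    fix \<phi> \<psi> assume "\<phi> \<in> Sigma_fm k"
    then have "decidable ?S \<phi>"
      using that unfolding proves_all_def LEM_def decidable_def by blast
    then have "?S \<turnstile> Imp (All (Or \<psi> (shift \<phi>))) (Or (All \<psi>) \<phi>)"
      using eqv_Or_All[of ?S \<phi> \<psi>] by (simp add: eqv_def)
    moreover have "eqv ?S (Imp (All (Or \<psi> (shift \<phi>))) (Or (All \<psi>) \<phi>))
        (Imp (All (Or (shift \<phi>) \<psi>)) (Or \<phi> (All \<psi>)))"
      by (intro eqv_Imp eqv_All eqv_Or_commute)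
    ultimately show "?S \<turnstile> Imp (All (Or (shift \<phi>) \<psi>)) (Or \<phi> (All \<psi>))"
      using eqv_provable by blast
  qed
  have 11: "CD_R (Sigma_fm k) ?S" if "proves_all ?S (CD (Sigma_fm k))"
    unfolding CD_R_def
  proof (intro ballI impI)
    fix \<phi> \<psi> assume "\<phi> \<in> Sigma_fm k" "\<psi> \<in> Sigma_fm k" and *: "?S \<turnstile> All (Or (shift \<phi>) \<psi>)"
    then have "?S \<turnstile> Imp (All (Or (shift \<phi>) \<psi>)) (Or \<phi> (All \<psi>))"
      using that unfolding proves_all_def CD_def by blast
    then show "?S \<turnstile> Or \<phi> (All \<psi>)" using * by (rule provable_MP)
  qed
  have 119: ?LEM if "CD_R (Sigma_fm k) ?S"
    using decides_if_CD_R[OF HA that] by (simp add: decides_iff_LEM)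
  have "?V \<longleftrightarrow> ?LEM" "conservative (Pi_fm (Suc (Suc k))) ?P ?S \<longleftrightarrow> ?LEM"
    "conservative (Sigma_fm (Suc k)) ?P ?S \<longleftrightarrow> ?LEM" "DNE_R (Sigma_fm (Suc k)) ?S \<longleftrightarrow> ?LEM"
    using 1 2 3 4 49 by argo+
  moreover from this(1) have "DMLD_R (Pi_fm (Suc k)) ?S \<longleftrightarrow> ?LEM" using 5 59 by argo
  moreover have "conservative (E_fm (Suc k)) ?P ?S \<longleftrightarrow> ?LEM" "conservative (F_fm k) ?P ?S \<longleftrightarrow> ?LEM"
    "conservative (Sigma_or_Pi k) ?P ?S \<longleftrightarrow> ?LEM"
    using 1 6 7 8 89 by argo+
  moreover have "proves_all ?S (CD (Sigma_fm k)) \<longleftrightarrow> ?LEM" "CD_R (Sigma_fm k) ?S \<longleftrightarrow> ?LEM"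
    using 10 11 119 by argo+
  moreover have "k + 1 = Suc k" "k + 2 = Suc (Suc k)" by simp_all
  ultimately show ?thesis unfolding pairwise_equivalent_def by (simp only: list.set ball_simps simp_thms)
qed

end
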